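(* Fix an integer $k\geq 15$. Let $H\sim\mathcal{G}(n,m)$ with $\frac16(7k-1)n\leq m\leq n\log n$, and let $G$ be the graph obtained from $H$ by adding $\lfloor n/8\rfloor$ new edges chosen uniformly at random (a uniformly random set of $\lfloor n/8\rfloor$ pairs among those not in $E(H)$). Then the probability that $H^{(k)}$ is Hamiltonian and, at the same time, $G^{(k)}$ is connected but not Hamiltonian, is $o(n^{-3})$.
   Context: $\mathcal{G}(n,m)$ is the uniform distribution on graphs on vertex set $[n]$ with exactly $m$ edges. The $k$-core $F^{(k)}$ of a graph $F$ is its unique maximal (possibly empty) subgraph of minimum degree at least $k$. $\log$ is the natural logarithm. *)

theory Defs
  imports "HOL-Probability.Probability" "HOL-Library.Landau_Symbols"
begin

type_synonym 'a ugraph = "'a set \<times> 'a set set"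

abbreviation verts :: "'a ugraph \<Rightarrow> 'a set" where "verts \<equiv> fst"
abbreviation edges :: "'a ugraph \<Rightarrow> 'a set set" where "edges \<equiv> snd"

definition vertex_pairs :: "'a set \<Rightarrow> 'a set set" where
  "vertex_pairs V = {e. e \<subseteq> V \<and> card e = 2}"

definition simple_graph :: "'a ugraph \<Rightarrow> bool" where
  "simple_graph F \<longleftrightarrow> finite (verts F) \<and> edges F \<subseteq> vertex_pairs (verts F)"

definition subgraph :: "'a ugraph \<Rightarrow> 'a ugraph \<Rightarrow> bool" where
  "subgraph C F \<longleftrightarrow> simple_graph C \<and> verts C \<subseteq> verts F \<and> edges C \<subseteq> edges F"

definition degree :: "'a ugraph \<Rightarrow> 'a \<Rightarrow> nat" where
  "degree F v = card {e \<in> edges F. v \<in> e}"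

text \<open>The graph with no vertices has minimum degree at least \<open>k\<close> for every \<open>k\<close>.\<close>

definition min_degree_ge :: "nat \<Rightarrow> 'a ugraph \<Rightarrow> bool" where
  "min_degree_ge k F \<longleftrightarrow> (\<forall>v \<in> verts F. k \<le> degree F v)"

definition is_k_core :: "nat \<Rightarrow> 'a ugraph \<Rightarrow> 'a ugraph \<Rightarrow> bool" where
  "is_k_core k F C \<longleftrightarrow> subgraph C F \<and> min_degree_ge k C \<and>
     (\<forall>D. subgraph D F \<and> min_degree_ge k D \<and> subgraph C D \<longrightarrow> D = C)"

definition k_core :: "nat \<Rightarrow> 'a ugraph \<Rightarrow> 'a ugraph" where
  "k_core k F = (THE C. is_k_core k F C)"

lemma ex1_is_k_core:
  assumes F: "simple_graph F"
  shows "\<exists>!C. is_k_core k F C"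
proof -
  define S where "S = {D. subgraph D F \<and> min_degree_ge k D}"
  define U where "U = (\<Union>(verts ` S), \<Union>(edges ` S))"
  have finV: "finite (verts F)" and FE: "edges F \<subseteq> vertex_pairs (verts F)"
    using F by (auto simp: simple_graph_def)
  have finE: "finite (edges F)"
    by (rule finite_subset[of _ "Pow (verts F)"]) (use finV FE in \<open>auto simp: vertex_pairs_def\<close>)
  have US: "verts U \<subseteq> verts F" "edges U \<subseteq> edges F"
    by (auto simp: U_def S_def subgraph_def)
  have sim: "simple_graph U"
  proof -
    have "edges U \<subseteq> vertex_pairs (verts U)"
    proof
      fix e assume "e \<in> edges U"
      then obtain D where D: "D \<in> S" "e \<in> edges D" by (auto simp: U_def)
      then have "e \<in> vertex_pairs (verts D)" by (auto simp: S_def subgraph_def simple_graph_def)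
      moreover have "verts D \<subseteq> verts U" using D by (auto simp: U_def)
      ultimately show "e \<in> vertex_pairs (verts U)" by (auto simp: vertex_pairs_def)
    qed
    then show ?thesis using US finV by (auto simp: simple_graph_def intro: finite_subset)
  qed
  have Usub: "subgraph U F" using sim US by (simp add: subgraph_def)
  have Udeg: "min_degree_ge k U"
    unfolding min_degree_ge_def
  proof
    fix v assume "v \<in> verts U"
    then obtain D where D: "D \<in> S" "v \<in> verts D" by (auto simp: U_def)
    have "k \<le> degree D v" using D by (auto simp: S_def min_degree_ge_def)
    also have "edges D \<subseteq> edges U" using D by (auto simp: U_def)
    then have "degree D v \<le> degree U v"
      unfolding degree_def
      using US finE by (intro card_mono) (auto intro: finite_subset)
    finally show "k \<le> degree U v" .
  qed
  have max: "subgraph D U" if "subgraph D F" "min_degree_ge k D" for D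
  proof -
    have "D \<in> S" using that by (simp add: S_def)
    then have "verts D \<subseteq> verts U" "edges D \<subseteq> edges U" by (auto simp: U_def)
    then show ?thesis using that by (simp add: subgraph_def)
  qed
  have anti: "D = C" if "subgraph C D" "subgraph D C" for C D :: "'a ugraph"
    using that by (auto simp: subgraph_def prod_eq_iff)
  show ?thesis
  proof (rule ex1I)
    show "is_k_core k F U"
      unfolding is_k_core_def using Usub Udeg max anti by blast
    show "C = U" if "is_k_core k F C" for C
      using that Usub Udeg max unfolding is_k_core_def by metis
  qed
qed

definition connected_graph :: "'a ugraph \<Rightarrow> bool" where
  "connected_graph F \<longleftrightarrow> verts F \<noteq> {} \<and>
     (\<forall>u \<in> verts F. \<forall>v \<in> verts F. (u, v) \<in> {(x, y). {x, y} \<in> edges F}\<^sup>*)"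

text \<open>A Hamilton cycle is listed by its vertices in cyclic order; it has at least three vertices,
  so the empty graph is not Hamiltonian.\<close>

definition hamilton_cycle :: "'a ugraph \<Rightarrow> 'a list \<Rightarrow> bool" where
  "hamilton_cycle F c \<longleftrightarrow> 3 \<le> length c \<and> distinct c \<and> set c = verts F \<and>
     (\<forall>i < length c. {c ! i, c ! (Suc i mod length c)} \<in> edges F)"

definition hamiltonian :: "'a ugraph \<Rightarrow> bool" where
  "hamiltonian F \<longleftrightarrow> (\<exists>c. hamilton_cycle F c)"

text \<open>Here \<^const>\<open>pmf_of_set\<close> is meaningful only for a nonempty set, i.e. for
  \<open>m \<le> n choose 2\<close>; likewise \<open>add_random_edges r F\<close> needs at least \<open>r\<close> non-edges in \<open>F\<close>.\<close>

definition Gnm :: "nat \<Rightarrow> nat \<Rightarrow> nat ugraph pmf" where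
  "Gnm n m = pmf_of_set {F. simple_graph F \<and> verts F = {1..n} \<and> card (edges F) = m}"

definition add_random_edges :: "nat \<Rightarrow> 'a ugraph \<Rightarrow> 'a ugraph pmf" where
  "add_random_edges r F =
     map_pmf (\<lambda>R. (verts F, edges F \<union> R))
       (pmf_of_set {R. R \<subseteq> vertex_pairs (verts F) - edges F \<and> card R = r})"

text \<open>The joint law of \<open>(H, G)\<close>.\<close>

definition Gnm_sprinkled :: "nat \<Rightarrow> nat \<Rightarrow> nat \<Rightarrow> (nat ugraph \<times> nat ugraph) pmf" where
  "Gnm_sprinkled n m r =
     bind_pmf (Gnm n m) (\<lambda>H. map_pmf (\<lambda>G. (H, G)) (add_random_edges r H))"

end

theory Submission
  imports Defs "HOL-Real_Asymp.Real_Asymp"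
begin

text \<open>Let \<open>C\<close> and \<open>W\<close> be the vertex sets of the cores of \<open>H\<close> and \<open>G\<close>. Random edges inside \<open>C\<close> have no
  influence on \<open>W\<close>, so the core of \<open>G\<close> arises from \<open>H\<close> and the remaining random edges by sprinkling
  uniformly random edges into \<open>C\<close>. Up to a negligible probability \<open>W - C\<close> has fewer than \<open>x\<close> vertices
  for some small \<open>x\<close> of order \<open>n / \<mu>\<^sup>2\<close>, where \<open>\<mu>\<close> is the average degree, and every set \<open>S\<close> of at most
  \<open>n / 8\<close> vertices has at least \<open>2 |S|\<close> neighbours in the core: small sets because a violation would
  be a small vertex set spanning \<open>5 / 2\<close> times as many edges as vertices, large sets because it would
  leave too many pairs of \<open>H\<close> empty. By Posa's rotations a constant fraction of the pairs in \<open>C\<close> are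
  boosters: adding one lengthens the longest path or closes a Hamilton cycle. The Hamilton cycle of
  the core of \<open>H\<close> is a path missing fewer than \<open>x\<close> vertices, so fewer than \<open>x + 1\<close> boosters
  suffice, while many more are expected among the \<open>n / 8\<close> random edges.\<close>

section \<open>Counting random subsets\<close>

text \<open>The number 15 comes from small sets: if every vertex of S has 15 edges inside a set T
  with |T| < 3 |S|, then T spans more than 5 |T| / 2 edges. For \<open>k = 15\<close> the lower
  bound on m makes the average degree at least (7 * 15 - 1) / 3 = 104 / 3, and all numerical
  estimates below are tightest there. Edges of a uniform graph are not independent. The tail bounds
  for edge counts compare the hypergeometric law with independent sampling; this costs a polynomial
  factor, which the exponentially small terms absorb. Dense spots have to be excluded in G, because
  its core may contain new vertices and use new edges. Conditioning on their absence would bias the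
  random edges inside C. They are therefore tested on H together with the random edges outside C
  only; a spot found there survives in G, so nothing has to be assumed about the edges that serve as
  boosters. The upper bound on m keeps x of order at least n / log^2 n, so that every term decaying
  exponentially in x is smaller than any power of n.\<close>

lemma binomial_term_le_mode:
  fixes N r j :: nat
  assumes "r \<le> N" "j \<le> N"
  shows "(N choose j) * r ^ j * (N - r) ^ (N - j) \<le> (N choose r) * r ^ r * (N - r) ^ (N - r)"
proof -
  define t where "t i = (N choose i) * r ^ i * (N - r) ^ (N - i)" for i
  \<comment> \<open>\<open>X i\<close> is the common factor of \<open>t i\<close> and
    \<open>t (Suc i)\<close>. The two are thus compared through (N - i) r against (i + 1) (N - r)
    without a division, also for \<open>r = N\<close>; the comparison changes direction at i =
    r.\<close>
  define X where "X i = (N choose i) * r ^ i * (N - r) ^ (N - Suc i)" for i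
  have up: "Suc i * t (Suc i) = (N - i) * r * X i" and down: "Suc i * t i = Suc i * (N - r) * X i"
    if "i < N" for i
  proof -
    have "Suc i * (N choose Suc i) = (N - i) * (N choose i)"
      by (metis binomial_absorb_comp binomial_absorption)
    then have eq: "Suc i * (N choose Suc i) = (N - i) * (N choose i)" .
    have "Suc i * t (Suc i) = (Suc i * (N choose Suc i)) * (r ^ Suc i * (N - r) ^ (N - Suc i))"
      by (simp only: t_def mult.assoc)
    also have "\<dots> = (N - i) * r * X i" unfolding eq by (simp only: X_def power_Suc mult_ac)
    finally show "Suc i * t (Suc i) = (N - i) * r * X i" .
    have "N - i = Suc (N - Suc i)" using that by simp
    then have "(N - r) ^ (N - i) = (N - r) * (N - r) ^ (N - Suc i)" by (simp only: power_Suc)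
    then show "Suc i * t i = Suc i * (N - r) * X i" by (simp only: t_def X_def mult_ac)
  qed
  have inc: "t i \<le> t (Suc i)" if "i < r" for i
  proof -
    have "Suc i * (N - r) \<le> r * (N - i)" using that by (intro mult_le_mono) auto
    then have "Suc i * (N - r) * X i \<le> (N - i) * r * X i"
      by (intro mult_le_mono1) (simp only: mult.commute)
    then have "Suc i * t i \<le> Suc i * t (Suc i)" using up[of i] down[of i] that assms(1) by linarith
    then show ?thesis unfolding mult_le_cancel1 by simp
  qed
  have dec: "t (Suc i) \<le> t i" if "r \<le> i" "i < N" for i
  proof -
    have "r * (N - i) \<le> Suc i * (N - r)" using that by (intro mult_le_mono) auto
    then have "(N - i) * r * X i \<le> Suc i * (N - r) * X i"
      by (intro mult_le_mono1) (simp only: mult.commute)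
    then have "Suc i * t (Suc i) \<le> Suc i * t i" using up[of i] down[of i] that by linarith
    then show ?thesis unfolding mult_le_cancel1 by simp
  qed
  have "t j \<le> t r"
  proof (cases "j \<le> r")
    case True
    then show ?thesis
    proof (induction rule: inc_induct)
      case (step i)
      then show ?case using inc[of i] by linarith
    qed simp
  next
    case False
    then have "r \<le> j" by simp
    then show ?thesis using assms(2)
    proof (induction rule: dec_induct)
      case (step i)
      then show ?case using dec[of i] by simp
    qed simp
  qed
  then show ?thesis by (simp add: t_def)
qed

text \<open>The N + 1 binomial probabilities sum to 1 and the one at the mean r is the largest.
  Conditioning independent sampling on its total size therefore costs at most a factor N +
  1.\<close>

lemma binomial_mode_prob_ge:
  fixes N r :: nat
  assumes "r \<le> N" "0 < N"
  defines "p \<equiv> real r / real N"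
  shows "1 \<le> real (N + 1) * (real (N choose r) * p ^ r * (1 - p) ^ (N - r))"
proof -
  have "N ^ N = (r + (N - r)) ^ N" using assms by simp
  also have "\<dots> = (\<Sum>j\<le>N. (N choose j) * r ^ j * (N - r) ^ (N - j))"
    by (simp add: binomial of_nat_id)
  also have "\<dots> \<le> (\<Sum>j\<le>N. (N choose r) * r ^ r * (N - r) ^ (N - r))"
    by (intro sum_mono binomial_term_le_mode assms) simp
  also have "\<dots> = (N + 1) * ((N choose r) * r ^ r * (N - r) ^ (N - r))" by simp
  finally have "real N ^ N \<le> real ((N + 1) * ((N choose r) * r ^ r * (N - r) ^ (N - r)))"
    by (metis of_nat_le_iff of_nat_power)
  then have le: "real N ^ N \<le> real (N + 1) * (real (N choose r) * (real r ^ r * real (N - r) ^ (N - r)))"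
    by (simp only: of_nat_mult of_nat_power mult.assoc)
  have "1 - p = real (N - r) / real N"
    using assms by (simp add: p_def of_nat_diff diff_divide_distrib)
  then have "p ^ r * (1 - p) ^ (N - r) = real r ^ r * real (N - r) ^ (N - r) / (real N ^ r * real N ^ (N - r))"
    by (simp add: p_def power_divide)
  also have "real N ^ r * real N ^ (N - r) = real N ^ N" using assms(1) by (simp flip: power_add)
  finally have "real (N + 1) * (real (N choose r) * p ^ r * (1 - p) ^ (N - r))
      = real (N + 1) * (real (N choose r) * (real r ^ r * real (N - r) ^ (N - r))) / real N ^ N"
    by (simp only: mult.assoc times_divide_eq_right)
  also have "\<dots> \<ge> 1" using le assms(2) by (subst le_divide_eq_1_pos) simp_all
  finally show ?thesis .
qed

text \<open>Up to normalisation this is the generating function, at x, of the number of sampled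
  elements among a special ones. Multiplied by \<open>w\<close>, the weight of one sample of size r
  under independent sampling with probability p, each summand becomes a product of two binomial
  terms. Bounding the factor of the other b elements by 1 leaves a binomial sum, and
  \<open>binomial_mode_prob_ge\<close> removes \<open>w\<close> again.\<close>

lemma hypergeometric_pgf_le:
  fixes a b r :: nat and x :: real
  assumes r: "r \<le> a + b" and N: "0 < a + b" and x: "0 \<le> x" "x \<le> 1"
  defines "p \<equiv> real r / real (a + b)"
  shows "(\<Sum>j\<le>r. real (b choose (r - j)) * real (a choose j) * x ^ j)
    \<le> real (a + b + 1) * real ((a + b) choose r) * (1 - (1 - x) * p) ^ a"
proof -
  let ?L = "\<Sum>j\<le>r. real (b choose (r - j)) * real (a choose j) * x ^ j"
  have p: "0 \<le> p" "p \<le> 1" using r N by (auto simp: p_def divide_simps)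
  define w where "w = p ^ r * (1 - p) ^ (a + b - r)"
  have w: "0 < w"
  \<comment> \<open>In both degenerate cases \<open>w\<close> is 1, by
    \<open>0 ^ 0 = 1\<close>.\<close>
  proof (cases "r = 0 \<or> r = a + b")
    case True
    then show ?thesis using N by (auto simp: w_def p_def)
  next
    case False
    then have "0 < p" "p < 1" using r N by (auto simp: p_def divide_simps)
    then show ?thesis by (simp add: w_def)
  qed
  define f where "f j = real (a choose j) * (x * p) ^ j * (1 - p) ^ (a - j)" for j
  define g where "g i = real (b choose i) * p ^ i * (1 - p) ^ (b - i)" for i
  have fpos: "0 \<le> f j" "0 \<le> g j" for j using p x by (auto simp: f_def g_def)
  have fs: "(\<Sum>j\<le>a. f j) = (x * p + (1 - p)) ^ a" by (simp add: binomial_ring f_def)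
  have gs: "(\<Sum>j\<le>b. g j) = 1" using binomial_ring[of p "1 - p" b] by (simp add: g_def)
  have g1: "g i \<le> 1" for i
  proof (cases "i \<le> b")
    case True
    then have "g i \<le> (\<Sum>j\<le>b. g j)" using fpos by (intro member_le_sum) auto
    then show ?thesis using gs by simp
  qed (simp add: g_def binomial_eq_0)
  have "?L * w = (\<Sum>j\<le>r. f j * g (r - j))"
    unfolding sum_distrib_right
  proof (rule sum.cong[OF refl])
    fix j assume "j \<in> {..r}"
    then have j: "j \<le> r" by simp
    show "real (b choose (r - j)) * real (a choose j) * x ^ j * w = f j * g (r - j)"
    proof (cases "j \<le> a \<and> r - j \<le> b")
      case True
      then have "a + b - r = (a - j) + (b - (r - j))" using j by arith
      then have "w = (p ^ j * p ^ (r - j)) * ((1 - p) ^ (a - j) * (1 - p) ^ (b - (r - j)))"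
        using j by (simp add: w_def flip: power_add)
      then show ?thesis by (simp add: f_def g_def power_mult_distrib)
    next
      case False
      then have "(a choose j) = 0 \<or> (b choose (r - j)) = 0"
        by (auto intro: binomial_eq_0)
      then show ?thesis by (auto simp: f_def g_def)
    qed
  qed
  also have "\<dots> \<le> (\<Sum>j\<le>r. f j)"
    using fpos g1 by (intro sum_mono mult_left_le) auto
  also have "\<dots> \<le> (\<Sum>j\<le>a. f j)"
  proof (cases "r \<le> a")
    case True
    then show ?thesis using fpos by (intro sum_mono2) auto
  next
    case False
    then have "(\<Sum>j\<le>r. f j) = (\<Sum>j\<le>a. f j)"
      by (intro sum.mono_neutral_right) (auto simp: f_def binomial_eq_0)
    then show ?thesis by simp
  qed
  also have "\<dots> = (1 - (1 - x) * p) ^ a" unfolding fs by (simp add: algebra_simps)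
  finally have 1: "?L * w \<le> (1 - (1 - x) * p) ^ a" .
  have "(1 - x) * p \<le> 1" using x p by (simp add: mult_le_one)
  then have "0 \<le> (1 - (1 - x) * p) ^ a" by simp
  then have "1 * (1 - (1 - x) * p) ^ a
      \<le> (real (a + b + 1) * (real ((a + b) choose r) * w)) * (1 - (1 - x) * p) ^ a"
    using binomial_mode_prob_ge[OF r N, folded p_def]
    by (intro mult_right_mono) (simp_all add: w_def algebra_simps)
  with 1 have "?L * w \<le> (real (a + b + 1) * real ((a + b) choose r) * (1 - (1 - x) * p) ^ a) * w"
    by (simp add: mult_ac)
  then show ?thesis using w by simp
qed

lemma card_subsets_split:
  assumes fin: "finite A" "finite B" and dis: "A \<inter> B = {}"
  shows "card {R. R \<subseteq> A \<union> B \<and> card R = r \<and> Q R} =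
    (\<Sum>S | S \<subseteq> B \<and> card S \<le> r. card {T. T \<subseteq> A \<and> card T = r - card S \<and> Q (T \<union> S)})"
proof -
  let ?I = "{S. S \<subseteq> B \<and> card S \<le> r}"
  let ?J = "\<lambda>S. {T. T \<subseteq> A \<and> card T = r - card S \<and> Q (T \<union> S)}"
  have cardU: "card (T \<union> S) = card T + card S" if "T \<subseteq> A" "S \<subseteq> B" for T S
    using that fin dis by (intro card_Un_disjoint) (auto intro: finite_subset)
  have "bij_betw (\<lambda>(S, T). T \<union> S) (Sigma ?I ?J) {R. R \<subseteq> A \<union> B \<and> card R = r \<and> Q R}"
  proof (rule bij_betw_byWitness[where f' = "\<lambda>R. (R \<inter> B, R \<inter> A)"])
    show "\<forall>z\<in>Sigma ?I ?J. (\<lambda>R. (R \<inter> B, R \<inter> A)) ((\<lambda>(S, T). T \<union> S) z) = z" using dis by auto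
    show "\<forall>R\<in>{R. R \<subseteq> A \<union> B \<and> card R = r \<and> Q R}. (\<lambda>(S, T). T \<union> S) (R \<inter> B, R \<inter> A) = R" by auto
    show "(\<lambda>(S, T). T \<union> S) ` Sigma ?I ?J \<subseteq> {R. R \<subseteq> A \<union> B \<and> card R = r \<and> Q R}"
      using cardU by auto
    show "(\<lambda>R. (R \<inter> B, R \<inter> A)) ` {R. R \<subseteq> A \<union> B \<and> card R = r \<and> Q R} \<subseteq> Sigma ?I ?J"
    proof
      fix z assume "z \<in> (\<lambda>R. (R \<inter> B, R \<inter> A)) ` {R. R \<subseteq> A \<union> B \<and> card R = r \<and> Q R}"
      then obtain R where R: "z = (R \<inter> B, R \<inter> A)" "R \<subseteq> A \<union> B" "card R = r" "Q R" by auto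
      have "(R \<inter> A) \<union> (R \<inter> B) = R" using R by auto
      then show "z \<in> Sigma ?I ?J" using R cardU[of "R \<inter> A" "R \<inter> B"] by auto
    qed
  qed
  then have "card {R. R \<subseteq> A \<union> B \<and> card R = r \<and> Q R} = card (Sigma ?I ?J)"
    by (simp add: bij_betw_same_card)
  also have "\<dots> = (\<Sum>S\<in>?I. card (?J S))" using fin by (intro card_SigmaI) auto
  finally show ?thesis .
qed

text \<open>The part S of R in B is revealed first. If afterwards j uniform elements of A satisfy Q
  with probability at most c x^j, averaging over the hypergeometric j gives an exponential bound. It
  serves with x = 2 / 5 for too few edges at a set, with x = 0 for no edge at all, and with x = 1 -
  \<beta> / 2 for boosters.\<close>

lemma card_subsets_le:
  fixes c x :: real
  assumes fin: "finite A" "finite B" and dis: "A \<inter> B = {}"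
    and r: "r \<le> card A + card B" and N: "0 < card A + card B" and x: "0 \<le> x" "x \<le> 1" and c: "0 \<le> c"
    and Q: "\<And>S j. S \<subseteq> B \<Longrightarrow>
      real (card {T. T \<subseteq> A \<and> card T = j \<and> Q (T \<union> S)}) \<le> c * x ^ j * real (card A choose j)"
  defines "M \<equiv> card A + card B"
  shows "real (card {R. R \<subseteq> A \<union> B \<and> card R = r \<and> Q R})
    \<le> c * real (M + 1) * real (M choose r) * exp (- (1 - x) * real r * real (card A) / real M)"
proof -
  let ?a = "card A" and ?b = "card B"
  define h where "h i = c * x ^ (r - i) * real (?a choose (r - i))" for i
  have "real (card {R. R \<subseteq> A \<union> B \<and> card R = r \<and> Q R})
      = (\<Sum>S | S \<subseteq> B \<and> card S \<le> r. real (card {T. T \<subseteq> A \<and> card T = r - card S \<and> Q (T \<union> S)}))"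
    unfolding card_subsets_split[OF fin dis] by simp
  also have "\<dots> \<le> (\<Sum>S | S \<subseteq> B \<and> card S \<le> r. h (card S))"
    unfolding h_def by (intro sum_mono Q) auto
  also have "\<dots> = (\<Sum>i\<le>r. \<Sum>S | S \<in> {S. S \<subseteq> B \<and> card S \<le> r} \<and> card S = i. h (card S))"
    using fin by (subst sum.group) auto
  also have "\<dots> = (\<Sum>i\<le>r. real (?b choose i) * h i)"
  proof (rule sum.cong[OF refl])
    fix i assume "i \<in> {..r}"
    then have "{S. S \<in> {S. S \<subseteq> B \<and> card S \<le> r} \<and> card S = i} = {S. S \<subseteq> B \<and> card S = i}" by auto
    then show "(\<Sum>S | S \<in> {S. S \<subseteq> B \<and> card S \<le> r} \<and> card S = i. h (card S)) = real (?b choose i) * h i"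
      using n_subsets[OF fin(2), of i] by simp
  qed
  also have "\<dots> = c * (\<Sum>j\<le>r. real (?b choose (r - j)) * real (?a choose j) * x ^ j)"
    unfolding sum_distrib_left
    by (rule sum.reindex_bij_witness[of _ "\<lambda>j. r - j" "\<lambda>j. r - j"]) (auto simp: h_def)
  also have "\<dots> \<le> c * (real (M + 1) * real (M choose r) * (1 - (1 - x) * (real r / real M)) ^ ?a)"
    unfolding M_def by (intro mult_left_mono hypergeometric_pgf_le r N x c)
  also have "\<dots> \<le> c * (real (M + 1) * real (M choose r) * exp (- (1 - x) * real r * real ?a / real M))"
  proof (intro mult_left_mono c)
    define y where "y = (1 - x) * (real r / real M)"
    have "real r / real M \<le> 1" using r N by (simp add: M_def divide_simps)
    then have "y \<le> 1" unfolding y_def using x by (intro mult_le_one) auto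
    moreover have "1 - y \<le> exp (- y)" using exp_ge_add_one_self[of "- y"] by simp
    ultimately have "(1 - y) ^ ?a \<le> exp (- y) ^ ?a" by (intro power_mono) auto
    also have "\<dots> = exp (- (1 - x) * real r * real ?a / real M)"
      unfolding y_def exp_of_nat_mult[symmetric]
      by (rule arg_cong[where f = exp]) (simp add: algebra_simps diff_divide_distrib)
    finally show "(1 - (1 - x) * (real r / real M)) ^ ?a \<le> exp (- (1 - x) * real r * real ?a / real M)"
      by (simp add: y_def)
  qed simp
  finally show ?thesis by (simp add: mult.assoc)
qed

section \<open>Binomial coefficients and prescribed elements of random sets\<close>

lemma power_self_le_fact_exp: "real k ^ k \<le> fact k * exp (real k)"
proof -
  \<comment> \<open>k^k / k! is a single term of the exponential series at k.\<close>
  have "(\<Sum>n\<in>{k}. inverse (fact n) * real k ^ n) \<le> exp (real k)"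
    unfolding exp_def real_scaleR_def
    by (rule sum_le_suminf) (use summable_exp_generic[of "real k"] in auto)
  then show ?thesis by (simp add: field_simps)
qed

lemma binomial_le_exp_power:
  assumes "0 < k"
  shows "real (n choose k) \<le> (exp 1 * real n / real k) ^ k"
proof -
  have "real (n choose k) * real k ^ k \<le> real (n choose k) * (fact k * exp (real k))"
    by (intro mult_left_mono power_self_le_fact_exp) simp
  also have "\<dots> = real ((n choose k) * fact k) * exp (real k)" by simp
  also have "\<dots> \<le> real (n ^ k) * exp (real k)"
    by (intro mult_right_mono of_nat_mono binomial_fact_pow) simp
  also have "\<dots> = (exp 1 * real n) ^ k"
    by (simp add: power_mult_distrib flip: exp_of_nat_mult)
  finally show ?thesis using assms by (simp add: power_divide field_simps)
qed

text \<open>The probability that f given elements all lie in a random m-set is a product of factors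
  (m - i) / (N - i), each at most m / N.\<close>

lemma choose_diff_le:
  assumes "m \<le> N" "f \<le> m"
  shows "real ((N - f) choose (m - f)) \<le> real (N choose m) * (real m / real N) ^ f"
  using assms(2)
proof (induction f)
  case (Suc f)
  have "(m - f) * ((N - f) choose (m - f)) = (N - f) * ((N - f - 1) choose (m - f - 1))"
    using Suc.prems by (intro times_binomial_minus1_eq) simp
  then have "real (m - f) * real ((N - f) choose (m - f)) = real (N - f) * real ((N - Suc f) choose (m - Suc f))"
    by (metis Suc_eq_plus1 diff_diff_left of_nat_mult)
  moreover have pos: "0 < real (N - f)" "0 < real N" using Suc.prems assms(1) by auto
  ultimately have "real ((N - Suc f) choose (m - Suc f))
      = real (m - f) / real (N - f) * real ((N - f) choose (m - f))"
    by (simp add: field_simps)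
  also have "\<dots> \<le> real m / real N * (real (N choose m) * (real m / real N) ^ f)"
  proof (intro mult_mono)
    have "real f * real m \<le> real f * real N" using assms(1) by (intro mult_left_mono) auto
    then have "(real m - real f) * real N \<le> real m * (real N - real f)"
      by (simp add: algebra_simps)
    then show "real (m - f) / real (N - f) \<le> real m / real N"
      using pos Suc.prems assms(1) by (simp add: field_simps of_nat_diff)
  qed (use Suc in auto)
  finally show ?case by (simp add: mult_ac)
qed simp

lemma card_supersets_le:
  assumes P: "finite P" and F: "F \<subseteq> P" and m: "m \<le> card P"
  shows "real (card {E. E \<subseteq> P \<and> card E = m \<and> F \<subseteq> E})
    \<le> real (card P choose m) * (real m / real (card P)) ^ card F"
proof (cases "card F \<le> m")
  case True
  have fF: "finite F" using P F finite_subset by blast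
  have "card {E. E \<subseteq> P \<and> card E = m \<and> F \<subseteq> E} = card {D. D \<subseteq> P - F \<and> card D = m - card F}"
  proof (rule bij_betw_same_card)
    show "bij_betw (\<lambda>E. E - F) {E. E \<subseteq> P \<and> card E = m \<and> F \<subseteq> E} {D. D \<subseteq> P - F \<and> card D = m - card F}"
    proof (rule bij_betw_byWitness[where f' = "\<lambda>D. D \<union> F"])
      show "(\<lambda>D. D \<union> F) ` {D. D \<subseteq> P - F \<and> card D = m - card F} \<subseteq> {E. E \<subseteq> P \<and> card E = m \<and> F \<subseteq> E}"
      proof
        fix E assume "E \<in> (\<lambda>D. D \<union> F) ` {D. D \<subseteq> P - F \<and> card D = m - card F}"
        then obtain D where D: "E = D \<union> F" "D \<subseteq> P - F" "card D = m - card F" by auto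
        have "card (D \<union> F) = card D + card F"
          using D P fF by (intro card_Un_disjoint) (auto intro: finite_subset)
        then show "E \<in> {E. E \<subseteq> P \<and> card E = m \<and> F \<subseteq> E}" using D F True by auto
      qed
    qed (use fF in \<open>auto simp: card_Diff_subset\<close>)
  qed
  also have "\<dots> = (card P - card F) choose (m - card F)"
    using n_subsets[of "P - F" "m - card F"] P F fF by (simp add: card_Diff_subset)
  finally show ?thesis using choose_diff_le[OF m True] by simp
next
  case False
  have "{E. E \<subseteq> P \<and> card E = m \<and> F \<subseteq> E} = {}"
    using False P by (auto dest: card_mono[rotated] intro: finite_subset)
  then show ?thesis by (simp only: card.empty) simp
qed

text \<open>Edges are added one at a time; each has probability at least \<open>\<beta>\<close> of lowering \<open>D\<close>, so that
  \<open>2 ^ D\<close> shrinks by a factor \<open>1 - \<beta> / 2\<close> on average.\<close>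

lemma card_sprinkling_fails_le:
  fixes D :: "'a set \<Rightarrow> nat" and \<beta> :: real
  assumes P: "finite P" and mono: "\<And>F F'. F \<subseteq> F' \<Longrightarrow> F' \<subseteq> P \<Longrightarrow> D F' \<le> D F"
    and \<beta>: "0 \<le> \<beta>" "\<beta> \<le> 1"
    and drop: "\<And>F. F \<subseteq> P \<Longrightarrow> 0 < D F \<Longrightarrow>
      \<beta> * real (card (P - F)) \<le> real (card {e \<in> P - F. D (insert e F) < D F})"
  shows "real (card {F. F \<subseteq> P \<and> card F = s \<and> 0 < D F})
    \<le> 2 ^ D {} * (1 - \<beta> / 2) ^ s * real (card P choose s)"
proof -
  \<comment> \<open>An arbitrary starting set \<open>F0\<close> replaces the empty one, so that the
    induction can add one element and go on from there.\<close>
  define X where "X F0 s = {F. F0 \<subseteq> F \<and> F \<subseteq> P \<and> card (F - F0) = s \<and> 0 < D F}" for F0 s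
  have fX: "finite (X F0 s)" for F0 s
    by (rule finite_subset[of _ "Pow P"]) (use P in \<open>auto simp: X_def\<close>)
  have "real (card (X F0 s)) \<le> 2 ^ D F0 * (1 - \<beta> / 2) ^ s * real (card (P - F0) choose s)"
    if "F0 \<subseteq> P" for F0
    using that
  proof (induction s arbitrary: F0)
    case 0
    have "F = F0" if "F \<in> X F0 0" for F
    proof -
      have "finite (F - F0)" "card (F - F0) = 0" using that P by (auto simp: X_def intro: finite_subset)
      then show ?thesis using that by (auto simp: X_def)
    qed
    then have "X F0 0 \<subseteq> {F0}" by auto
    then have "card (X F0 0) \<le> 1" using card_mono[of "{F0}"] by simp
    then have "real (card (X F0 0)) \<le> 1" by simp
    also have "(1::real) \<le> 2 ^ D F0" by simp
    finally show ?case by simp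
  next
    case (Suc s)
    show ?case
    proof (cases "D F0 = 0")
      case True
      then have "X F0 (Suc s) = {}" using mono[of F0] by (force simp: X_def)
      then show ?thesis using \<beta> by simp
    next
      case False
      define M where "M = card (P - F0)"
      define Z where "Z = {e \<in> P - F0. D (insert e F0) < D F0}"
      have fZ: "finite Z" "Z \<subseteq> P - F0" using P by (auto simp: Z_def)
      have cZ: "\<beta> * real M \<le> real (card Z)" using drop[OF Suc.prems] False by (simp add: Z_def M_def)
      \<comment> \<open>Double counting replaces a random order: each F is counted once for every
        new element e that may have been added first.\<close>
      have "Suc s * card (X F0 (Suc s)) = (\<Sum>F\<in>X F0 (Suc s). card (F - F0))"
        by (simp add: X_def)
      also have "\<dots> = (\<Sum>F\<in>X F0 (Suc s). card {e \<in> P - F0. e \<in> F})"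
        by (intro sum.cong arg_cong[where f = card]) (auto simp: X_def)
      also have "\<dots> = (\<Sum>e\<in>P - F0. card {F \<in> X F0 (Suc s). e \<in> F})"
        using sum_multicount_gen[of "X F0 (Suc s)" "P - F0" "\<lambda>F e. e \<in> F" "\<lambda>e. card {F \<in> X F0 (Suc s). e \<in> F}"]
          fX P by simp
      also have "\<dots> \<le> (\<Sum>e\<in>P - F0. card (X (insert e F0) s))"
      proof (intro sum_mono card_mono fX subsetI)
        fix e F assume e: "e \<in> P - F0" and F: "F \<in> {F \<in> X F0 (Suc s). e \<in> F}"
        have eq: "F - F0 = insert e (F - insert e F0)" using e F by auto
        have "finite (F - insert e F0)" using F P by (auto simp: X_def intro: finite_subset)
        then have "card (F - F0) = Suc (card (F - insert e F0))"
          unfolding eq by (intro card_insert_disjoint) auto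
        then show "F \<in> X (insert e F0) s" using F by (auto simp: X_def)
      qed
      finally have "real (Suc s) * real (card (X F0 (Suc s))) \<le> (\<Sum>e\<in>P - F0. real (card (X (insert e F0) s)))"
        by (metis of_nat_mono of_nat_mult of_nat_sum)
      also have "\<dots> \<le> (\<Sum>e\<in>P - F0. 2 ^ D (insert e F0) * ((1 - \<beta> / 2) ^ s * real (M - 1 choose s)))"
      proof (rule sum_mono)
        fix e assume e: "e \<in> P - F0"
        then have "card (P - insert e F0) = M - 1"
          using P by (simp add: M_def Diff_insert[of P e F0] card_Diff_singleton)
        then show "real (card (X (insert e F0) s)) \<le> 2 ^ D (insert e F0) * ((1 - \<beta> / 2) ^ s * real (M - 1 choose s))"
          using Suc.IH[of "insert e F0"] e Suc.prems by (simp add: mult.assoc)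
      qed
      also have "\<dots> = (\<Sum>e\<in>P - F0. 2 ^ D (insert e F0)) * ((1 - \<beta> / 2) ^ s * real (M - 1 choose s))"
        by (simp add: sum_distrib_right)
      also have "\<dots> \<le> (2 ^ D F0 * ((1 - \<beta> / 2) * real M)) * ((1 - \<beta> / 2) ^ s * real (M - 1 choose s))"
      proof (rule mult_right_mono)
        have "(\<Sum>e\<in>P - F0. (2::real) ^ D (insert e F0)) = (\<Sum>e\<in>P - F0 - Z. 2 ^ D (insert e F0)) + (\<Sum>e\<in>Z. 2 ^ D (insert e F0))"
          using fZ P by (intro sum.subset_diff) auto
        \<comment> \<open>Lowering D by at least 1 halves \<open>2 ^ D\<close>; by monotonicity the
          other elements do not increase it.\<close>
        also have "\<dots> \<le> (\<Sum>e\<in>P - F0 - Z. 2 ^ D F0) + (\<Sum>e\<in>Z. 2 ^ D F0 / 2)"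
        proof (intro add_mono sum_mono)
          fix e assume "e \<in> P - F0 - Z"
          then show "(2::real) ^ D (insert e F0) \<le> 2 ^ D F0"
            using Suc.prems by (intro power_increasing mono) auto
        next
          fix e assume "e \<in> Z"
          then have "(2::real) ^ Suc (D (insert e F0)) \<le> 2 ^ D F0"
            by (intro power_increasing) (auto simp: Z_def)
          then show "(2::real) ^ D (insert e F0) \<le> 2 ^ D F0 / 2" by simp
        qed
        also have "\<dots> = 2 ^ D F0 * (real M - real (card Z) / 2)"
        proof -
          have "card (P - F0 - Z) = M - card Z" using fZ by (simp add: M_def card_Diff_subset)
          moreover have "card Z \<le> M" unfolding M_def using P fZ by (intro card_mono) auto
          ultimately show ?thesis by (simp add: of_nat_diff algebra_simps)
        qed
        also have "\<dots> \<le> 2 ^ D F0 * ((1 - \<beta> / 2) * real M)"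
          using cZ by (intro mult_left_mono) (auto simp: algebra_simps)
        finally show "(\<Sum>e\<in>P - F0. (2::real) ^ D (insert e F0)) \<le> 2 ^ D F0 * ((1 - \<beta> / 2) * real M)" .
      qed (use \<beta> in simp)
      also have "\<dots> = 2 ^ D F0 * (1 - \<beta> / 2) ^ Suc s * (real (M * (M - 1 choose s)))" by simp
      also have "M * (M - 1 choose s) = Suc s * (M choose Suc s)"
        by (simp only: binomial_absorption)
      finally have "real (Suc s) * real (card (X F0 (Suc s)))
          \<le> real (Suc s) * (2 ^ D F0 * (1 - \<beta> / 2) ^ Suc s * real (M choose Suc s))"
        by (simp only: of_nat_mult mult_ac)
      then show ?thesis unfolding M_def by (simp only: mult_le_cancel_left_pos of_nat_0_less_iff)
    qed
  qed
  from this[of "{}"] show ?thesis by (simp add: X_def)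
qed

section \<open>Rotations of longest paths\<close>

fun path_edges :: "'a list \<Rightarrow> 'a set set" where
  "path_edges (x # y # zs) = insert {x, y} (path_edges (y # zs))"
| "path_edges _ = {}"

lemma path_edges_Cons: "zs \<noteq> [] \<Longrightarrow> path_edges (y # zs) = insert {y, hd zs} (path_edges zs)"
  by (cases zs) auto

lemma path_edges_append:
  "path_edges (xs @ y # zs) = path_edges (xs @ [y]) \<union> path_edges (y # zs)"
proof (induction xs)
  case (Cons x xs)
  then show ?case by (cases xs) auto
qed simp

lemma path_edges_snoc: "xs \<noteq> [] \<Longrightarrow> path_edges (xs @ [y]) = insert {last xs, y} (path_edges xs)"
proof (induction xs)
  case (Cons x xs)
  then show ?case by (cases xs) auto
qed simp

lemma path_edges_rev: "path_edges (rev xs) = path_edges xs"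
proof (induction xs)
  case (Cons x xs)
  then show ?case
    by (cases "xs = []") (auto simp: path_edges_snoc path_edges_Cons last_rev)
qed simp

lemma path_edges_subset_set: "e \<in> path_edges xs \<Longrightarrow> e \<subseteq> set xs"
  by (induction xs rule: path_edges.induct) auto

lemma path_edges_append2:
  assumes "xs \<noteq> []" "ys \<noteq> []"
  shows "path_edges (xs @ ys) = path_edges xs \<union> path_edges ys \<union> {{last xs, hd ys}}"
  using assms path_edges_append[of xs "hd ys" "tl ys"] by (auto simp: path_edges_snoc)

definition path_nbrs :: "'a list \<Rightarrow> 'a \<Rightarrow> 'a set" where
  "path_nbrs p y = {v. {y, v} \<in> path_edges p}"

lemma path_nbrs_split:
  assumes "distinct (xs @ y # zs)"
  shows "path_nbrs (xs @ y # zs) y =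
    (if xs = [] then {} else {last xs}) \<union> (if zs = [] then {} else {hd zs})"
proof -
  have no: "path_nbrs xs y = {}" "path_nbrs zs y = {}"
    using assms path_edges_subset_set by (fastforce simp: path_nbrs_def)+
  have 1: "path_nbrs (xs @ [y]) y = (if xs = [] then {} else {last xs})"
    using no(1) by (auto simp: path_nbrs_def path_edges_snoc doubleton_eq_iff)
  have 2: "path_nbrs (y # zs) y = (if zs = [] then {} else {hd zs})"
    using no(2) by (auto simp: path_nbrs_def path_edges_Cons doubleton_eq_iff)
  have "path_nbrs (xs @ y # zs) y = path_nbrs (xs @ [y]) y \<union> path_nbrs (y # zs) y"
    by (auto simp: path_nbrs_def path_edges_append[of xs y zs])
  then show ?thesis unfolding 1 2 .
qed

lemma path_nbrs_bound:
  assumes "distinct p"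
  shows "finite (path_nbrs p y)" "card (path_nbrs p y) \<le> 2"
proof -
  have "finite (path_nbrs p y) \<and> card (path_nbrs p y) \<le> 2"
  proof (cases "y \<in> set p")
    case True
    then obtain xs zs where p: "p = xs @ y # zs" by (meson split_list)
    then show ?thesis using assms path_nbrs_split[of xs y zs] by (auto simp: card_insert_if)
  next
    case False
    then have "path_nbrs p y = {}"
      unfolding path_nbrs_def using path_edges_subset_set[of _ p] by blast
    then show ?thesis by simp
  qed
  then show "finite (path_nbrs p y)" "card (path_nbrs p y) \<le> 2" by auto
qed

lemma path_nbrs_last:
  assumes "distinct p" "p \<noteq> []"
  shows "card (path_nbrs p (last p)) \<le> 1"
proof -
  have "p = butlast p @ [last p]" using assms by simp
  then have "path_nbrs p (last p) = (if butlast p = [] then {} else {last (butlast p)})"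
    using path_nbrs_split[of "butlast p" "last p" "[]"] assms(1) by auto
  then show ?thesis by simp
qed

definition is_path :: "'a ugraph \<Rightarrow> 'a list \<Rightarrow> bool" where
  "is_path F p \<longleftrightarrow> p \<noteq> [] \<and> distinct p \<and> set p \<subseteq> verts F \<and> path_edges p \<subseteq> edges F"

definition longest_path :: "'a ugraph \<Rightarrow> 'a list \<Rightarrow> bool" where
  "longest_path F p \<longleftrightarrow> is_path F p \<and> (\<forall>q. is_path F q \<longrightarrow> length q \<le> length p)"

definition nbhd :: "'a ugraph \<Rightarrow> 'a set \<Rightarrow> 'a set" where
  "nbhd F S = {w \<in> verts F - S. \<exists>u\<in>S. {u, w} \<in> edges F}"

text \<open>Posa rotations with the first vertex fixed: the edge from the last vertex back to y
  comes in, the edge from y to its successor goes out, and that successor becomes the new last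
  vertex.\<close>

inductive_set rotations :: "'a ugraph \<Rightarrow> 'a list \<Rightarrow> 'a list set" for F p where
  rotations_refl: "p \<in> rotations F p"
| rotations_step: "xs @ y # zs \<in> rotations F p \<Longrightarrow> zs \<noteq> [] \<Longrightarrow> {last zs, y} \<in> edges F \<Longrightarrow>
    xs @ y # rev zs \<in> rotations F p"

lemma rotations_path:
  assumes "q \<in> rotations F p" "is_path F p"
  shows "is_path F q" "hd q = hd p" "set q = set p" "length q = length p"
proof -
  have "is_path F q \<and> hd q = hd p \<and> set q = set p \<and> length q = length p"
    using assms(1)
  proof induction
    case (rotations_step xs y zs)
    have "path_edges (xs @ y # rev zs) \<subseteq> edges F"
      using rotations_step
      unfolding is_path_def path_edges_append[of xs y zs] path_edges_append[of xs y "rev zs"]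
      by (auto simp: path_edges_Cons path_edges_rev hd_rev insert_commute)
    with rotations_step show ?case
      by (auto simp: is_path_def hd_append)
  qed (use assms in auto)
  then show "is_path F q" "hd q = hd p" "set q = set p" "length q = length p" by auto
qed

definition rotation_ends :: "'a ugraph \<Rightarrow> 'a list \<Rightarrow> 'a set" where
  "rotation_ends F p = last ` rotations F p"

lemma longest_path_nbhd_end:
  assumes F: "simple_graph F" and p: "longest_path F p" and xy: "{last p, y} \<in> edges F"
  shows "y \<in> set p"
proof (rule ccontr)
  assume "y \<notin> set p"
  then have "is_path F (p @ [y])"
    using p xy F by (auto simp: longest_path_def is_path_def path_edges_snoc simple_graph_def vertex_pairs_def)
  then show False using p by (force simp: longest_path_def)
qed

text \<open>If neither \<open>y\<close> nor one of its neighbours on \<open>p\<close> were an endpoint, no rotation would ever break an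
  edge of \<open>p\<close> at \<open>y\<close>; but rotating at \<open>y\<close> turns its successor, a neighbour on \<open>p\<close>, into an endpoint.\<close>

lemma nbhd_rotation_ends:
  assumes F: "simple_graph F" and p: "longest_path F p"
  shows "nbhd F (rotation_ends F p) \<subseteq> (\<Union>x\<in>rotation_ends F p. path_nbrs p x)"
proof
  fix y assume "y \<in> nbhd F (rotation_ends F p)"
  then obtain q where y: "y \<notin> rotation_ends F p" and q: "q \<in> rotations F p"
    and e: "{last q, y} \<in> edges F" by (auto simp: nbhd_def rotation_ends_def)
  have pp: "is_path F p" using p by (simp add: longest_path_def)
  note qp = rotations_path[OF q pp]
  have lq: "longest_path F q" using p qp by (simp add: longest_path_def)
  have yq: "y \<in> set q" using longest_path_nbhd_end[OF F lq e] .
  show "y \<in> (\<Union>x\<in>rotation_ends F p. path_nbrs p x)"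
  proof (rule ccontr)
    assume "\<not> ?thesis"
    then have no: "v \<notin> rotation_ends F p" if "{y, v} \<in> path_edges p" for v
      using that by (auto simp: path_nbrs_def insert_commute)
    \<comment> \<open>A rotation at w destroys only the edge {w, hd zs} and makes
      \<open>hd zs\<close> an end. An edge of p at y would have y or a path neighbour of y as that
      end, and neither is one.\<close>
    have keep: "path_nbrs p y \<subseteq> path_nbrs s y" if "s \<in> rotations F p" for s
      using that
    proof induction
      case (rotations_step xs w zs)
      have new: "xs @ w # rev zs \<in> rotations F p"
        using rotations_step.hyps by (rule rotations.rotations_step)
      then have "last (xs @ w # rev zs) \<in> rotation_ends F p"
        unfolding rotation_ends_def by (rule imageI)
      then have h: "hd zs \<in> rotation_ends F p" using rotations_step by (simp add: last_rev)
      show ?case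
      proof
        fix v assume v: "v \<in> path_nbrs p y"
        then have "{y, v} \<in> path_edges (xs @ w # zs)" using rotations_step.IH by (auto simp: path_nbrs_def)
        moreover have "{y, v} \<noteq> {w, hd zs}"
          using h y no[of v] v by (auto simp: doubleton_eq_iff path_nbrs_def)
        ultimately have "{y, v} \<in> path_edges (xs @ w # rev zs)"
          using rotations_step(2) unfolding path_edges_append[of xs w zs] path_edges_append[of xs w "rev zs"]
          by (auto simp: path_edges_Cons path_edges_rev)
        then show "v \<in> path_nbrs (xs @ w # rev zs) y" by (simp add: path_nbrs_def)
      qed
    qed simp
    obtain xs zs where qs: "q = xs @ y # zs" using yq by (meson split_list)
    have "y \<noteq> last q" using y q by (auto simp: rotation_ends_def)
    then have zs: "zs \<noteq> []" using qs by auto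
    have "last (xs @ y # rev zs) \<in> rotation_ends F p"
      unfolding rotation_ends_def
      by (rule imageI, rule rotations_step) (use q qs zs e in auto)
    then have z: "hd zs \<in> rotation_ends F p" using zs by (simp add: last_rev)
    have dq: "distinct q" using qp by (simp add: is_path_def)
    have nq: "path_nbrs q y = (if xs = [] then {} else {last xs}) \<union> {hd zs}"
      using path_nbrs_split[of xs y zs] dq qs zs by simp
    have "y \<in> set p" using yq qp by simp
    then obtain xs' zs' where ps: "p = xs' @ y # zs'" by (meson split_list)
    have "y \<noteq> last p" using y rotations_refl[of p F] by (auto simp: rotation_ends_def)
    then have zs': "zs' \<noteq> []" using ps by auto
    have dp: "distinct p" using pp by (simp add: is_path_def)
    have np: "path_nbrs p y = (if xs' = [] then {} else {last xs'}) \<union> {hd zs'}"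
      using path_nbrs_split[of xs' y zs'] dp ps zs' by simp
    have sub: "path_nbrs p y \<subseteq> path_nbrs q y" by (rule keep[OF q])
    \<comment> \<open>If y comes first on q, its successor is its only neighbour on q and the
      nonempty \<open>path_nbrs p y\<close> must consist of it. Otherwise y is inner on p, since
      rotations fix the first vertex; it has two neighbours on p and at most two on q, so that the
      inclusion \<open>sub\<close> is an equality.\<close>
    have "hd zs \<in> path_nbrs p y"
    proof (cases "xs = []")
      case True
      then show ?thesis using sub np nq by auto
    next
      case False
      have "y \<noteq> hd q" using False qs dq by auto
      then have "xs' \<noteq> []" using ps qp(2) by auto
      moreover have "last xs' \<noteq> hd zs'"
        using dp ps zs' \<open>xs' \<noteq> []\<close> by (metis disjoint_iff distinct_append hd_in_set last_in_set list.set_intros(2))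
      ultimately have "card (path_nbrs p y) = 2" using np by simp
      moreover have "card (path_nbrs q y) \<le> 2" "finite (path_nbrs q y)" using path_nbrs_bound[OF dq] by auto
      ultimately have "path_nbrs p y = path_nbrs q y" using sub by (intro card_subset_eq) (auto intro: antisym card_mono dest: card_mono)
      then show ?thesis using nq by simp
    qed
    then show False using no z by (simp add: path_nbrs_def)
  qed
qed

text \<open>Every rotation end has at most two neighbours on p, and \<open>last p\<close>, itself a
  rotation end, has only one. This one is what makes the inequality strict.\<close>

lemma posa:
  assumes F: "simple_graph F" and p: "longest_path F p"
  shows "card (nbhd F (rotation_ends F p)) < 2 * card (rotation_ends F p)"
proof -
  have pp: "is_path F p" using p by (simp add: longest_path_def)
  let ?E = "rotation_ends F p"
  have "q \<in> rotations F p \<Longrightarrow> last q \<in> set p" for q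
    using rotations_path[OF _ pp, of q] by (metis is_path_def last_in_set)
  then have "?E \<subseteq> set p" by (auto simp: rotation_ends_def)
  then have fin: "finite ?E" by (rule finite_subset) simp
  have l: "last p \<in> ?E" using rotations_refl[of p F] by (auto simp: rotation_ends_def)
  have d: "distinct p" "p \<noteq> []" using pp by (auto simp: is_path_def)
  have "card (nbhd F ?E) \<le> card (\<Union>x\<in>?E. path_nbrs p x)"
    by (rule card_mono) (use fin path_nbrs_bound[OF d(1)] nbhd_rotation_ends[OF F p] in auto)
  also have "\<dots> \<le> (\<Sum>x\<in>?E. card (path_nbrs p x))" by (rule card_UN_le[OF fin])
  also have "\<dots> = card (path_nbrs p (last p)) + (\<Sum>x\<in>?E - {last p}. card (path_nbrs p x))"
    using l fin by (simp add: sum.remove)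
  also have "\<dots> \<le> 1 + (\<Sum>x\<in>?E - {last p}. 2)"
    by (intro add_mono sum_mono path_nbrs_last path_nbrs_bound d)
  also have "\<dots> = 1 + 2 * (card ?E - 1)" using l fin by simp
  also have "\<dots> < 2 * card ?E" using l fin card_gt_0_iff[of ?E] by auto
  finally show ?thesis .
qed

section \<open>Deficiency and boosters\<close>

definition path_number :: "'a ugraph \<Rightarrow> nat" where
  "path_number F = Max (length ` {p. is_path F p})"

text \<open>An upper bound on the number of boosters still needed, for a nonempty graph: each
  lengthens the longest path or finishes a Hamilton cycle. \<open>Suc\<close> accounts for the edge
  that closes a Hamilton path.\<close>

definition deficiency :: "'a ugraph \<Rightarrow> nat" where
  "deficiency F = (if hamiltonian F then 0 else Suc (card (verts F)) - path_number F)"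

lemma path_length_le: "simple_graph F \<Longrightarrow> is_path F p \<Longrightarrow> length p \<le> card (verts F)"
  by (metis card_mono distinct_card is_path_def simple_graph_def)

lemma finite_path_lengths: "simple_graph F \<Longrightarrow> finite (length ` {p. is_path F p})"
  by (rule finite_subset[of _ "{..card (verts F)}"]) (auto simp: path_length_le)

lemma path_number_ge: "simple_graph F \<Longrightarrow> is_path F p \<Longrightarrow> length p \<le> path_number F"
  unfolding path_number_def by (intro Max_ge finite_path_lengths) auto

lemma ex_longest_path:
  assumes "simple_graph F" "verts F \<noteq> {}"
  obtains p where "longest_path F p" "length p = path_number F"
proof -
  obtain v where "v \<in> verts F" using assms by auto
  then have "is_path F [v]" by (auto simp: is_path_def)
  then have "length ` {p. is_path F p} \<noteq> {}" by auto
  then have "path_number F \<in> length ` {p. is_path F p}"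
    unfolding path_number_def by (intro Max_in finite_path_lengths assms)
  then obtain p where "is_path F p" "length p = path_number F" by auto
  then show ?thesis using path_number_ge[OF assms(1)] that by (auto simp: longest_path_def)
qed

lemma path_number_le: "simple_graph F \<Longrightarrow> verts F \<noteq> {} \<Longrightarrow> path_number F \<le> card (verts F)"
  by (metis ex_longest_path longest_path_def path_length_le)

lemma deficiency_pos_iff:
  "simple_graph F \<Longrightarrow> verts F \<noteq> {} \<Longrightarrow> 0 < deficiency F \<longleftrightarrow> \<not> hamiltonian F"
  using path_number_le[of F] by (auto simp: deficiency_def)

lemma hamiltonian_mono:
  
  assumes "hamiltonian (V, E)" "E \<subseteq> E'"
  shows "hamiltonian (V, E')"
proof -
  obtain c where "hamilton_cycle (V, E) c" using assms(1) by (auto simp: hamiltonian_def)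
  then have "hamilton_cycle (V, E') c" using assms(2) by (auto simp: hamilton_cycle_def)
  then show ?thesis by (auto simp: hamiltonian_def)
qed

lemma is_path_mono: "is_path (V, E) p \<Longrightarrow> E \<subseteq> E' \<Longrightarrow> is_path (V, E') p"
  by (auto simp: is_path_def)

lemma deficiency_mono:
  assumes "simple_graph (V, E')" "E \<subseteq> E'" "V \<noteq> {}"
  shows "deficiency (V, E') \<le> deficiency (V, E)"
proof -
  have "simple_graph (V, E)" using assms by (auto simp: simple_graph_def)
  then obtain p where p: "is_path (V, E) p" "length p = path_number (V, E)"
    using assms(3) by (metis ex_longest_path fst_conv longest_path_def)
  then have "path_number (V, E) \<le> path_number (V, E')"
    using path_number_ge[OF assms(1)] is_path_mono[OF _ assms(2)] by metis
  then show ?thesis using hamiltonian_mono[OF _ assms(2)] by (auto simp: deficiency_def)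
qed

lemma hamilton_cycle_of_path:
  assumes "distinct q" "3 \<le> length q" "set q = verts F" "path_edges q \<subseteq> edges F"
    "{last q, hd q} \<in> edges F"
  shows "hamiltonian F"
proof -
  have nth: "{q ! i, q ! Suc i} \<in> path_edges q" if "Suc i < length q" for q :: "'a list" and i
    using that
  proof (induction q arbitrary: i rule: path_edges.induct)
    case (1 x y zs)
    then show ?case by (cases i) auto
  qed auto
  have "{q ! i, q ! (Suc i mod length q)} \<in> edges F" if "i < length q" for i
  proof (cases "Suc i < length q")
    case True
    then show ?thesis using nth[OF True] assms by auto
  next
    case False
    then have "Suc i = length q" using that by simp
    then have "i = length q - 1" "Suc i mod length q = 0" "q \<noteq> []" by auto
    then have "q ! i = last q" "q ! (Suc i mod length q) = hd q"
      by (simp_all add: last_conv_nth hd_conv_nth)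
    then show ?thesis using assms by simp
  qed
  then show ?thesis using assms by (auto simp: hamiltonian_def hamilton_cycle_def)
qed

lemma path_of_hamilton_cycle:
  assumes "hamiltonian F"
  obtains p where "is_path F p" "length p = card (verts F)" "3 \<le> length p"
proof -
  obtain c where c: "hamilton_cycle F c" using assms by (auto simp: hamiltonian_def)
  have sub: "path_edges xs \<subseteq> X" if "\<And>i. Suc i < length xs \<Longrightarrow> {xs ! i, xs ! Suc i} \<in> X"
    for xs :: "'a list" and X
    using that
  proof (induction xs rule: path_edges.induct)
    case (1 x y zs)
    have "{x, y} \<in> X" using 1(2)[of 0] by simp
    moreover have "path_edges (y # zs) \<subseteq> X" by (rule 1(1)) (use 1(2)[of "Suc _"] in auto)
    ultimately show ?case by simp
  qed auto
  have "path_edges c \<subseteq> edges F"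
  proof (rule sub)
    fix i assume "Suc i < length c"
    then show "{c ! i, c ! Suc i} \<in> edges F"
      using c by (metis Suc_lessD hamilton_cycle_def mod_less)
  qed
  then have "is_path F c" "length c = card (verts F)" "3 \<le> length c"
    using c distinct_card[of c] by (auto simp: is_path_def hamilton_cycle_def)
  then show ?thesis using that by blast
qed

text \<open>An edge joining the ends of a longest path closes it to a cycle, which is Hamiltonian or
  can be opened next to a vertex outside.\<close>

lemma closing_edge_deficiency:
  assumes F: "simple_graph (V, E)" and p: "longest_path (V, E) p" and len: "3 \<le> length p"
    and out: "set p \<noteq> V \<Longrightarrow> nbhd (V, E) (V - set p) \<noteq> {}"
    and nh: "\<not> hamiltonian (V, E)"
    and F': "simple_graph (V, insert {hd p, last p} E)"
  shows "deficiency (V, insert {hd p, last p} E) < deficiency (V, E)"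
proof -
  let ?F' = "(V, insert {hd p, last p} E)"
  have pp: "is_path (V, E) p" using p by (simp add: longest_path_def)
  then have V: "V \<noteq> {}" by (auto simp: is_path_def)
  have le: "path_number (V, E) = length p"
  proof (rule antisym)
    obtain q where "longest_path (V, E) q" "length q = path_number (V, E)"
      using ex_longest_path[OF F] V by auto
    then show "path_number (V, E) \<le> length p" using p by (metis longest_path_def)
  qed (use path_number_ge[OF F pp] in simp)
  have pos: "0 < deficiency (V, E)" using deficiency_pos_iff[OF F] V nh by simp
  show ?thesis
  proof (cases "set p = V")
    case True
    have "hamiltonian ?F'"
      by (rule hamilton_cycle_of_path[of p]) (use pp len True in \<open>auto simp: is_path_def insert_commute\<close>)
    then show ?thesis using pos by (simp add: deficiency_def)
  next
    case False
    then obtain u w where u: "u \<in> set p" and w: "w \<in> V - set p" and e: "{u, w} \<in> E"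
      using out[OF False] by (auto simp: nbhd_def insert_commute)
    obtain xs ys where ps: "p = xs @ u # ys" using u by (meson split_list)
    \<comment> \<open>The cycle is opened just behind u: run through \<open>ys\<close>, take the
      closing edge back to the start of p, follow \<open>xs\<close> up to u and leave to w. For
      empty \<open>ys\<close> the closing edge is not on this path.\<close>
    let ?q = "(ys @ xs @ [u]) @ [w]"
    have 1: "path_edges p = path_edges (xs @ [u]) \<union> path_edges (u # ys)"
      using ps path_edges_append by metis
    have "path_edges (ys @ xs @ [u]) \<subseteq> edges ?F'"
    proof (cases "ys = []")
      case True
      then show ?thesis using 1 pp by (auto simp: is_path_def)
    next
      case False
      have "hd p = hd (xs @ [u])" "last p = last ys" using ps False by (cases xs; auto)+
      moreover have "path_edges (xs @ [u]) \<subseteq> E" "path_edges ys \<subseteq> E"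
        using 1 pp False by (auto simp: is_path_def path_edges_Cons)
      ultimately show ?thesis
        using path_edges_append2[OF False, of "xs @ [u]"] by (auto simp: insert_commute)
    qed
    then have "is_path ?F' ?q"
      using pp ps w e path_edges_snoc[of "ys @ xs @ [u]" w] by (auto simp: is_path_def)
    then have "length ?q \<le> path_number ?F'" by (rule path_number_ge[OF F'])
    moreover have "length ?q = Suc (length p)" using ps by simp
    ultimately have "Suc (path_number (V, E)) \<le> path_number ?F'" using le by simp
    moreover have "path_number (V, E) \<le> card V" using path_number_le[OF F] V by simp
    ultimately show ?thesis using nh by (auto simp: deficiency_def)
  qed
qed

text \<open>n is a separate parameter because it will be the number of all vertices, also when F is
  a core with fewer vertices.\<close>

definition expander :: "nat \<Rightarrow> 'a ugraph \<Rightarrow> bool" where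
  "expander n F \<longleftrightarrow> (\<forall>S \<subseteq> verts F. 8 * card S \<le> n \<longrightarrow> 2 * card S \<le> card (nbhd F S))"

lemma expander_mono:
  assumes "expander n (V, E)" "E \<subseteq> E'" "finite V"
  shows "expander n (V, E')"
  unfolding expander_def
proof (intro allI impI)
  fix S assume "S \<subseteq> verts (V, E')" "8 * card S \<le> n"
  then have "2 * card S \<le> card (nbhd (V, E) S)" using assms by (auto simp: expander_def)
  also have "\<dots> \<le> card (nbhd (V, E') S)"
    by (rule card_mono) (use assms in \<open>auto simp: nbhd_def\<close>)
  finally show "2 * card S \<le> card (nbhd (V, E') S)" .
qed

lemma rotation_ends_large:
  assumes "simple_graph F" "longest_path F p" "expander n F"
  shows "n < 8 * card (rotation_ends F p)"
proof (rule ccontr)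
  have "rotation_ends F p \<subseteq> verts F"
    using rotations_path[of _ F p] assms(2)
    by (force simp: rotation_ends_def longest_path_def is_path_def)
  moreover assume "\<not> ?thesis"
  ultimately show False using posa[OF assms(1,2)] assms(3) by (auto simp: expander_def)
qed

lemma longest_path_rev: "longest_path F p \<Longrightarrow> longest_path F (rev p)"
  by (auto simp: longest_path_def is_path_def path_edges_rev)

lemma longest_path_rotation:
  assumes "longest_path F p" "q \<in> rotations F p"
  shows "longest_path F q" "hd q = hd p" "length q = length p"
  using assms rotations_path[of q F p] by (auto simp: longest_path_def)

lemma card_unordered:
  assumes "finite B" "\<And>x y. (x, y) \<in> B \<Longrightarrow> x \<noteq> y"
  shows "card B \<le> 2 * card ((\<lambda>(x, y). {x, y}) ` B)"
proof -
  let ?f = "\<lambda>(x, y). {x, y}"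
  have 1: "card B = (\<Sum>e\<in>?f ` B. card {z \<in> B. ?f z = e})"
    using sum.image_gen[OF assms(1), of "\<lambda>_. 1::nat" ?f] by simp
  have 2: "(\<Sum>e\<in>?f ` B. card {z \<in> B. ?f z = e}) \<le> (\<Sum>e\<in>?f ` B. 2)"
  proof (rule sum_mono)
    fix e assume "e \<in> ?f ` B"
    then obtain x y where e: "e = {x, y}" by auto
    have "{z \<in> B. ?f z = e} \<subseteq> {(x, y), (y, x)}"
    proof
      fix z assume z: "z \<in> {z \<in> B. ?f z = e}"
      obtain a b where ab: "z = (a, b)" by (rule prod.exhaust)
      have "{a, b} = {x, y}" using z e ab by simp
      then show "z \<in> {(x, y), (y, x)}" unfolding doubleton_eq_iff ab by blast
    qed
    then have "card {z \<in> B. ?f z = e} \<le> card {(x, y), (y, x)}" by (intro card_mono) auto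
    also have "\<dots> \<le> 2" using card_length[of "[(x, y), (y, x)]"] by simp
    finally show "card {z \<in> B. ?f z = e} \<le> 2" .
  qed
  show ?thesis using 2 unfolding 1[symmetric] sum_constant by (simp only: of_nat_id mult.commute)
qed

text \<open>Rotations of a longest path give more than n / 8 last vertices, and rotating the other
  end of each resulting path gives as many first vertices. Boosters have to lie inside C, which
  loses at most d choices at either end. A pair may arise in both orders, hence the factor
  2.\<close>

lemma many_boosters:
  assumes F: "simple_graph (V, E)" and ex: "expander n (V, E)" and nh: "\<not> hamiltonian (V, E)"
    and C: "C \<subseteq> V" "card (V - C) \<le> d" "8 * d \<le> n"
    and long: "card C \<le> path_number (V, E)" "3 \<le> card C"
  defines "B \<equiv> {e \<in> vertex_pairs C - E. deficiency (V, insert e E) < deficiency (V, E)}"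
  shows "(real n / 8 - real d)\<^sup>2 \<le> 2 * real (card B)"
proof -
  have fV: "finite V" using F by (simp add: simple_graph_def)
  have V: "V \<noteq> {}" using C long by auto
  have fC: "finite C" using fV C(1) finite_subset by blast
  obtain p where p: "longest_path (V, E) p" and lp: "length p = path_number (V, E)"
    using ex_longest_path[OF F] V by auto
  define L where "L = {q. longest_path (V, E) q \<and> length q = length p}"
  define Z where "Z = {(hd q, last q) | q. q \<in> L \<and> hd q \<in> C \<and> last q \<in> C}"
  have pp: "is_path (V, E) q" if "q \<in> L" for q using that by (simp add: L_def longest_path_def)
  \<comment> \<open>A longest path has at least |C| vertices, so it misses at most d <= n / 8. The
    missed set is small enough to expand, hence some edge leaves it.\<close>
  have out: "nbhd (V, E) (V - set q) \<noteq> {}" if "q \<in> L" "set q \<noteq> V" for q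
  proof
    assume "nbhd (V, E) (V - set q) = {}"
    moreover have q: "set q \<subseteq> V" "distinct q" using pp[OF that(1)] by (auto simp: is_path_def)
    have "card C \<le> card (set q)" using that long lp by (simp add: L_def distinct_card[OF q(2)])
    then have "8 * card (V - set q) \<le> n"
      using C q fV fC by (auto simp: card_Diff_subset finite_subset)
    then have "2 * card (V - set q) \<le> card (nbhd (V, E) (V - set q))" using ex by (simp add: expander_def)
    ultimately have "card (V - set q) = 0" by simp
    then show False using that q fV by auto
  qed
  have red: "{x, y} \<in> B" "x \<noteq> y" "x \<in> C" "y \<in> C" if xy: "(x, y) \<in> Z" for x y
  proof -
    obtain q where q: "q \<in> L" "hd q = x" "last q = y" and c: "x \<in> C" "y \<in> C"
      using xy by (auto simp: Z_def)
    have l3: "3 \<le> length q" using q long lp by (simp add: L_def)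
    have "distinct q" using pp[OF q(1)] by (simp add: is_path_def)
    then show ne: "x \<noteq> y"
      using q l3 by (cases q) (auto simp: Suc_le_eq split: if_splits)
    have vp: "{x, y} \<in> vertex_pairs C" using c ne by (simp add: vertex_pairs_def)
    then have F': "simple_graph (V, insert {hd q, last q} E)"
      using F C q by (auto simp: simple_graph_def vertex_pairs_def)
    have "longest_path (V, E) q" using q by (simp add: L_def)
    then have dec: "deficiency (V, insert {x, y} E) < deficiency (V, E)"
      using closing_edge_deficiency[OF F _ l3 out[OF q(1)] nh F'] q by simp
    then have "{x, y} \<notin> E" by (auto simp: insert_absorb)
    then show "{x, y} \<in> B" using dec vp by (simp add: B_def)
    show "x \<in> C" "y \<in> C" using c by auto
  qed
  have Zsub: "Z \<subseteq> C \<times> C" using red by auto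
  then have fZ: "finite Z" using fC finite_subset by blast
  have large: "real n / 8 - real d \<le> real (card (rotation_ends (V, E) q \<inter> C))" if "q \<in> L" for q
  proof -
    have lq: "longest_path (V, E) q" using that by (simp add: L_def)
    have sub: "rotation_ends (V, E) q \<subseteq> V"
      using rotations_path[of _ "(V, E)" q] pp[OF that]
      by (force simp: rotation_ends_def is_path_def)
    have "n < 8 * card (rotation_ends (V, E) q)" by (rule rotation_ends_large[OF F lq ex])
    also have "card (rotation_ends (V, E) q) \<le> card ((rotation_ends (V, E) q \<inter> C) \<union> (V - C))"
      by (rule card_mono) (use sub fV fC in auto)
    also have "\<dots> \<le> card (rotation_ends (V, E) q \<inter> C) + card (V - C)" by (rule card_Un_le)
    finally show ?thesis using C(2) by simp
  qed
  have pL: "p \<in> L" using p by (simp add: L_def)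
  let ?A = "rotation_ends (V, E) (rev p) \<inter> C"
  have rpL: "rev p \<in> L" using p longest_path_rev by (simp add: L_def)
  \<comment> \<open>Reversing q puts x at the fixed end; the rotations of \<open>rev q\<close> then
    vary the partner y of x.\<close>
  have Zb: "real n / 8 - real d \<le> real (card {y. (x, y) \<in> Z})" if xA: "x \<in> ?A" for x
  proof -
    obtain q where q: "q \<in> rotations (V, E) (rev p)" "last q = x" and xC: "x \<in> C"
      using xA by (auto simp: rotation_ends_def)
    have qL: "q \<in> L" using longest_path_rotation[OF _ q(1)] rpL by (auto simp: L_def)
    then have rq: "rev q \<in> L" using longest_path_rev by (auto simp: L_def)
    have "rotation_ends (V, E) (rev q) \<inter> C \<subseteq> {y. (x, y) \<in> Z}"
    proof
      fix y assume "y \<in> rotation_ends (V, E) (rev q) \<inter> C"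
      then obtain s where s: "s \<in> rotations (V, E) (rev q)" "last s = y" "y \<in> C"
        by (auto simp: rotation_ends_def)
      have "s \<in> L" "hd s = x" using longest_path_rotation[OF _ s(1)] rq q by (auto simp: L_def hd_rev)
      then show "y \<in> {y. (x, y) \<in> Z}" using s xC by (auto simp: Z_def)
    qed
    moreover have "finite {y. (x, y) \<in> Z}"
      by (rule finite_subset[OF _ fC]) (use Zsub in auto)
    ultimately have "card (rotation_ends (V, E) (rev q) \<inter> C) \<le> card {y. (x, y) \<in> Z}"
      by (intro card_mono)
    then show ?thesis using large[OF rq] by linarith
  qed
  have fA: "finite ?A" using fC by simp
  have nn: "0 \<le> real n / 8 - real d" using C(3) by simp
  have "(real n / 8 - real d)\<^sup>2 \<le> real (card ?A) * (real n / 8 - real d)"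
    unfolding power2_eq_square by (intro mult_right_mono large[OF rpL] nn)
  also have "\<dots> = (\<Sum>x\<in>?A. real n / 8 - real d)" by simp
  also have "\<dots> \<le> (\<Sum>x\<in>?A. real (card {y. (x, y) \<in> Z}))" by (rule sum_mono) (rule Zb)
  also have "\<dots> = real (card (SIGMA x:?A. {y. (x, y) \<in> Z}))"
    using fA by (subst card_SigmaI) (auto intro!: finite_subset[OF _ fC] dest: red)
  also have "\<dots> \<le> real (card Z)" by (intro of_nat_mono card_mono fZ) auto
  also have "card Z \<le> 2 * card ((\<lambda>(x, y). {x, y}) ` Z)" by (rule card_unordered[OF fZ red(2)])
  also have "card ((\<lambda>(x, y). {x, y}) ` Z) \<le> card B"
    by (rule card_mono) (use red fC in \<open>auto simp: B_def vertex_pairs_def\<close>)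
  finally show ?thesis by simp
qed

section \<open>Expansion of the core\<close>

definition induced :: "'a set set \<Rightarrow> 'a set \<Rightarrow> 'a set set" where
  "induced E W = {e \<in> E. e \<subseteq> W}"

text \<open>The family of these sets is closed under union, so the union is its largest member.
  Working with the vertex set alone makes the cores of H and G comparable; the edges of a core are
  the induced ones, see \<open>k_core_eq\<close>.\<close>

definition core_verts :: "nat \<Rightarrow> 'a set \<Rightarrow> 'a set set \<Rightarrow> 'a set" where
  "core_verts k V E = \<Union>{X. X \<subseteq> V \<and> (\<forall>v\<in>X. k \<le> card {e \<in> induced E X. v \<in> e})}"

lemma core_verts_subset: "core_verts k V E \<subseteq> V"
  by (auto simp: core_verts_def)

lemma core_verts_greatest:
  "X \<subseteq> V \<Longrightarrow> (\<And>v. v \<in> X \<Longrightarrow> k \<le> card {e \<in> induced E X. v \<in> e}) \<Longrightarrow> X \<subseteq> core_verts k V E"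
  by (auto simp: core_verts_def)

lemma core_verts_degree:
  assumes "finite E" "v \<in> core_verts k V E"
  shows "k \<le> card {e \<in> induced E (core_verts k V E). v \<in> e}"
proof -
  obtain X where X: "X \<subseteq> V" "\<forall>v\<in>X. k \<le> card {e \<in> induced E X. v \<in> e}" and v: "v \<in> X"
    using assms(2) by (auto simp: core_verts_def)
  have "X \<subseteq> core_verts k V E" using X by (intro core_verts_greatest) auto
  then have "card {e \<in> induced E X. v \<in> e} \<le> card {e \<in> induced E (core_verts k V E). v \<in> e}"
    using assms(1) by (intro card_mono) (auto simp: induced_def)
  then show ?thesis using X v by force
qed

lemma core_verts_mono:
  assumes "finite E'" "E \<subseteq> E'"
  shows "core_verts k V E \<subseteq> core_verts k V E'"
proof (rule core_verts_greatest[OF core_verts_subset])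
  have fE: "finite E" using assms finite_subset by blast
  fix v assume "v \<in> core_verts k V E"
  then have "k \<le> card {e \<in> induced E (core_verts k V E). v \<in> e}" by (rule core_verts_degree[OF fE])
  also have "\<dots> \<le> card {e \<in> induced E' (core_verts k V E). v \<in> e}"
    using assms by (intro card_mono) (auto simp: induced_def)
  finally show "k \<le> card {e \<in> induced E' (core_verts k V E). v \<in> e}" .
qed

text \<open>Let W be the core vertices with R present. Without R they still have degree k inside W:
  a vertex of the core of E has k edges of E there, and any other vertex meets no edge of R.\<close>

lemma core_verts_add_inside:
  assumes fin: "finite E'" "finite R" and "E \<subseteq> E'" and R: "\<And>e. e \<in> R \<Longrightarrow> e \<subseteq> core_verts k V E"
  shows "core_verts k V (E' \<union> R) = core_verts k V E'"
proof
  show "core_verts k V E' \<subseteq> core_verts k V (E' \<union> R)" using fin by (intro core_verts_mono) auto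
  let ?W = "core_verts k V (E' \<union> R)"
  let ?C = "core_verts k V E"
  have fE: "finite E" using assms finite_subset by blast
  have CW: "?C \<subseteq> ?W" using assms by (intro core_verts_mono) auto
  show "?W \<subseteq> core_verts k V E'"
  proof (rule core_verts_greatest[OF core_verts_subset])
    fix v assume v: "v \<in> ?W"
    show "k \<le> card {e \<in> induced E' ?W. v \<in> e}"
    proof (cases "v \<in> ?C")
      case True
      then have "k \<le> card {e \<in> induced E ?C. v \<in> e}" by (rule core_verts_degree[OF fE])
      also have "\<dots> \<le> card {e \<in> induced E' ?W. v \<in> e}"
        using fin CW assms(3) by (intro card_mono) (auto simp: induced_def)
      finally show ?thesis .
    next
      case False
      then have "{e \<in> induced (E' \<union> R) ?W. v \<in> e} = {e \<in> induced E' ?W. v \<in> e}"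
        using R by (auto simp: induced_def)
      then show ?thesis using core_verts_degree[OF _ v] fin by simp
    qed
  qed
qed

lemma induced_vertex_pairs: "E \<subseteq> vertex_pairs V \<Longrightarrow> induced E W \<subseteq> vertex_pairs W"
  by (auto simp: induced_def vertex_pairs_def)

lemma finite_vertex_pairs: "finite V \<Longrightarrow> finite (vertex_pairs V)"
  by (rule finite_subset[of _ "Pow V"]) (auto simp: vertex_pairs_def)

text \<open>The vertex set of any subgraph of minimum degree k is one of the sets united in
  \<open>core_verts\<close>, so no such subgraph properly extends \<open>?K\<close>.\<close>

lemma k_core_eq:
  assumes F: "simple_graph (V, E)"
  shows "k_core k (V, E) = (core_verts k V E, induced E (core_verts k V E))"
proof -
  let ?C = "core_verts k V E"
  let ?K = "(?C, induced E ?C)"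
  have fV: "finite V" and EV: "E \<subseteq> vertex_pairs V" using F by (auto simp: simple_graph_def)
  have fE: "finite E" using finite_vertex_pairs[OF fV] EV finite_subset by blast
  have sub: "subgraph ?K (V, E)"
    using fV core_verts_subset[of k V E] induced_vertex_pairs[OF EV, of ?C]
    by (auto simp: subgraph_def simple_graph_def induced_def intro: finite_subset)
  have deg: "min_degree_ge k ?K"
    using core_verts_degree[OF fE] by (auto simp: min_degree_ge_def degree_def)
  have max: "D = ?K" if D: "subgraph D (V, E)" "min_degree_ge k D" "subgraph ?K D" for D
  proof -
    have De: "edges D \<subseteq> induced E (verts D)"
      using D by (auto simp: subgraph_def simple_graph_def induced_def vertex_pairs_def)
    have "verts D \<subseteq> ?C"
    proof (rule core_verts_greatest)
      fix v assume "v \<in> verts D"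
      then have "k \<le> card {e \<in> edges D. v \<in> e}" using D by (auto simp: min_degree_ge_def degree_def)
      also have "\<dots> \<le> card {e \<in> induced E (verts D). v \<in> e}"
        using De fE by (intro card_mono) (auto simp: induced_def)
      finally show "k \<le> card {e \<in> induced E (verts D). v \<in> e}" .
    qed (use D in \<open>auto simp: subgraph_def\<close>)
    then have "verts D = ?C" using D by (auto simp: subgraph_def)
    moreover have "edges D = induced E ?C" using De D calculation by (auto simp: subgraph_def)
    ultimately show ?thesis by (simp add: prod_eq_iff)
  qed
  have "is_k_core k (V, E) ?K" unfolding is_k_core_def using sub deg max by blast
  then show ?thesis unfolding k_core_def using ex1_is_k_core[OF F, of k] by (metis the1_equality)
qed

text \<open>Peel off the vertices outside the core one by one: each has fewer than \<open>k\<close> edges to what remains.\<close>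

lemma peeling:
  assumes V: "finite V" and E: "E \<subseteq> vertex_pairs V" and j: "j \<le> card (V - core_verts k V E)"
  shows "\<exists>X\<subseteq>V. card X = j \<and> card {e \<in> E. e \<inter> X \<noteq> {}} \<le> (k - 1) * j"
  using j
proof (induction j)
  case 0
  show ?case by (rule exI[of _ "{}"]) auto
next
  case (Suc j)
  then obtain X where X: "X \<subseteq> V" "card X = j" "card {e \<in> E. e \<inter> X \<noteq> {}} \<le> (k - 1) * j" by auto
  have fE: "finite E" using finite_vertex_pairs[OF V] E finite_subset by blast
  have fX: "finite X" using V X finite_subset by blast
  have "\<not> V - X \<subseteq> core_verts k V E"
  proof
    assume "V - X \<subseteq> core_verts k V E"
    then have "V - core_verts k V E \<subseteq> X" by auto
    then have "card (V - core_verts k V E) \<le> j" using card_mono[OF fX] X by auto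
    then show False using Suc.prems by simp
  qed
  then obtain v where v: "v \<in> V - X" "\<not> k \<le> card {e \<in> induced E (V - X). v \<in> e}"
    using core_verts_greatest[of "V - X" V k E] by blast
  have "{e \<in> E. e \<inter> insert v X \<noteq> {}} \<subseteq> {e \<in> E. e \<inter> X \<noteq> {}} \<union> {e \<in> induced E (V - X). v \<in> e}"
    using E by (auto simp: induced_def vertex_pairs_def)
  then have "card {e \<in> E. e \<inter> insert v X \<noteq> {}}
      \<le> card ({e \<in> E. e \<inter> X \<noteq> {}} \<union> {e \<in> induced E (V - X). v \<in> e})"
    using fE by (intro card_mono) (auto simp: induced_def)
  also have "\<dots> \<le> card {e \<in> E. e \<inter> X \<noteq> {}} + card {e \<in> induced E (V - X). v \<in> e}"
    by (rule card_Un_le)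
  also have "\<dots> \<le> (k - 1) * j + (k - 1)" using X v by (intro add_mono) auto
  finally show ?case using X v fX by (intro exI[of _ "insert v X"]) auto
qed

lemma edge_at_card_le:
  assumes "E \<subseteq> vertex_pairs V" "finite T" "v \<in> T"
  shows "card {e \<in> E. e \<subseteq> T \<and> v \<in> e} < card T"
proof -
  have "{e \<in> E. e \<subseteq> T \<and> v \<in> e} \<subseteq> (\<lambda>w. {v, w}) ` (T - {v})"
  proof
    fix e assume e: "e \<in> {e \<in> E. e \<subseteq> T \<and> v \<in> e}"
    then have "card e = 2" using assms by (auto simp: vertex_pairs_def)
    then obtain x y where xy: "e = {x, y}" "x \<noteq> y" by (auto simp: card_2_iff)
    then show "e \<in> (\<lambda>w. {v, w}) ` (T - {v})" using e by (auto simp: insert_commute)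
  qed
  then have "card {e \<in> E. e \<subseteq> T \<and> v \<in> e} \<le> card (T - {v})"
    using assms by (intro surj_card_le) auto
  also have "\<dots> < card T" using assms by (intro card_Diff1_less)
  finally show ?thesis .
qed

text \<open>A violating set together with its neighbourhood spans too many edges if it is small, and
  misses too many edges of \<open>E\<close> if it is large.\<close>

lemma core_expander:
  assumes V: "finite V" "card V = n" and E1: "E1 \<subseteq> vertex_pairs V" "E \<subseteq> E1" and k: "15 \<le> k"
    and W: "card (V - core_verts k V E1) < x"
    and sparse: "\<And>T. T \<subseteq> V \<Longrightarrow> 16 \<le> card T \<Longrightarrow> card T < 3 * x \<Longrightarrow>
      2 * card (induced E1 T) < 5 * card T"
    and joined: "\<And>S Y. S \<subseteq> V \<Longrightarrow> Y \<subseteq> V \<Longrightarrow> S \<inter> Y = {} \<Longrightarrow> x \<le> card S \<Longrightarrow> 8 * card S \<le> n \<Longrightarrow>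
      card Y = 3 * card S \<Longrightarrow> \<exists>u\<in>S. \<exists>w\<in>V - S - Y. {u, w} \<in> E"
  shows "expander n (core_verts k V E1, induced E1 (core_verts k V E1))"
  unfolding expander_def
proof (intro allI impI)
  let ?W = "core_verts k V E1"
  let ?F = "(?W, induced E1 ?W)"
  fix S assume SW: "S \<subseteq> verts ?F" and S8: "8 * card S \<le> n"
  have fE: "finite E1" using finite_vertex_pairs[OF V(1)] E1 finite_subset by blast
  have WV: "?W \<subseteq> V" by (rule core_verts_subset)
  have fW: "finite ?W" using WV V finite_subset by blast
  have SV: "S \<subseteq> V" "finite S" using SW WV V by (auto intro: finite_subset)
  let ?N = "nbhd ?F S"
  have NW: "?N \<subseteq> ?W" "?N \<inter> S = {}" by (auto simp: nbhd_def)
  then have fN: "finite ?N" using fW finite_subset by blast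
  show "2 * card S \<le> card ?N"
  proof (rule ccontr)
    assume "\<not> 2 * card S \<le> card ?N"
    then have N: "card ?N < 2 * card S" by simp
    define T where "T = S \<union> ?N"
    have fT: "finite T" "T \<subseteq> V" using SV NW WV fN by (auto simp: T_def)
    have cT: "card T < 3 * card S"
      using N card_Un_le[of S ?N] by (simp add: T_def)
    \<comment> \<open>Core edges at S cannot leave S together with its neighbourhood, so S keeps its
      full core degree inside T.\<close>
    have deg: "15 \<le> card {e \<in> E1. e \<subseteq> T \<and> v \<in> e}" if v: "v \<in> S" for v
    proof -
      have "k \<le> card {e \<in> induced E1 ?W. v \<in> e}" using core_verts_degree[OF fE] v SW by auto
      also have "{e \<in> induced E1 ?W. v \<in> e} \<subseteq> {e \<in> E1. e \<subseteq> T \<and> v \<in> e}"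
      proof
        fix e assume e: "e \<in> {e \<in> induced E1 ?W. v \<in> e}"
        then have "card e = 2" using E1 by (auto simp: induced_def vertex_pairs_def)
        then obtain w where w: "e = {v, w}" using e by (auto simp: card_2_iff insert_commute)
        then have "w \<in> T" using e v by (auto simp: T_def nbhd_def induced_def)
        then show "e \<in> {e \<in> E1. e \<subseteq> T \<and> v \<in> e}" using e v w by (auto simp: T_def induced_def)
      qed
      then have "card {e \<in> induced E1 ?W. v \<in> e} \<le> card {e \<in> E1. e \<subseteq> T \<and> v \<in> e}"
        using fE by (intro card_mono) auto
      finally show ?thesis using k by simp
    qed
    show False
    proof (cases "x \<le> card S")
      case False
      obtain v where v: "v \<in> S" using N by (cases "S = {}") auto
      then have "v \<in> T" by (simp add: T_def)
      \<comment> \<open>One vertex with 15 edges inside T already forces 16 vertices;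
        \<open>sparse\<close> is stated only from this size on.\<close>
      then have "16 \<le> card T" using deg[OF v] edge_at_card_le[OF E1(1) fT(1)] by fastforce
      moreover have "card T < 3 * x" using cT False by simp
      ultimately have sp: "2 * card (induced E1 T) < 5 * card T" using sparse fT by blast
      have fi: "finite (induced E1 T)" using fE by (simp add: induced_def)
      \<comment> \<open>Counting incidences with S gives 15 |S| <= 2 e(T), against 2 e(T) < 5 |T| <
        15 |S|.\<close>
      have "15 * card S \<le> (\<Sum>v\<in>S. card {e \<in> induced E1 T. v \<in> e})"
        using sum_mono[of S "\<lambda>_. 15" "\<lambda>v. card {e \<in> induced E1 T. v \<in> e}"] deg
        by (simp add: induced_def conj_assoc mult.commute)
      also have "\<dots> = (\<Sum>e\<in>induced E1 T. card {v \<in> S. v \<in> e})"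
        using sum_multicount_gen[of S "induced E1 T" "\<lambda>v e. v \<in> e" "\<lambda>e. card {v \<in> S. v \<in> e}"] fi SV by simp
      also have "\<dots> \<le> (\<Sum>e\<in>induced E1 T. 2)"
      proof (rule sum_mono)
        fix e assume "e \<in> induced E1 T"
        then have "card e = 2" using E1 by (auto simp: induced_def vertex_pairs_def)
        moreover from this have "finite e" by (intro card_ge_0_finite) simp
        ultimately show "card {v \<in> S. v \<in> e} \<le> 2" using card_mono[of e "{v \<in> S. v \<in> e}"] by auto
      qed
      also have "\<dots> = 2 * card (induced E1 T)" by simp
      finally show False using sp cT by simp
    next
      case True
      \<comment> \<open>Fewer than 2 |S| neighbours and fewer than |S| vertices outside the core:
        padded to exactly 3 |S|, so that the union bound needs only one size of Y. Any further
        vertex adjacent to S would lie in the core and be a neighbour.\<close>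
      define Y0 where "Y0 = ?N \<union> (V - ?W)"
      have "card Y0 \<le> card ?N + card (V - ?W)" unfolding Y0_def by (rule card_Un_le)
      then have c: "card Y0 \<le> 3 * card S" using N W True by simp
      have Y0: "Y0 \<subseteq> V - S" using NW WV SW by (auto simp: Y0_def)
      have "3 * card S \<le> card (V - S)" using S8 V SV by (simp add: card_Diff_subset)
      then obtain Y where Y: "Y0 \<subseteq> Y" "Y \<subseteq> V - S" "card Y = 3 * card S"
        using exists_subset_between[OF c _ Y0] V by auto
      then obtain u w where uw: "u \<in> S" "w \<in> V - S - Y" "{u, w} \<in> E"
        using joined[OF SV(1) _ _ True S8] by blast
      then have "w \<in> ?W" "w \<notin> ?N" using Y by (auto simp: Y0_def)
      then show False using uw SW E1(2) by (auto simp: nbhd_def induced_def)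
    qed
  qed
qed

section \<open>Counting graphs with exceptional vertex sets\<close>

definition edge_sets :: "'a set \<Rightarrow> nat \<Rightarrow> 'a set set set" where
  "edge_sets V m = {E. E \<subseteq> vertex_pairs V \<and> card E = m}"

lemma finite_edge_sets: "finite V \<Longrightarrow> finite (edge_sets V m)"
  by (rule finite_subset[of _ "Pow (vertex_pairs V)"]) (auto simp: edge_sets_def finite_vertex_pairs)

lemma card_vertex_pairs: "finite V \<Longrightarrow> card (vertex_pairs V) = card V choose 2"
  unfolding vertex_pairs_def by (rule n_subsets)

lemma card_edge_sets: "finite V \<Longrightarrow> card (edge_sets V m) = (card V choose 2) choose m"
  unfolding edge_sets_def by (subst n_subsets) (simp_all add: finite_vertex_pairs card_vertex_pairs)

definition cross :: "'a set \<Rightarrow> 'a set \<Rightarrow> 'a set set" where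
  "cross S Z = (\<lambda>(u, w). {u, w}) ` (S \<times> Z)"

lemma cross_subset: "S \<subseteq> V \<Longrightarrow> Z \<subseteq> V \<Longrightarrow> S \<inter> Z = {} \<Longrightarrow> cross S Z \<subseteq> vertex_pairs V"
  by (fastforce simp: cross_def vertex_pairs_def card_insert_if)

lemma card_cross:
  assumes "S \<inter> Z = {}"
  shows "card (cross S Z) = card S * card Z"
proof -
  have "inj_on (\<lambda>(u, w). {u, w}) (S \<times> Z)"
    using assms by (auto simp: inj_on_def doubleton_eq_iff)
  then show ?thesis unfolding cross_def by (simp add: card_image card_cartesian_product)
qed

lemma card_edge_sets_le:
  fixes c x :: real
  assumes V: "finite V" and A: "A \<subseteq> vertex_pairs V" and m: "m \<le> card V choose 2"
    and N: "0 < card V choose 2" and x: "0 \<le> x" "x \<le> 1" and c: "0 \<le> c"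
    and Q: "\<And>S j. S \<subseteq> vertex_pairs V - A \<Longrightarrow>
      real (card {T. T \<subseteq> A \<and> card T = j \<and> Q (T \<union> S)}) \<le> c * x ^ j * real (card A choose j)"
  defines "N \<equiv> card V choose 2"
  shows "real (card {E \<in> edge_sets V m. Q E})
    \<le> c * real (N + 1) * real (N choose m) * exp (- (1 - x) * real m * real (card A) / real N)"
proof -
  have fP: "finite (vertex_pairs V)" using V by (rule finite_vertex_pairs)
  have fA: "finite A" using A fP finite_subset by blast
  have s: "A \<union> (vertex_pairs V - A) = vertex_pairs V" using A by auto
  have cA: "card A \<le> N" unfolding N_def card_vertex_pairs[OF V, symmetric] using fP A by (rule card_mono)
  have cs: "card A + card (vertex_pairs V - A) = N"
    using A fA cA by (simp add: card_Diff_subset card_vertex_pairs[OF V] N_def)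
  have "{E \<in> edge_sets V m. Q E} = {R. R \<subseteq> A \<union> (vertex_pairs V - A) \<and> card R = m \<and> Q R}"
    unfolding s by (auto simp: edge_sets_def)
  then show ?thesis
    using card_subsets_le[of A "vertex_pairs V - A" m x c Q] fA fP m N x c Q unfolding cs
    by (simp add: N_def)
qed

lemma real_card_ex_le:
  assumes "finite U" "finite Z"
  shows "real (card {E \<in> U. \<exists>z\<in>Z. P z E}) \<le> (\<Sum>z\<in>Z. real (card {E \<in> U. P z E}))"
proof -
  have "{E \<in> U. \<exists>z\<in>Z. P z E} = (\<Union>z\<in>Z. {E \<in> U. P z E})" by auto
  then have "card {E \<in> U. \<exists>z\<in>Z. P z E} \<le> (\<Sum>z\<in>Z. card {E \<in> U. P z E})"
    using card_UN_le[OF assms(2)] by simp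
  then have "real (card {E \<in> U. \<exists>z\<in>Z. P z E}) \<le> real (\<Sum>z\<in>Z. card {E \<in> U. P z E})"
    by (rule of_nat_mono)
  then show ?thesis by simp
qed

text \<open>Peeling x vertices leaves a set X of that size with at most l = (k - 1) x edges to its
  complement. The weight (5 / 2)^l (2 / 5)^j is at least 1 for every j <= l, which is a Chernoff
  bound on the number j of these edges.\<close>

lemma card_small_core_le:
  fixes V :: "'a set"
  assumes V: "finite V" "card V = n" and m: "m \<le> n choose 2" and N: "0 < n choose 2"
  defines "N \<equiv> n choose 2"
  shows "real (card {E \<in> edge_sets V m. x \<le> card (V - core_verts k V E)})
    \<le> real (N choose m) * (real (n choose x) * (5 / 2) ^ ((k - 1) * x) * real (N + 1)
        * exp (- (3 / 5) * real m * real (x * (n - x)) / real N))"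
proof -
  let ?Z = "{X. X \<subseteq> V \<and> card X = x}"
  let ?P = "\<lambda>X E. card (E \<inter> cross X (V - X)) \<le> (k - 1) * x"
  let ?b = "(5 / 2) ^ ((k - 1) * x) * real (N + 1) * real (N choose m)
        * exp (- (3 / 5) * real m * real (x * (n - x)) / real N)"
  have fZ: "finite ?Z" using V by simp
  have "{E \<in> edge_sets V m. x \<le> card (V - core_verts k V E)} \<subseteq> {E \<in> edge_sets V m. \<exists>X\<in>?Z. ?P X E}"
  proof
    fix E assume "E \<in> {E \<in> edge_sets V m. x \<le> card (V - core_verts k V E)}"
    then have E: "E \<in> edge_sets V m" "E \<subseteq> vertex_pairs V" "x \<le> card (V - core_verts k V E)"
      by (auto simp: edge_sets_def)
    obtain X where X: "X \<subseteq> V" "card X = x" "card {e \<in> E. e \<inter> X \<noteq> {}} \<le> (k - 1) * x"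
      using peeling[OF V(1) E(2,3)] by blast
    have "finite E" using E finite_vertex_pairs[OF V(1)] finite_subset by blast
    then have "card (E \<inter> cross X (V - X)) \<le> card {e \<in> E. e \<inter> X \<noteq> {}}"
      by (intro card_mono) (auto simp: cross_def)
    then show "E \<in> {E \<in> edge_sets V m. \<exists>X\<in>?Z. ?P X E}" using E X by auto
  qed
  then have "card {E \<in> edge_sets V m. x \<le> card (V - core_verts k V E)}
      \<le> card {E \<in> edge_sets V m. \<exists>X\<in>?Z. ?P X E}"
    using finite_edge_sets[OF V(1)] by (intro card_mono) auto
  then have "real (card {E \<in> edge_sets V m. x \<le> card (V - core_verts k V E)})
      \<le> real (card {E \<in> edge_sets V m. \<exists>X\<in>?Z. ?P X E})" by simp
  also have "\<dots> \<le> (\<Sum>X\<in>?Z. real (card {E \<in> edge_sets V m. ?P X E}))"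
    by (rule real_card_ex_le[OF finite_edge_sets[OF V(1)] fZ])
  also have "\<dots> \<le> (\<Sum>X\<in>?Z. ?b)"
  proof (rule sum_mono)
    fix X assume X: "X \<in> ?Z"
    let ?A = "cross X (V - X)"
    have A: "?A \<subseteq> vertex_pairs V" using X by (intro cross_subset) auto
    have fA: "finite ?A" using A finite_vertex_pairs[OF V(1)] finite_subset by blast
    have cA: "card ?A = x * (n - x)"
      using X V by (subst card_cross) (auto simp: card_Diff_subset finite_subset)
    let ?l = "(k - 1) * x"
    have Q: "real (card {T. T \<subseteq> ?A \<and> card T = j \<and> ?P X (T \<union> S)})
        \<le> (5 / 2) ^ ?l * (2 / 5) ^ j * real (card ?A choose j)" if S: "S \<subseteq> vertex_pairs V - ?A" for S j
    proof (cases "j \<le> ?l")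
      case True
      have "card {T. T \<subseteq> ?A \<and> card T = j \<and> ?P X (T \<union> S)} \<le> card {T. T \<subseteq> ?A \<and> card T = j}"
        using fA by (intro card_mono) auto
      also have "\<dots> = card ?A choose j" by (rule n_subsets[OF fA])
      finally have "real (card {T. T \<subseteq> ?A \<and> card T = j \<and> ?P X (T \<union> S)}) \<le> 1 * real (card ?A choose j)" by simp
      also have "(1::real) \<le> (5 / 2) ^ ?l * (2 / 5) ^ j"
      proof -
        have "(5 / 2 :: real) ^ j * (2 / 5) ^ j \<le> (5 / 2) ^ ?l * (2 / 5) ^ j"
          using True by (intro mult_right_mono power_increasing) auto
        then show ?thesis by (simp flip: power_mult_distrib)
      qed
      finally show ?thesis by (simp add: mult_right_mono)
    next
      case False
      have "(T \<union> S) \<inter> ?A = T" if "T \<subseteq> ?A" for T using S that by auto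
      then have "{T. T \<subseteq> ?A \<and> card T = j \<and> ?P X (T \<union> S)} = {}" using False by auto
      then show ?thesis by (simp only: card.empty) simp
    qed
    show "real (card {E \<in> edge_sets V m. ?P X E}) \<le> ?b"
      using card_edge_sets_le[OF V(1) A, of m "2 / 5" "(5 / 2) ^ ?l" "?P X", OF _ _ _ _ _ Q] m N
      unfolding V(2) cA N_def by simp
  qed
  also have "\<dots> = real (n choose x) * ?b" using n_subsets[OF V(1), of x] V(2) by simp
  finally show ?thesis by (simp add: mult_ac)
qed

text \<open>A union bound over S and Y. That no edge runs from S to the remaining vertices is the
  case x = 0 of \<open>card_edge_sets_le\<close>, where \<open>0 ^ j\<close> is 1 only for j =
  0.\<close>

lemma card_not_joined_le:
  fixes V :: "'a set"
  assumes V: "finite V" "card V = n" and m: "m \<le> n choose 2" and N: "0 < n choose 2"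
  defines "N \<equiv> n choose 2"
  shows "real (card {E \<in> edge_sets V m. \<exists>S Y. S \<subseteq> V \<and> Y \<subseteq> V \<and> S \<inter> Y = {} \<and> x \<le> card S \<and>
        8 * card S \<le> n \<and> card Y = 3 * card S \<and> \<not> (\<exists>u\<in>S. \<exists>w\<in>V - S - Y. {u, w} \<in> E)})
    \<le> real (N choose m) * (\<Sum>s | x \<le> s \<and> 8 * s \<le> n. real (n choose s) * real (n choose (3 * s))
        * real (N + 1) * exp (- real m * real (s * (n - 4 * s)) / real N))"
proof -
  let ?I = "{s. x \<le> s \<and> 8 * s \<le> n}"
  let ?J = "\<lambda>s. {S. S \<subseteq> V \<and> card S = s} \<times> {Y. Y \<subseteq> V \<and> card Y = 3 * s}"
  let ?K = "\<lambda>s. {(S, Y). (S, Y) \<in> ?J s \<and> S \<inter> Y = {}}"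
  let ?Z = "SIGMA s:?I. ?K s"
  let ?A = "\<lambda>S Y. cross S (V - S - Y)"
  let ?P = "\<lambda>(s, S, Y) E. E \<inter> ?A S Y = {}"
  let ?b = "\<lambda>s. real (N + 1) * real (N choose m) * exp (- real m * real (s * (n - 4 * s)) / real N)"
  have fI: "finite ?I" by (rule finite_subset[of _ "{..n}"]) auto
  have fJ: "finite (?J s)" for s using V by simp
  have fJ': "finite {(S, Y). (S, Y) \<in> ?J s \<and> S \<inter> Y = {}}" for s
    by (rule finite_subset[OF _ fJ[of s]]) auto
  have fZ: "finite ?Z" using fI fJ' by (intro finite_SigmaI) auto
  let ?bad = "{E \<in> edge_sets V m. \<exists>S Y. S \<subseteq> V \<and> Y \<subseteq> V \<and> S \<inter> Y = {} \<and> x \<le> card S \<and>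
        8 * card S \<le> n \<and> card Y = 3 * card S \<and> \<not> (\<exists>u\<in>S. \<exists>w\<in>V - S - Y. {u, w} \<in> E)}"
  have "?bad \<subseteq> {E \<in> edge_sets V m. \<exists>z\<in>?Z. ?P z E}"
  proof
    fix E assume "E \<in> ?bad"
    then obtain S Y where SY: "S \<subseteq> V" "Y \<subseteq> V" "S \<inter> Y = {}" "x \<le> card S" "8 * card S \<le> n"
      "card Y = 3 * card S" "\<not> (\<exists>u\<in>S. \<exists>w\<in>V - S - Y. {u, w} \<in> E)" and E: "E \<in> edge_sets V m" by blast
    have "(card S, S, Y) \<in> ?Z" using SY by auto
    moreover have "?P (card S, S, Y) E" using SY(7) by (auto simp: cross_def)
    ultimately show "E \<in> {E \<in> edge_sets V m. \<exists>z\<in>?Z. ?P z E}" using E by blast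
  qed
  then have "card ?bad \<le> card {E \<in> edge_sets V m. \<exists>z\<in>?Z. ?P z E}"
    using finite_edge_sets[OF V(1)] by (intro card_mono) auto
  then have "real (card ?bad) \<le> real (card {E \<in> edge_sets V m. \<exists>z\<in>?Z. ?P z E})" by simp
  also have "\<dots> \<le> (\<Sum>z\<in>?Z. real (card {E \<in> edge_sets V m. ?P z E}))"
    by (rule real_card_ex_le[OF finite_edge_sets[OF V(1)] fZ])
  also have "\<dots> \<le> (\<Sum>z\<in>?Z. ?b (fst z))"
  proof (rule sum_mono)
    fix z assume "z \<in> ?Z"
    then obtain s S Y where z: "z = (s, S, Y)" and SY: "S \<subseteq> V" "card S = s" "Y \<subseteq> V" "card Y = 3 * s" "S \<inter> Y = {}"
      by auto
    have A: "?A S Y \<subseteq> vertex_pairs V" using SY by (intro cross_subset) auto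
    have fSY: "finite S" "finite Y" using SY V finite_subset by blast+
    then have "card (V - S - Y) = n - 4 * s"
      using SY V by (subst card_Diff_subset; (subst card_Diff_subset)?) auto
    then have cA: "card (?A S Y) = s * (n - 4 * s)" using SY by (subst card_cross) auto
    have Q: "real (card {T. T \<subseteq> ?A S Y \<and> card T = j \<and> (T \<union> R) \<inter> ?A S Y = {}})
        \<le> 1 * 0 ^ j * real (card (?A S Y) choose j)" for R j
    proof (cases "j = 0")
      case True
      have "{T. T \<subseteq> ?A S Y \<and> card T = j \<and> (T \<union> R) \<inter> ?A S Y = {}} \<subseteq> {{}}" by blast
      then have "card {T. T \<subseteq> ?A S Y \<and> card T = j \<and> (T \<union> R) \<inter> ?A S Y = {}} \<le> card {{} :: 'a set set}"
        by (rule card_mono[rotated]) simp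
      then show ?thesis using True by simp
    next
      case False
      have "{T. T \<subseteq> ?A S Y \<and> card T = j \<and> (T \<union> R) \<inter> ?A S Y = {}} = {}"
      proof (rule equals0I)
        fix T assume T: "T \<in> {T. T \<subseteq> ?A S Y \<and> card T = j \<and> (T \<union> R) \<inter> ?A S Y = {}}"
        then have "T = {}" by blast
        then show False using T False by simp
      qed
      then show ?thesis by (simp only: card.empty) simp
    qed
    have "real (card {E \<in> edge_sets V m. E \<inter> ?A S Y = {}}) \<le> ?b s"
      using card_edge_sets_le[OF V(1) A, of m 0 1 "\<lambda>E. E \<inter> ?A S Y = {}", OF _ _ _ _ _ Q] m N
      unfolding V(2) cA N_def by simp
    then show "real (card {E \<in> edge_sets V m. ?P z E}) \<le> ?b (fst z)" by (simp only: z prod.case fst_conv)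
  qed
  also have "\<dots> = (\<Sum>(s, y)\<in>?Z. ?b s)" by (simp only: split_def)
  also have "\<dots> = (\<Sum>s\<in>?I. \<Sum>y\<in>?K s. ?b s)"
    using fI fJ' by (intro sum.Sigma[symmetric]) auto
  also have "\<dots> \<le> (\<Sum>s\<in>?I. real (N choose m) * (real (n choose s) * real (n choose (3 * s))
        * real (N + 1) * exp (- real m * real (s * (n - 4 * s)) / real N)))"
  proof (rule sum_mono)
    fix s
    have "card (?K s) \<le> card (?J s)"
      by (rule card_mono[OF fJ]) auto
    also have "\<dots> = (n choose s) * (n choose (3 * s))"
      using V by (simp add: card_cartesian_product n_subsets)
    finally have "real (card (?K s)) \<le> real (n choose s) * real (n choose (3 * s))"
      unfolding of_nat_mult[symmetric] by (rule of_nat_mono)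
    then have "real (card (?K s)) * ?b s \<le> real (n choose s) * real (n choose (3 * s)) * ?b s"
      by (rule mult_right_mono) simp
    then show "(\<Sum>y\<in>?K s. ?b s) \<le> real (N choose m) * (real (n choose s) * real (n choose (3 * s))
        * real (N + 1) * exp (- real m * real (s * (n - 4 * s)) / real N))"
      unfolding sum_constant by (simp only: mult_ac)
  qed
  finally show ?thesis by (simp add: sum_distrib_left)
qed

text \<open>A union bound over T and over the choice F of exactly \<open>(5 * t + 1) div 2\<close>
  edges inside T, the integer 5 t / 2 rounded up.\<close>

lemma card_dense_spot_le:
  fixes V :: "'a set"
  assumes V: "finite V" "card V = n" and m: "m \<le> n choose 2"
  defines "N \<equiv> n choose 2"
  shows "real (card {E \<in> edge_sets V m. \<exists>T\<subseteq>V. 16 \<le> card T \<and> card T < y \<and> 5 * card T \<le> 2 * card (induced E T)})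
    \<le> real (N choose m) * (\<Sum>t = 16..<y. real (n choose t) *
        (real ((t choose 2) choose ((5 * t + 1) div 2)) * (real m / real N) ^ ((5 * t + 1) div 2)))"
proof -
  let ?f = "\<lambda>t. (5 * t + 1) div 2"
  let ?Z = "SIGMA t:{16..<y}. SIGMA T:{T. T \<subseteq> V \<and> card T = t}. {F. F \<subseteq> vertex_pairs T \<and> card F = ?f t}"
  let ?P = "\<lambda>(t, T, F) E. F \<subseteq> E"
  have fT: "finite {F. F \<subseteq> vertex_pairs T \<and> card F = j}" if "T \<subseteq> V" for T j
    by (rule finite_subset[of _ "Pow (vertex_pairs V)"])
      (use finite_vertex_pairs[OF V(1)] that in \<open>auto simp: vertex_pairs_def\<close>)
  have fZ: "finite ?Z" using V fT by (intro finite_SigmaI) auto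
  let ?bad = "{E \<in> edge_sets V m. \<exists>T\<subseteq>V. 16 \<le> card T \<and> card T < y \<and> 5 * card T \<le> 2 * card (induced E T)}"
  have "?bad \<subseteq> {E \<in> edge_sets V m. \<exists>z\<in>?Z. ?P z E}"
  proof
    fix E assume "E \<in> ?bad"
    then obtain T where T: "T \<subseteq> V" "16 \<le> card T" "card T < y" "5 * card T \<le> 2 * card (induced E T)"
      and E: "E \<in> edge_sets V m" by blast
    have "?f (card T) \<le> card (induced E T)" using T(4) by linarith
    then obtain F where F: "F \<subseteq> induced E T" "card F = ?f (card T)"
      by (meson obtain_subset_with_card_n)
    have "induced E T \<subseteq> vertex_pairs T" by (rule induced_vertex_pairs[of E V]) (use E in \<open>simp add: edge_sets_def\<close>)
    then have "(card T, T, F) \<in> ?Z" using T F by auto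
    moreover have "?P (card T, T, F) E" using F by (auto simp: induced_def)
    ultimately show "E \<in> {E \<in> edge_sets V m. \<exists>z\<in>?Z. ?P z E}" using E by blast
  qed
  then have "card ?bad \<le> card {E \<in> edge_sets V m. \<exists>z\<in>?Z. ?P z E}"
    using finite_edge_sets[OF V(1)] by (intro card_mono) auto
  then have "real (card ?bad) \<le> real (card {E \<in> edge_sets V m. \<exists>z\<in>?Z. ?P z E})" by simp
  also have "\<dots> \<le> (\<Sum>z\<in>?Z. real (card {E \<in> edge_sets V m. ?P z E}))"
    by (rule real_card_ex_le[OF finite_edge_sets[OF V(1)] fZ])
  also have "\<dots> \<le> (\<Sum>z\<in>?Z. real (N choose m) * (real m / real N) ^ ?f (fst z))"
  proof (rule sum_mono)
    fix z assume "z \<in> ?Z"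
    then obtain t T F where z: "z = (t, T, F)" and F: "T \<subseteq> V" "F \<subseteq> vertex_pairs T" "card F = ?f t" by auto
    have "F \<subseteq> vertex_pairs V" using F by (auto simp: vertex_pairs_def)
    then have "real (card {E. E \<subseteq> vertex_pairs V \<and> card E = m \<and> F \<subseteq> E})
        \<le> real (card (vertex_pairs V) choose m) * (real m / real (card (vertex_pairs V))) ^ card F"
      by (rule card_supersets_le[OF finite_vertex_pairs[OF V(1)]]) (use m V in \<open>simp add: card_vertex_pairs\<close>)
    then show "real (card {E \<in> edge_sets V m. ?P z E}) \<le> real (N choose m) * (real m / real N) ^ ?f (fst z)"
      using F by (simp add: z edge_sets_def card_vertex_pairs V N_def conj_assoc)
  qed
  also have "\<dots> = (\<Sum>t = 16..<y. \<Sum>T | T \<subseteq> V \<and> card T = t. \<Sum>F | F \<subseteq> vertex_pairs T \<and> card F = ?f t.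
      real (N choose m) * (real m / real N) ^ ?f t)"
    using V fT by (subst sum.Sigma; (subst sum.Sigma)?) (auto simp: split_def intro!: finite_SigmaI)
  also have "\<dots> = (\<Sum>t = 16..<y. real (N choose m) * (real (n choose t) *
        (real ((t choose 2) choose ?f t) * (real m / real N) ^ ?f t)))"
  proof (rule sum.cong[OF refl])
    fix t
    have "(\<Sum>F | F \<subseteq> vertex_pairs T \<and> card F = ?f t. real (N choose m) * (real m / real N) ^ ?f t)
        = real ((t choose 2) choose ?f t) * (real (N choose m) * (real m / real N) ^ ?f t)"
      if "T \<in> {T. T \<subseteq> V \<and> card T = t}" for T
    proof -
      have "finite T" using that V finite_subset by auto
      then show ?thesis using that n_subsets[OF finite_vertex_pairs, of T "?f t"]
        by (simp add: card_vertex_pairs)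
    qed
    then have "(\<Sum>T | T \<subseteq> V \<and> card T = t. \<Sum>F | F \<subseteq> vertex_pairs T \<and> card F = ?f t.
        real (N choose m) * (real m / real N) ^ ?f t)
      = (\<Sum>T | T \<subseteq> V \<and> card T = t.
        real ((t choose 2) choose ?f t) * (real (N choose m) * (real m / real N) ^ ?f t))"
      by (intro sum.cong refl)
    also have "\<dots> = real (N choose m) * (real (n choose t) *
        (real ((t choose 2) choose ?f t) * (real m / real N) ^ ?f t))"
      using n_subsets[OF V(1), of t] unfolding V(2) sum_constant by (simp only: mult_ac)
    finally show "(\<Sum>T | T \<subseteq> V \<and> card T = t. \<Sum>F | F \<subseteq> vertex_pairs T \<and> card F = ?f t.
        real (N choose m) * (real m / real N) ^ ?f t) = real (N choose m) * (real (n choose t) *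
        (real ((t choose 2) choose ?f t) * (real m / real N) ^ ?f t))" .
  qed
  finally show ?thesis by (simp add: sum_distrib_left)
qed

text \<open>All pairs (E, R) are equally likely, so probabilities become counts. The assumption
  makes both sample spaces nonempty, as \<open>pmf_of_set\<close> requires.\<close>

lemma prob_Gnm_sprinkled:
  assumes "m + r \<le> n choose 2"
  shows "measure_pmf.prob (Gnm_sprinkled n m r) Z =
    (\<Sum>E\<in>edge_sets {1..n} m. real (card {R. R \<subseteq> vertex_pairs {1..n} - E \<and> card R = r \<and>
        (({1..n}, E), ({1..n}, E \<union> R)) \<in> Z}))
    / (real ((n choose 2) choose m) * real (((n choose 2) - m) choose r))"
proof -
  let ?V = "{1..n}"
  let ?S = "{F. simple_graph F \<and> verts F = ?V \<and> card (edges F) = m}"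
  let ?N = "n choose 2"
  have S: "?S = Pair ?V ` edge_sets ?V m"
    by (auto simp: simple_graph_def edge_sets_def image_iff)
  have inj: "inj_on (Pair ?V) (edge_sets ?V m)" by (auto simp: inj_on_def)
  have cU: "card (edge_sets ?V m) = ?N choose m" by (simp add: card_edge_sets)
  have finS: "finite ?S" unfolding S by (intro finite_imageI finite_edge_sets) simp
  have cS: "card ?S = ?N choose m" unfolding S using inj cU by (simp add: card_image)
  then have neS: "?S \<noteq> {}" using assms by (metis card.empty zero_less_binomial_iff add_leD1 less_not_refl)
  have NE: "finite {R. R \<subseteq> vertex_pairs ?V - E \<and> card R = r}"
    "card {R. R \<subseteq> vertex_pairs ?V - E \<and> card R = r} = (?N - m) choose r"
    if "E \<in> edge_sets ?V m" for E
  proof -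
    have f: "finite (vertex_pairs ?V)" by (rule finite_vertex_pairs) simp
    have E: "E \<subseteq> vertex_pairs ?V" "card E = m" using that by (auto simp: edge_sets_def)
    then have "finite E" using f finite_subset by blast
    then have "card (vertex_pairs ?V - E) = ?N - m"
      using E by (simp add: card_Diff_subset card_vertex_pairs)
    then show "card {R. R \<subseteq> vertex_pairs ?V - E \<and> card R = r} = (?N - m) choose r"
      using n_subsets[of "vertex_pairs ?V - E" r] f by simp
    show "finite {R. R \<subseteq> vertex_pairs ?V - E \<and> card R = r}"
      by (rule finite_subset[of _ "Pow (vertex_pairs ?V)"]) (use f in auto)
  qed
  have rpos: "0 < (?N - m) choose r" using assms by (simp add: zero_less_binomial_iff)
  have neR: "{R. R \<subseteq> vertex_pairs ?V - E \<and> card R = r} \<noteq> {}" if "E \<in> edge_sets ?V m" for E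
    using NE[OF that] rpos by (metis card.empty less_not_refl)
  let ?g = "\<lambda>H. map_pmf (\<lambda>G. (H, G)) (add_random_edges r H)"
  have step: "measure_pmf.expectation (?g (?V, E)) (indicator Z) =
      real (card {R. R \<subseteq> vertex_pairs ?V - E \<and> card R = r \<and> ((?V, E), (?V, E \<union> R)) \<in> Z})
      / real ((?N - m) choose r)" (is "?l = ?r") if E: "E \<in> edge_sets ?V m" for E
  proof -
    let ?R = "{R. R \<subseteq> vertex_pairs ?V - E \<and> card R = r}"
    have "?l = measure_pmf.prob (?g (?V, E)) Z" by simp
    also have "\<dots> = measure_pmf.prob (pmf_of_set ?R) {R. ((?V, E), (?V, E \<union> R)) \<in> Z}"
      by (simp add: add_random_edges_def map_pmf_comp vimage_def)
    also have "\<dots> = real (card (?R \<inter> {R. ((?V, E), (?V, E \<union> R)) \<in> Z})) / real (card ?R)"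
      by (rule measure_pmf_of_set[OF neR[OF E] NE(1)[OF E]])
    also have "\<dots> = ?r" unfolding NE(2)[OF E] by (simp add: Int_def conj_assoc)
    finally show ?thesis .
  qed
  have "measure_pmf.prob (Gnm_sprinkled n m r) Z
      = measure_pmf.expectation (pmf_of_set ?S \<bind> ?g) (indicator Z)"
    by (simp add: Gnm_sprinkled_def Gnm_def)
  also have "\<dots> = (\<Sum>F\<in>?S. measure_pmf.expectation (?g F) (indicator Z) /\<^sub>R real (card ?S))"
  proof (intro pmf_expectation_bind_pmf_of_set[OF neS finS])
    fix F assume "F \<in> ?S"
    then obtain E where "F = (?V, E)" "E \<in> edge_sets ?V m" unfolding S by auto
    then show "finite (set_pmf (?g F))"
      by (simp only: add_random_edges_def set_map_pmf fst_conv snd_conv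
          set_pmf_of_set[OF neR NE(1)] finite_imageI[OF finite_imageI] NE(1))
  qed
  also have "\<dots> = (\<Sum>E\<in>edge_sets ?V m. measure_pmf.expectation (?g (?V, E)) (indicator Z) / real (?N choose m))"
    unfolding cS unfolding S by (subst sum.reindex[OF inj]) (simp add: divide_inverse mult.commute)
  also have "\<dots> = (\<Sum>E\<in>edge_sets ?V m.
      real (card {R. R \<subseteq> vertex_pairs ?V - E \<and> card R = r \<and> ((?V, E), (?V, E \<union> R)) \<in> Z})
      / real ((?N - m) choose r) / real (?N choose m))"
    by (intro sum.cong refl arg_cong[where f = "\<lambda>z. z / real (?N choose m)"] step)
  finally show ?thesis by (simp add: sum_divide_distrib mult.commute)
qed

text \<open>A graph G with m + r edges splits into E and R in (m + r choose m) ways. Events that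
  depend only on G can thus be counted in the uniform model with m + r edges.\<close>

lemma sum_card_union_event:
  assumes V: "finite V" and N: "m + r \<le> card V choose 2"
  shows "(\<Sum>E\<in>edge_sets V m. card {R. R \<subseteq> vertex_pairs V - E \<and> card R = r \<and> P (E \<union> R)})
    = ((m + r) choose m) * card {G \<in> edge_sets V (m + r). P G}"
proof -
  have fP: "finite (vertex_pairs V)" using V by (rule finite_vertex_pairs)
  have fin: "finite E" if "E \<subseteq> vertex_pairs V" for E using that fP finite_subset by blast
  let ?X = "SIGMA E:edge_sets V m. {R. R \<subseteq> vertex_pairs V - E \<and> card R = r \<and> P (E \<union> R)}"
  let ?Y = "SIGMA G:{G \<in> edge_sets V (m + r). P G}. {E. E \<subseteq> G \<and> card E = m}"
  have "bij_betw (\<lambda>(E, R). (E \<union> R, E)) ?X ?Y"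
  proof (rule bij_betw_byWitness[where f' = "\<lambda>(G, E). (E, G - E)"])
    show "\<forall>a\<in>?X. (\<lambda>(G, E). (E, G - E)) ((\<lambda>(E, R). (E \<union> R, E)) a) = a" by auto
    show "\<forall>a\<in>?Y. (\<lambda>(E, R). (E \<union> R, E)) ((\<lambda>(G, E). (E, G - E)) a) = a" by auto
    show "(\<lambda>(E, R). (E \<union> R, E)) ` ?X \<subseteq> ?Y"
    proof (clarsimp simp: edge_sets_def)
      fix E R assume *: "E \<subseteq> vertex_pairs V" "R \<subseteq> vertex_pairs V - E" "m = card E" "r = card R"
      have "card (E \<union> R) = card E + card R" using * fin[of E] fin[of R] by (intro card_Un_disjoint) auto
      then show "R \<subseteq> vertex_pairs V \<and> card (E \<union> R) = card E + card R" using * by auto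
    qed
    show "(\<lambda>(G, E). (E, G - E)) ` ?Y \<subseteq> ?X"
    proof (clarsimp simp: edge_sets_def)
      fix G E assume *: "G \<subseteq> vertex_pairs V" "card G = card E + r" "P G" "E \<subseteq> G" "m = card E"
      have "E \<union> G = G" using * by auto
      then show "E \<subseteq> vertex_pairs V \<and> G - E \<subseteq> vertex_pairs V - E \<and> card (G - E) = r \<and> P (E \<union> G)"
        using * fin[of E] by (auto simp: card_Diff_subset)
    qed
  qed
  then have eq: "card ?X = card ?Y" by (rule bij_betw_same_card)
  have "card ?X = (\<Sum>E\<in>edge_sets V m. card {R. R \<subseteq> vertex_pairs V - E \<and> card R = r \<and> P (E \<union> R)})"
    using finite_edge_sets[OF V] fP by (intro card_SigmaI) (auto intro: finite_subset[of _ "Pow (vertex_pairs V)"])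
  moreover have "card ?Y = (\<Sum>G\<in>{G \<in> edge_sets V (m + r). P G}. card {E. E \<subseteq> G \<and> card E = m})"
    using finite_edge_sets[OF V] fin by (intro card_SigmaI) (auto simp: edge_sets_def)
  moreover have "\<dots> = (\<Sum>G\<in>{G \<in> edge_sets V (m + r). P G}. (m + r) choose m)"
    by (intro sum.cong refl) (use n_subsets[OF fin] in \<open>auto simp: edge_sets_def\<close>)
  moreover have "\<dots> = ((m + r) choose m) * card {G \<in> edge_sets V (m + r). P G}"
    by (simp only: sum_constant of_nat_id mult.commute)
  ultimately show ?thesis using eq by metis
qed

section \<open>Sprinkling inside the core\<close>

text \<open>Written as a negation so that its failure is literally the event of
  \<open>card_not_joined_le\<close>.\<close>

definition joined :: "nat \<Rightarrow> 'a set \<Rightarrow> 'a set set \<Rightarrow> bool" where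
  "joined x V E \<longleftrightarrow> \<not> (\<exists>S Y. S \<subseteq> V \<and> Y \<subseteq> V \<and> S \<inter> Y = {} \<and> x \<le> card S \<and>
     8 * card S \<le> card V \<and> card Y = 3 * card S \<and> \<not> (\<exists>u\<in>S. \<exists>w\<in>V - S - Y. {u, w} \<in> E))"

definition dense_spot :: "nat \<Rightarrow> 'a set \<Rightarrow> 'a set set \<Rightarrow> bool" where
  "dense_spot y V E \<longleftrightarrow> (\<exists>T\<subseteq>V. 16 \<le> card T \<and> card T < y \<and> 5 * card T \<le> 2 * card (induced E T))"

lemma dense_spot_mono:
  assumes "dense_spot y V E" "E \<subseteq> E'" "finite E'"
  shows "dense_spot y V E'"
proof -
  obtain T where T: "T \<subseteq> V" "16 \<le> card T" "card T < y" "5 * card T \<le> 2 * card (induced E T)"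
    using assms(1) by (auto simp: dense_spot_def)
  have "card (induced E T) \<le> card (induced E' T)"
    using assms by (intro card_mono) (auto simp: induced_def)
  then show ?thesis using T unfolding dense_spot_def by (intro exI[of _ T]) auto
qed

lemma two_times_choose_two: "2 * real (n choose 2) = real n * (real n - 1)"
  by (induction n) (simp_all add: numeral_2_eq_2 algebra_simps)

lemma n_choose_2_le: "2 * real (n choose 2) \<le> real n ^ 2"
  by (simp add: two_times_choose_two power2_eq_square algebra_simps)

lemma booster_rate_le:
  assumes "8 * x \<le> n"
  shows "(1 / 8 - real x / real n)\<^sup>2 \<le> 1"
proof -
  have "real x / real n \<le> 1 / 8" using assms by (cases "n = 0") (auto simp: field_simps)
  moreover have "0 \<le> real x / real n" by simp
  ultimately have "(1 / 8 - real x / real n)\<^sup>2 \<le> 1\<^sup>2" by (intro power_mono) linarith+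
  then show ?thesis by simp
qed

lemma vertex_pairs_mono: "A \<subseteq> B \<Longrightarrow> vertex_pairs A \<subseteq> vertex_pairs B"
  by (auto simp: vertex_pairs_def)

text \<open>Only the random edges inside the core of \<open>H\<close> are used as boosters: by
  \<open>core_verts_add_inside\<close> they do not influence the vertex set of the core of \<open>G\<close>, so that they stay
  uniformly distributed when the other random edges are revealed.\<close>

lemma card_booster_fails_le:
  assumes V: "finite V" "card V = n" and E: "E \<subseteq> vertex_pairs V" and k: "15 \<le> k"
    and ham: "hamiltonian (k_core k (V, E))"
    and C: "card (V - core_verts k V E) < x" and x8: "8 * x \<le> n"
    and jn: "joined x V E" and R0: "S \<subseteq> vertex_pairs V"
  defines "P \<equiv> vertex_pairs (core_verts k V E) - E"
  shows "real (card {T. T \<subseteq> P \<and> card T = j \<and>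
      \<not> hamiltonian (k_core k (V, E \<union> (T \<union> S))) \<and> \<not> dense_spot (3 * x) V (E \<union> (T \<union> S))})
    \<le> 2 ^ x * (1 - (1 / 8 - real x / real n)\<^sup>2 / 2) ^ j * real (card P choose j)"
proof (cases "dense_spot (3 * x) V (E \<union> S)")
  case True
  have fVP: "finite (vertex_pairs V)" by (rule finite_vertex_pairs[OF V(1)])
  have CV: "core_verts k V E \<subseteq> V" by (rule core_verts_subset)
  \<comment> \<open>A dense spot present before T is added survives, so there is nothing to
    count.\<close>
  have "dense_spot (3 * x) V (E \<union> (T \<union> S))" if "T \<subseteq> P" for T
  proof (rule dense_spot_mono[OF True])
    have "E \<union> (T \<union> S) \<subseteq> vertex_pairs V" 
      using E R0 vertex_pairs_mono[OF CV] that by (auto simp: P_def)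
    then show "finite (E \<union> (T \<union> S))" using fVP finite_subset by blast
  qed auto
  then have "{T. T \<subseteq> P \<and> card T = j \<and>
      \<not> hamiltonian (k_core k (V, E \<union> (T \<union> S))) \<and> \<not> dense_spot (3 * x) V (E \<union> (T \<union> S))} = {}" by blast
  moreover have "0 \<le> 1 - (1 / 8 - real x / real n)\<^sup>2 / 2" using booster_rate_le[OF x8] by simp
  ultimately show ?thesis by (simp only: card.empty) simp
next
  case False
  let ?C = "core_verts k V E"
  let ?E1 = "E \<union> S"
  let ?W = "core_verts k V ?E1"
  let ?\<beta> = "(1 / 8 - real x / real n)\<^sup>2"
  have fVP: "finite (vertex_pairs V)" by (rule finite_vertex_pairs[OF V(1)])
  have E1: "?E1 \<subseteq> vertex_pairs V" using E R0 by auto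
  have fE1: "finite ?E1" using E1 fVP finite_subset by blast
  have fE: "finite E" using fE1 by simp
  have CV: "?C \<subseteq> V" and WV: "?W \<subseteq> V" by (rule core_verts_subset)+
  have CW: "?C \<subseteq> ?W" by (rule core_verts_mono[OF fE1]) auto
  have fW: "finite ?W" using WV V finite_subset by blast
  have PC: "P \<subseteq> vertex_pairs ?C" by (auto simp: P_def)
  have PV: "P \<subseteq> vertex_pairs V" using PC CV by (auto simp: vertex_pairs_def)
  have fP: "finite P" using PV fVP finite_subset by blast
  have F0: "simple_graph (V, E)" using V E by (simp add: simple_graph_def)
  have ham': "hamiltonian (?C, induced E ?C)" using ham k_core_eq[OF F0] by simp
  obtain p where p: "is_path (?C, induced E ?C) p" "length p = card ?C" "3 \<le> length p"
    using path_of_hamilton_cycle[OF ham'] by auto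
  have C3: "3 \<le> card ?C" using p by simp
  then have n0: "0 < n" using CV V by (metis card_mono le_trans not_numeral_le_zero neq0_conv)
  have W0: "?W \<noteq> {}" using C3 CW by auto
  \<comment> \<open>The core after the booster candidates F have been added: its vertex set does not
    depend on F.\<close>
  let ?G = "\<lambda>F. (?W, induced ?E1 ?W \<union> F)"
  define D where "D F = deficiency (?G F)" for F
  have sg: "simple_graph (?G F)" if "F \<subseteq> P" for F
    using induced_vertex_pairs[OF E1, of ?W] that PC vertex_pairs_mono[OF CW] fW
    by (auto simp: simple_graph_def)
  have core: "k_core k (V, E \<union> (F \<union> S)) = ?G F" if F: "F \<subseteq> P" for F
  proof -
    have eq: "E \<union> (F \<union> S) = ?E1 \<union> F" by auto
    have "core_verts k V (?E1 \<union> F) = ?W"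
      using fE1 fP F PC by (intro core_verts_add_inside[where E = E])
        (auto intro: finite_subset simp: vertex_pairs_def)
    moreover have "induced (?E1 \<union> F) ?W = induced ?E1 ?W \<union> F"
      using F PC CW by (auto simp: induced_def vertex_pairs_def)
    moreover have "simple_graph (V, ?E1 \<union> F)"
      using V E1 F PV by (auto simp: simple_graph_def)
    ultimately show ?thesis unfolding eq using k_core_eq[of V "?E1 \<union> F" k] by simp
  qed
  have iff: "\<not> hamiltonian (k_core k (V, E \<union> (F \<union> S))) \<longleftrightarrow> 0 < D F" if "F \<subseteq> P" for F
    unfolding core[OF that] D_def using deficiency_pos_iff[OF sg[OF that]] W0 by simp
  have cWC: "card (?W - ?C) < x"
    by (rule le_less_trans[OF card_mono C]) (use V WV in auto)
  have Wx: "card (V - ?W) < x"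
    by (rule le_less_trans[OF card_mono C]) (use V CW in auto)
  \<comment> \<open>Expansion is established before any edge of T is added;
    \<open>expander_mono\<close> carries it along.\<close>
  have ex: "expander n (?W, induced ?E1 ?W)"
  proof (rule core_expander[OF V E1 _ k Wx])
    show "E \<subseteq> ?E1" by auto
    show "2 * card (induced ?E1 T) < 5 * card T" if "T \<subseteq> V" "16 \<le> card T" "card T < 3 * x" for T
    proof (rule ccontr)
      assume "\<not> ?thesis"
      then have "dense_spot (3 * x) V ?E1" using that unfolding dense_spot_def by (intro exI[of _ T]) auto
      then show False using False by simp
    qed
    show "\<exists>u\<in>S. \<exists>w\<in>V - S - Y. {u, w} \<in> E"
      if "S \<subseteq> V" "Y \<subseteq> V" "S \<inter> Y = {}" "x \<le> card S" "8 * card S \<le> n" "card Y = 3 * card S" for S Y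
      using jn that V(2) unfolding joined_def by blast
  qed
  have pn: "card ?C \<le> path_number (?G F)" if F: "F \<subseteq> P" for F
  proof -
    have "induced E ?C \<subseteq> induced ?E1 ?W \<union> F" using CW by (auto simp: induced_def)
    then have "is_path (?G F) p" using p(1) CW by (auto simp: is_path_def)
    then show ?thesis using path_number_ge[OF sg[OF F]] p(2) by metis
  qed
  \<comment> \<open>The Hamilton cycle of the old core gives a path with |C| vertices, and |W - C| <
    x. The strict inequality makes room for the closing edge.\<close>
  have D0: "D {} \<le> x"
  proof -
    have "D {} \<le> Suc (card ?W) - card ?C" using pn[of "{}"] by (auto simp: D_def deficiency_def)
    also have "\<dots> = Suc (card (?W - ?C))"
      using CW fW card_mono[OF fW CW] by (simp add: card_Diff_subset finite_subset)
    finally show ?thesis using cWC by simp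
  qed
  have \<beta>1: "?\<beta> \<le> 1" by (rule booster_rate_le[OF x8])
  have drop: "?\<beta> * real (card (P - F)) \<le> real (card {e \<in> P - F. D (insert e F) < D F})"
    if F: "F \<subseteq> P" and pos: "0 < D F" for F
  proof -
    let ?H = "induced ?E1 ?W \<union> F"
    let ?B = "{e \<in> vertex_pairs ?C - ?H. deficiency (?W, insert e ?H) < deficiency (?W, ?H)}"
    have "\<not> hamiltonian (?G F)" using iff[OF F] core[OF F] pos by simp
    moreover have "expander n (?G F)" by (rule expander_mono[OF ex]) (use fW in auto)
    ultimately have 1: "(real n / 8 - real x)\<^sup>2 \<le> 2 * real (card ?B)"
      using many_boosters[OF sg[OF F], of n ?C x] CW cWC x8 pn[OF F] C3 by simp
    have sub: "?B \<subseteq> {e \<in> P - F. D (insert e F) < D F}"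
    proof
      fix e assume e: "e \<in> ?B"
      then have "e \<subseteq> ?W" using CW by (auto simp: vertex_pairs_def)
      then have "e \<in> P - F" using e by (auto simp: P_def induced_def)
      then show "e \<in> {e \<in> P - F. D (insert e F) < D F}" using e by (simp add: D_def)
    qed
    \<comment> \<open>\<beta> is a lower bound on the density of boosters: at least (n / 8 - x)^2 /
      2 of them among at most n^2 / 2 remaining pairs.\<close>
    have "?\<beta> * real (card (P - F)) \<le> ?\<beta> * (real n ^ 2 / 2)"
    proof (rule mult_left_mono)
      have "card (P - F) \<le> card (vertex_pairs V)" using PV fVP by (intro card_mono) auto
      then have "real (card (P - F)) \<le> real (n choose 2)" using card_vertex_pairs[OF V(1)] V(2) by simp
      then show "real (card (P - F)) \<le> real n ^ 2 / 2" using n_choose_2_le[of n] by simp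
    qed simp
    also have "\<dots> = (real n / 8 - real x)\<^sup>2 / 2"
    proof -
      have "real n / 8 - real x = (1 / 8 - real x / real n) * real n" using n0 by (simp add: field_simps)
      then show ?thesis by (simp add: power_mult_distrib)
    qed
    also have "\<dots> \<le> real (card ?B)" using 1 by simp
    also have "\<dots> \<le> real (card {e \<in> P - F. D (insert e F) < D F})"
      using sub fP by (intro of_nat_mono card_mono) auto
    finally show ?thesis .
  qed
  have mono: "D F' \<le> D F" if "F \<subseteq> F'" "F' \<subseteq> P" for F F'
    unfolding D_def by (rule deficiency_mono[OF sg[OF that(2)]]) (use that W0 in auto)
  have "{T. T \<subseteq> P \<and> card T = j \<and>
      \<not> hamiltonian (k_core k (V, E \<union> (T \<union> S))) \<and> \<not> dense_spot (3 * x) V (E \<union> (T \<union> S))}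
    \<subseteq> {F. F \<subseteq> P \<and> card F = j \<and> 0 < D F}" using iff by auto
  then have "card {T. T \<subseteq> P \<and> card T = j \<and>
      \<not> hamiltonian (k_core k (V, E \<union> (T \<union> S))) \<and> \<not> dense_spot (3 * x) V (E \<union> (T \<union> S))}
    \<le> card {F. F \<subseteq> P \<and> card F = j \<and> 0 < D F}" using fP by (intro card_mono) auto
  then have "real (card {T. T \<subseteq> P \<and> card T = j \<and>
      \<not> hamiltonian (k_core k (V, E \<union> (T \<union> S))) \<and> \<not> dense_spot (3 * x) V (E \<union> (T \<union> S))})
    \<le> real (card {F. F \<subseteq> P \<and> card F = j \<and> 0 < D F})" by simp
  also have "\<dots> \<le> 2 ^ D {} * (1 - ?\<beta> / 2) ^ j * real (card P choose j)"
    by (rule card_sprinkling_fails_le[OF fP mono _ \<beta>1 drop]) auto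
  also have "\<dots> \<le> 2 ^ x * (1 - ?\<beta> / 2) ^ j * real (card P choose j)"
    using D0 \<beta>1 by (intro mult_right_mono power_increasing) auto
  finally show ?thesis .
qed

text \<open>R is split into its pairs inside the core of H, which act as boosters, and all others,
  which are revealed first. Then \<open>card_subsets_le\<close> applies with c = 2^x and the rate
  from \<open>card_booster_fails_le\<close>.\<close>

lemma card_sprinkled_fails_le:
  assumes V: "finite V" "card V = n" and E: "E \<in> edge_sets V m" and k: "15 \<le> k"
    and ham: "hamiltonian (k_core k (V, E))"
    and C: "card (V - core_verts k V E) < x" and x8: "8 * x \<le> n"
    and jn: "joined x V E"
  defines "M \<equiv> (n choose 2) - m"
  assumes r: "r \<le> M" "0 < M"
  shows "real (card {R. R \<subseteq> vertex_pairs V - E \<and> card R = r \<and>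
      \<not> hamiltonian (k_core k (V, E \<union> R)) \<and> \<not> dense_spot (3 * x) V (E \<union> R)})
    \<le> 2 ^ x * real (M + 1) * real (M choose r) *
      exp (- ((1 / 8 - real x / real n)\<^sup>2 / 2) * real r * (real M - real x * real n) / real M)"
proof -
  let ?C = "core_verts k V E"
  let ?A = "vertex_pairs ?C - E"
  let ?B = "vertex_pairs V - E - ?A"
  let ?\<beta> = "(1 / 8 - real x / real n)\<^sup>2"
  let ?Q = "\<lambda>R. \<not> hamiltonian (k_core k (V, E \<union> R)) \<and> \<not> dense_spot (3 * x) V (E \<union> R)"
  have EV: "E \<subseteq> vertex_pairs V" "card E = m" using E by (auto simp: edge_sets_def)
  have fVP: "finite (vertex_pairs V)" by (rule finite_vertex_pairs[OF V(1)])
  have fE: "finite E" using EV fVP finite_subset by blast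
  have CV: "?C \<subseteq> V" by (rule core_verts_subset)
  have AV: "?A \<subseteq> vertex_pairs V - E" using CV by (auto simp: vertex_pairs_def)
  have fA: "finite ?A" using AV fVP by (meson finite_Diff finite_subset)
  have cNE: "card (vertex_pairs V - E) = M"
    using EV fE V by (simp add: card_Diff_subset card_vertex_pairs M_def)
  have cAM: "card ?A \<le> M" unfolding cNE[symmetric] using fVP AV by (intro card_mono) auto
  have cAB: "card ?A + card ?B = M"
    using cNE cAM by (simp only: card_Diff_subset[OF fA AV])
  have un: "?A \<union> ?B = vertex_pairs V - E" using AV by auto
  have \<beta>1: "?\<beta> \<le> 1" by (rule booster_rate_le[OF x8])
  \<comment> \<open>A non-edge that is not inside the core has one of fewer than x vertices as an
    end.\<close>
  have "card ?B \<le> x * n"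
  proof -
    have "?B \<subseteq> (\<lambda>(u, w). {u, w}) ` ((V - ?C) \<times> V)"
    proof
      fix e assume e: "e \<in> ?B"
      then obtain a b where ab: "e = {a, b}" "a \<noteq> b" "a \<in> V" "b \<in> V"
        by (auto simp: vertex_pairs_def card_2_iff)
      have "a \<notin> ?C \<or> b \<notin> ?C" using e ab by (auto simp: vertex_pairs_def)
      then show "e \<in> (\<lambda>(u, w). {u, w}) ` ((V - ?C) \<times> V)"
        using ab by (auto simp: insert_commute intro: image_eqI[of _ _ "(a, b)"] image_eqI[of _ _ "(b, a)"])
    qed
    then have "card ?B \<le> card ((V - ?C) \<times> V)" using V by (intro surj_card_le) auto
    also have "\<dots> \<le> x * n" using C V by (simp add: card_cartesian_product)
    finally show ?thesis .
  qed
  then have "real (card ?B) \<le> real x * real n" by (metis of_nat_mono of_nat_mult)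
  then have cA: "real M - real x * real n \<le> real (card ?A)" using cAB by linarith
  have "real (card {R. R \<subseteq> ?A \<union> ?B \<and> card R = r \<and> ?Q R})
    \<le> 2 ^ x * real (card ?A + card ?B + 1) * real ((card ?A + card ?B) choose r)
      * exp (- (1 - (1 - ?\<beta> / 2)) * real r * real (card ?A) / real (card ?A + card ?B))"
  proof (rule card_subsets_le)
    fix S j assume "S \<subseteq> ?B"
    then have "S \<subseteq> vertex_pairs V" by auto
    then show "real (card {T. T \<subseteq> ?A \<and> card T = j \<and> ?Q (T \<union> S)})
        \<le> 2 ^ x * (1 - ?\<beta> / 2) ^ j * real (card ?A choose j)"
      by (rule card_booster_fails_le[OF V EV(1) k ham C x8 jn])
  qed (use fA fVP cAB r \<beta>1 in auto)
  also have "\<dots> \<le> 2 ^ x * real (M + 1) * real (M choose r) *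
      exp (- (?\<beta> / 2) * real r * (real M - real x * real n) / real M)"
    unfolding cAB
  proof (intro mult_left_mono)
    have "?\<beta> / 2 * real r * (real M - real x * real n) / real M \<le> ?\<beta> / 2 * real r * real (card ?A) / real M"
      using cA by (intro divide_right_mono mult_left_mono) auto
    then show "exp (- (1 - (1 - ?\<beta> / 2)) * real r * real (card ?A) / real M)
        \<le> exp (- (?\<beta> / 2) * real r * (real M - real x * real n) / real M)" by simp
  qed auto
  finally show ?thesis unfolding un .
qed

text \<open>The four summands bound, in this order: a small core of H, the failure of
  \<open>joined\<close> in H, a dense spot in G (hence m + r edges), and the failure of the boosters
  when none of these happens.\<close>

lemma prob_sprinkled_fails_le:
  fixes k n m r x :: nat
  assumes k: "15 \<le> k" and mr: "m + r \<le> n choose 2" and m: "m < n choose 2" and x8: "8 * x \<le> n"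
  defines "N \<equiv> n choose 2" and "M \<equiv> (n choose 2) - m"
  shows "measure_pmf.prob (Gnm_sprinkled n m r)
      {(H, G). hamiltonian (k_core k H) \<and> connected_graph (k_core k G) \<and> \<not> hamiltonian (k_core k G)}
    \<le> real (n choose x) * (5 / 2) ^ ((k - 1) * x) * real (N + 1)
        * exp (- (3 / 5) * real m * real (x * (n - x)) / real N)
    + (\<Sum>s | x \<le> s \<and> 8 * s \<le> n. real (n choose s) * real (n choose (3 * s))
        * real (N + 1) * exp (- real m * real (s * (n - 4 * s)) / real N))
    + (\<Sum>t = 16..<3 * x. real (n choose t) *
        (real ((t choose 2) choose ((5 * t + 1) div 2)) * (real (m + r) / real N) ^ ((5 * t + 1) div 2)))
    + 2 ^ x * real (M + 1) * exp (- ((1 / 8 - real x / real n)\<^sup>2 / 2) * real r * (real M - real x * real n) / real M)"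
    (is "?p \<le> ?e3 + ?e2 + ?e1 + ?e4")
proof -
  let ?V = "{1..n}"
  let ?U = "edge_sets ?V m"
  let ?Z = "{(H, G). hamiltonian (k_core k H) \<and> connected_graph (k_core k G) \<and> \<not> hamiltonian (k_core k G)}"
  let ?T3 = "{E \<in> ?U. x \<le> card (?V - core_verts k ?V E)}"
  let ?T2 = "{E \<in> ?U. \<not> joined x ?V E}"
  let ?T1 = "{G \<in> edge_sets ?V (m + r). dense_spot (3 * x) ?V G}"
  let ?c = "real (M choose r)"
  let ?all = "\<lambda>E. {R. R \<subseteq> vertex_pairs ?V - E \<and> card R = r \<and> ((?V, E), (?V, E \<union> R)) \<in> ?Z}"
  let ?ds = "\<lambda>E. {R. R \<subseteq> vertex_pairs ?V - E \<and> card R = r \<and> dense_spot (3 * x) ?V (E \<union> R)}"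
  have V: "finite ?V" "card ?V = n" by auto
  have fVP: "finite (vertex_pairs ?V)" by (rule finite_vertex_pairs[OF V(1)])
  have fU: "finite ?U" by (rule finite_edge_sets[OF V(1)])
  have M0: "0 < M" "r \<le> M" "0 < N" "m \<le> N"
    using m mr unfolding M_def N_def by linarith+
  \<comment> \<open>An exceptional E is charged with all choices of R; for the other E the sets R
    that create a dense spot are separated from those where the boosters fail.\<close>
  have each: "real (card (?all E)) \<le> (if E \<in> ?T3 then ?c else 0) + (if E \<in> ?T2 then ?c else 0)
      + real (card (?ds E)) + ?e4 * ?c" if E: "E \<in> ?U" for E
  proof -
    have EV: "E \<subseteq> vertex_pairs ?V" "card E = m" using E by (auto simp: edge_sets_def)
    have fE: "finite E" using EV fVP finite_subset by blast
    have fin: "finite {R. R \<subseteq> vertex_pairs ?V - E \<and> X R}" for X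
      by (rule finite_subset[of _ "Pow (vertex_pairs ?V)"]) (use fVP in auto)
    have e4: "0 \<le> ?e4 * ?c" by simp
    have ds0: "0 \<le> real (card (?ds E))" by simp
    have c0: "0 \<le> ?c" by simp
    have "card (?all E) \<le> card {R. R \<subseteq> vertex_pairs ?V - E \<and> card R = r}"
      by (rule card_mono[OF fin]) auto
    also have "\<dots> = M choose r"
      using n_subsets[of "vertex_pairs ?V - E" r] fVP fE EV
      by (simp add: card_Diff_subset card_vertex_pairs M_def)
    finally have triv: "real (card (?all E)) \<le> ?c" by simp
    show ?thesis
    proof (cases "E \<in> ?T3 \<or> E \<in> ?T2")
      case True
      then have "?c \<le> (if E \<in> ?T3 then ?c else 0) + (if E \<in> ?T2 then ?c else 0)"
        using c0 by (auto split: if_splits)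
      then show ?thesis using triv e4 ds0 by linarith
    next
      case False
      then have C: "card (?V - core_verts k ?V E) < x" and jn: "joined x ?V E" using E by auto
      show ?thesis
      proof (cases "hamiltonian (k_core k (?V, E))")
        case True
        let ?f = "{R. R \<subseteq> vertex_pairs ?V - E \<and> card R = r \<and>
          \<not> hamiltonian (k_core k (?V, E \<union> R)) \<and> \<not> dense_spot (3 * x) ?V (E \<union> R)}"
        have "card (?all E) \<le> card (?ds E \<union> ?f)" by (rule card_mono) (use fin in auto)
        also have "\<dots> \<le> card (?ds E) + card ?f" by (rule card_Un_le)
        finally have "real (card (?all E)) \<le> real (card (?ds E)) + real (card ?f)"
          unfolding of_nat_add[symmetric] by (rule of_nat_mono)
        moreover have "real (card ?f) \<le> ?e4 * ?c"
          using card_sprinkled_fails_le[OF V E k True C x8 jn, of r] M0 by (simp add: M_def mult_ac)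
        ultimately show ?thesis using False by auto
      next
        case False
        then have "?all E = {}" by auto
        then show ?thesis using e4 ds0 c0 by (simp only: card.empty) auto
      qed
    qed
  qed
  have s: "(\<Sum>E\<in>?U. if E \<in> X then ?c else 0) = real (card X) * ?c" if "X \<subseteq> ?U" for X
  proof -
    have "?U \<inter> X = X" using that by auto
    then show ?thesis using fU by (simp add: sum.If_cases)
  qed
  have dsum: "(\<Sum>E\<in>?U. real (card (?ds E))) = real ((m + r) choose m) * real (card ?T1)"
    using sum_card_union_event[OF V(1), of m r "dense_spot (3 * x) ?V"] mr
    by (simp flip: of_nat_sum of_nat_mult)
  have "(\<Sum>E\<in>?U. real (card (?all E)))
    \<le> (\<Sum>E\<in>?U. (if E \<in> ?T3 then ?c else 0) + (if E \<in> ?T2 then ?c else 0)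
      + real (card (?ds E)) + ?e4 * ?c)" by (rule sum_mono) (rule each)
  also have "\<dots> = real (card ?T3) * ?c + real (card ?T2) * ?c
      + real ((m + r) choose m) * real (card ?T1) + real (N choose m) * (?e4 * ?c)"
  proof -
    have "?T3 \<subseteq> ?U" "?T2 \<subseteq> ?U" by auto
    then show ?thesis
      unfolding sum.distrib dsum sum_constant card_edge_sets[OF V(1)] V(2) N_def[symmetric]
      by (simp only: s)
  qed
  also have "\<dots> \<le> (real (N choose m) * ?e3) * ?c + (real (N choose m) * ?e2) * ?c
      + real ((m + r) choose m) * (real (N choose (m + r)) * ?e1) + real (N choose m) * (?e4 * ?c)"
  proof (intro add_mono mult_right_mono mult_left_mono order_refl)
    show "real (card ?T3) \<le> real (N choose m) * ?e3"
      using card_small_core_le[OF V, of m x k] M0 by (simp add: N_def)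
    show "real (card ?T2) \<le> real (N choose m) * ?e2"
      using card_not_joined_le[OF V, of m x] M0 unfolding joined_def V(2) not_not N_def by simp
    show "real (card ?T1) \<le> real (N choose (m + r)) * ?e1"
      using card_dense_spot_le[OF V, of "m + r" "3 * x"] mr unfolding dense_spot_def N_def by simp
  qed auto
  \<comment> \<open>Choosing G and then E inside it, or E and then R, counts the same pairs; this
    brings the dense spots to the common denominator.\<close>
  also have "real ((m + r) choose m) * (real (N choose (m + r)) * ?e1) = (real (N choose m) * ?e1) * ?c"
  proof -
    have "(N choose (m + r)) * ((m + r) choose m) = (N choose m) * (M choose r)"
      using choose_mult[of m "m + r" N] mr by (simp add: M_def N_def)
    then have "real (N choose (m + r)) * real ((m + r) choose m) = real (N choose m) * ?c"
      by (simp flip: of_nat_mult)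
    then show ?thesis by (simp add: mult_ac)
  qed
  also have "(real (N choose m) * ?e3) * ?c + (real (N choose m) * ?e2) * ?c
      + (real (N choose m) * ?e1) * ?c + real (N choose m) * (?e4 * ?c)
    = (?e3 + ?e2 + ?e1 + ?e4) * (real (N choose m) * ?c)"
  proof -
    have "(p * a) * q + (p * b) * q + (p * c) * q + p * (d * q) = (a + b + c + d) * (p * q)"
      for a b c d p q :: real by (simp add: algebra_simps)
    then show ?thesis .
  qed
  finally have tot: "(\<Sum>E\<in>?U. real (card (?all E))) \<le> (?e3 + ?e2 + ?e1 + ?e4) * (real (N choose m) * ?c)" .
  have pos: "0 < real (N choose m) * ?c" using M0 by (simp add: zero_less_binomial_iff)
  show ?thesis
    unfolding prob_Gnm_sprinkled[OF mr] M_def[symmetric] unfolding N_def[symmetric]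
    unfolding pos_divide_le_eq[OF pos] by (rule tot)
qed

section \<open>Asymptotic estimates\<close>

text \<open>A rational certificate for ln a <= c: take y = c / j and check a polynomial inequality.
  A larger j makes the quadratic Taylor bound on exp sharper.\<close>

lemma ln_le_of_power_bound:
  fixes a y :: real and j :: nat
  assumes "0 < a" "0 \<le> y" "a \<le> (1 + y + y\<^sup>2 / 2) ^ j"
  shows "ln a \<le> real j * y"
proof -
  have "a \<le> exp y ^ j"
    using assms exp_lower_Taylor_quadratic[of y] by (intro order_trans[OF assms(3)] power_mono) auto
  then have "a \<le> exp (real j * y)" by (simp add: exp_of_nat_mult)
  then show ?thesis using assms(1) by (metis ln_exp ln_le_cancel_iff exp_gt_zero)
qed

lemma ln_5_2_le: "ln (5 / 2 :: real) \<le> 918 / 1000"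
  using ln_le_of_power_bound[of "5 / 2" "57375 / 1000000" 16] by (simp add: power2_eq_square power_divide)

lemma ln_50_le: "ln (50 :: real) \<le> 395 / 100"
  using ln_le_of_power_bound[of 50 "1234375 / 10000000" 32] by (simp add: power2_eq_square power_divide)

text \<open>The logarithm of 5 \<mu>^2 / 7 is replaced by its tangent at \<mu> = 104 / 3, so that
  the later inequalities become linear in \<mu>. There the value is at most 6.8, and subtracting 2
  gives the constant 4.8.\<close>

lemma ln_ratio_le:
  fixes \<mu> :: real and n x :: nat
  assumes "104 / 3 \<le> \<mu>" "0 < x" "7 * real n \<le> 5 * real x * \<mu>\<^sup>2" "0 < n"
  shows "ln (real n / real x) \<le> 48 / 10 + 6 / 104 * \<mu>"
proof -
  let ?\<mu>0 = "104 / 3 :: real"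
  have \<mu>: "0 < \<mu>" using assms(1) by simp
  have "real n / real x \<le> 5 / 7 * \<mu>\<^sup>2" using assms by (simp add: field_simps)
  then have "ln (real n / real x) \<le> ln (5 / 7 * \<mu>\<^sup>2)"
    using assms by (intro ln_mono) auto
  also have "\<dots> = ln (5 / 7 * ?\<mu>0\<^sup>2 * (\<mu> / ?\<mu>0)\<^sup>2)" by (simp add: power_divide)
  also have "\<dots> = ln (5 / 7 * ?\<mu>0\<^sup>2) + 2 * ln (\<mu> / ?\<mu>0)"
    using \<mu> by (subst ln_mult) (auto simp: ln_realpow)
  also have "\<dots> \<le> 68 / 10 + 2 * (\<mu> / ?\<mu>0 - 1)"
  proof (intro add_mono mult_left_mono)
    show "ln (5 / 7 * ?\<mu>0\<^sup>2) \<le> 68 / 10"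
      using ln_le_of_power_bound[of "5 / 7 * ?\<mu>0\<^sup>2" "10625 / 100000" 64] by (simp add: power2_eq_square power_divide)
    show "ln (\<mu> / ?\<mu>0) \<le> \<mu> / ?\<mu>0 - 1" using \<mu> by (intro ln_le_minus_one) simp
  qed simp
  finally show ?thesis by simp
qed

lemma binomial_le_exp:
  assumes "0 < k" "0 < n"
  shows "real (n choose k) \<le> exp (real k * (1 + ln (real n / real k)))"
proof -
  have "real (n choose k) \<le> (exp 1 * real n / real k) ^ k" by (rule binomial_le_exp_power[OF assms(1)])
  also have "exp 1 * real n / real k = exp (1 + ln (real n / real k))"
    using assms by (simp add: exp_add)
  finally show ?thesis by (simp add: exp_of_nat_mult)
qed

lemma edge_density_ge:
  fixes n m :: nat
  assumes "2 \<le> n"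
  shows "2 * real m / real n / real n \<le> real m / real (n choose 2)"
proof -
  have "0 < n choose 2" using assms by (simp add: zero_less_binomial_iff)
  moreover have "real (n choose 2) \<le> real n ^ 2 / 2" using n_choose_2_le[of n] by simp
  ultimately have "real m / (real n ^ 2 / 2) \<le> real m / real (n choose 2)"
    using assms by (intro divide_left_mono) auto
  then show ?thesis by (simp add: power2_eq_square mult.commute)
qed

text \<open>The factor \<open>2 / 5\<close> per edge in \<open>card_small_core_le\<close> is close to the optimal
  \<open>(k - 1) / \<mu>\<close>; a constant further away would not be good enough for \<open>k = 15\<close>.\<close>

lemma small_core_bound:
  fixes \<mu> :: real and n m x k :: nat
  assumes n: "2 \<le> n" and \<mu>: "\<mu> = 2 * real m / real n" "104 / 3 \<le> \<mu>" and k: "1 \<le> k" "7 * real k \<le> 3 * \<mu> + 1"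
    and x: "0 < x" "x \<le> n" "7 * real n \<le> 5 * real x * \<mu>\<^sup>2" "100 * real x * \<mu>\<^sup>2 \<le> 141 * real n"
  defines "N \<equiv> n choose 2"
  shows "real (n choose x) * (5 / 2) ^ ((k - 1) * x) * real (N + 1)
        * exp (- (3 / 5) * real m * real (x * (n - x)) / real N) \<le> real (N + 1) * exp (- real x / 10)"
proof -
  define \<xi> where "\<xi> = real x / real n"
  have n0: "0 < real n" using n by simp
  have \<mu>0: "0 < \<mu>" using \<mu> by simp
  have L: "ln (real n / real x) \<le> 48 / 10 + 6 / 104 * \<mu>" using ln_ratio_le[OF \<mu>(2) x(1,3)] n by simp
  have "(5 / 2 :: real) ^ ((k - 1) * x) = exp (ln (5 / 2)) ^ ((k - 1) * x)" by simp
  also have "\<dots> = exp (real ((k - 1) * x) * ln (5 / 2))" by (simp only: exp_of_nat_mult)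
  also have "\<dots> \<le> exp (real x * ((3 * \<mu> - 6) / 7 * (918 / 1000)))"
  proof -
    have "real (k - 1) \<le> (3 * \<mu> - 6) / 7" using k by (simp add: of_nat_diff)
    then have "real (k - 1) * ln (5 / 2) \<le> (3 * \<mu> - 6) / 7 * (918 / 1000)"
      using ln_5_2_le \<mu> by (intro mult_mono) auto
    then have "real x * (real (k - 1) * ln (5 / 2)) \<le> real x * ((3 * \<mu> - 6) / 7 * (918 / 1000))"
      by (intro mult_left_mono) auto
    then show ?thesis by (simp add: mult_ac)
  qed
  finally have P: "(5 / 2 :: real) ^ ((k - 1) * x) \<le> exp (real x * ((3 * \<mu> - 6) / 7 * (918 / 1000)))" .
  have "\<mu> / real n \<le> real m / real N" using edge_density_ge[OF n, of m] \<mu>(1) by (simp add: N_def)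
  then have "\<mu> / real n * real (x * (n - x)) \<le> real m / real N * real (x * (n - x))"
    by (rule mult_right_mono) simp
  moreover have "\<mu> / real n * real (x * (n - x)) = real x * (\<mu> * (1 - \<xi>))"
    using x n0 by (simp add: \<xi>_def of_nat_diff field_simps)
  ultimately have "real x * (\<mu> * (1 - \<xi>)) \<le> real m * real (x * (n - x)) / real N" by simp
  then have X: "exp (- (3 / 5) * real m * real (x * (n - x)) / real N) \<le> exp (real x * (- (3 / 5) * (\<mu> * (1 - \<xi>))))"
    by simp
  have \<xi>: "\<xi> * \<mu> \<le> 141 / 100 * (3 / 104)"
  proof -
    have "\<xi> * \<mu> * \<mu> \<le> 141 / 100" using x n0 by (simp add: \<xi>_def power2_eq_square field_simps)
    moreover have "\<xi> * \<mu> * (104 / 3) \<le> \<xi> * \<mu> * \<mu>"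
      using \<mu> \<mu>0 by (intro mult_left_mono) (auto simp: \<xi>_def)
    ultimately show ?thesis by simp
  qed
  \<comment> \<open>After inserting the bounds on the logarithm and on \<xi> \<mu> the left side is
    linear and decreasing in \<mu>. At \<mu> = 104 / 3 it is about -0.124.\<close>
  have key: "1 + ln (real n / real x) + (3 * \<mu> - 6) / 7 * (918 / 1000) - (3 / 5) * (\<mu> * (1 - \<xi>)) \<le> - 1 / 10"
  proof -
    have "1 + L + (3 * \<mu> - 6) / 7 * (918 / 1000) - (3 / 5) * w \<le> - 1 / 10"
      if "L \<le> 48 / 10 + 6 / 104 * \<mu>" "z \<le> 141 / 100 * (3 / 104)" "w = \<mu> - z" for L w z
      using that \<mu>(2) by (simp add: field_simps)
    moreover have "\<mu> * (1 - \<xi>) = \<mu> - \<xi> * \<mu>" by (simp add: algebra_simps)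
    ultimately show ?thesis using L \<xi> by blast
  qed
  have "real (n choose x) * (5 / 2) ^ ((k - 1) * x) * real (N + 1)
        * exp (- (3 / 5) * real m * real (x * (n - x)) / real N)
    \<le> exp (real x * (1 + ln (real n / real x))) * exp (real x * ((3 * \<mu> - 6) / 7 * (918 / 1000))) * real (N + 1)
      * exp (real x * (- (3 / 5) * (\<mu> * (1 - \<xi>))))"
    using binomial_le_exp[OF x(1), of n] n by (intro mult_mono P X) auto
  also have "\<dots> = real (N + 1) * exp (real x * (1 + ln (real n / real x))
      + real x * ((3 * \<mu> - 6) / 7 * (918 / 1000)) + real x * (- (3 / 5) * (\<mu> * (1 - \<xi>))))"
    by (simp only: exp_add mult_ac)
  also have "\<dots> = real (N + 1) * exp (real x *
      (1 + ln (real n / real x) + (3 * \<mu> - 6) / 7 * (918 / 1000) - (3 / 5) * (\<mu> * (1 - \<xi>))))"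
  proof -
    have "y * a + y * b + y * (- (3 / 5) * w) = y * (a + b - (3 / 5) * w)" for y a b w :: real
      by (simp add: algebra_simps)
    then show ?thesis by (simp only:)
  qed
  also have "\<dots> \<le> real (N + 1) * exp (real x * (- 1 / 10))"
    by (intro mult_left_mono exp_le_cancel_iff[THEN iffD2] mult_left_mono[OF key]) simp_all
  finally show ?thesis by simp
qed

text \<open>Per vertex of S the choices cost 1 + 4 ln (n / s), and the missing edges gain \<mu> (1 -
  4 s / n). The worst logarithm and the worst factor together would be too much, but they belong to
  opposite ends of the range of s; hence the split at n / 50.\<close>

lemma not_joined_term_bound:
  fixes \<mu> :: real and n m x s :: nat
  assumes n: "2 \<le> n" and \<mu>: "\<mu> = 2 * real m / real n" "104 / 3 \<le> \<mu>"
    and x: "0 < x" "7 * real n \<le> 5 * real x * \<mu>\<^sup>2" and s: "x \<le> s" "8 * s \<le> n"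
  defines "N \<equiv> n choose 2"
  shows "real (n choose s) * real (n choose (3 * s))
        * real (N + 1) * exp (- real m * real (s * (n - 4 * s)) / real N) \<le> real (N + 1) * exp (- real x / 2)"
proof -
  define \<sigma> where "\<sigma> = real s / real n"
  define l where "l = ln (real n / real s)"
  have n0: "0 < real n" using n by simp
  have s0: "0 < s" using x s by simp
  have \<mu>0: "0 < \<mu>" using \<mu> by simp
  have C3: "real (n choose (3 * s)) \<le> exp (real s * (3 * l))"
  proof -
    have "real (n choose (3 * s)) \<le> (exp 1 * real n / real (3 * s)) ^ (3 * s)"
      using s0 by (intro binomial_le_exp_power) simp
    \<comment> \<open>The factor e / 3 is at most 1, so the choice of Y costs 3 ln (n / s) per
      vertex of S without an additive constant.\<close>
    also have "\<dots> \<le> (real n / real s) ^ (3 * s)"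
    proof (rule power_mono)
      have "exp 1 * (real n / (3 * real s)) \<le> 3 * (real n / (3 * real s))"
        by (intro mult_right_mono exp_le) simp
      then show "exp 1 * real n / real (3 * s) \<le> real n / real s" by simp
    qed simp
    also have "real n / real s = exp l" using s0 n0 by (simp add: l_def)
    also have "exp l ^ (3 * s) = exp (real (3 * s) * l)" by (simp only: exp_of_nat_mult)
    finally show ?thesis by (simp add: mult_ac)
  qed
  have "\<mu> / real n \<le> real m / real N" using edge_density_ge[OF n, of m] \<mu>(1) by (simp add: N_def)
  then have "\<mu> / real n * real (s * (n - 4 * s)) \<le> real m / real N * real (s * (n - 4 * s))"
    by (rule mult_right_mono) simp
  moreover have "\<mu> / real n * real (s * (n - 4 * s)) = real s * (\<mu> * (1 - 4 * \<sigma>))"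
    using s n0 by (simp add: \<sigma>_def of_nat_diff field_simps)
  ultimately have "real s * (\<mu> * (1 - 4 * \<sigma>)) \<le> real m * real (s * (n - 4 * s)) / real N" by simp
  then have X: "exp (- real m * real (s * (n - 4 * s)) / real N) \<le> exp (real s * (- (\<mu> * (1 - 4 * \<sigma>))))"
    by simp
  have key: "1 + 4 * l - \<mu> * (1 - 4 * \<sigma>) \<le> - 1 / 2"
  proof (cases "50 * s \<le> n")
    case True
    have "real n / real s \<le> real n / real x" using x s by (intro divide_left_mono) auto
    then have "l \<le> ln (real n / real x)" unfolding l_def using s0 n0 x by (subst ln_le_cancel_iff) auto
    also have "\<dots> \<le> 48 / 10 + 6 / 104 * \<mu>" using ln_ratio_le[OF \<mu>(2) x] n by simp
    finally have L: "l \<le> 48 / 10 + 6 / 104 * \<mu>" .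
    have "real (50 * s) \<le> real n" using True by (rule of_nat_mono)
    then have "\<sigma> \<le> 1 / 50" using n0 by (simp add: \<sigma>_def field_simps)
    then have "\<mu> * (92 / 100) \<le> \<mu> * (1 - 4 * \<sigma>)" using \<mu>0 by (intro mult_left_mono) auto
    then show ?thesis using L \<mu>(2) by linarith
  next
    case False
    have "real n \<le> real (50 * s)" using False by (intro of_nat_mono) simp
    then have "real n / real s \<le> 50" using s0 by (simp add: field_simps)
    then have "l \<le> ln 50" unfolding l_def using s0 n0 by (subst ln_le_cancel_iff) auto
    then have L: "l \<le> 395 / 100" using ln_50_le by simp
    have "real (8 * s) \<le> real n" using s(2) by (rule of_nat_mono)
    then have "\<sigma> \<le> 1 / 8" using n0 by (simp add: \<sigma>_def field_simps)
    then have "\<mu> * (1 / 2) \<le> \<mu> * (1 - 4 * \<sigma>)" using \<mu>0 by (intro mult_left_mono) auto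
    then show ?thesis using L \<mu>(2) by linarith
  qed
  have "real (n choose s) * real (n choose (3 * s))
        * real (N + 1) * exp (- real m * real (s * (n - 4 * s)) / real N)
    \<le> exp (real s * (1 + l)) * exp (real s * (3 * l)) * real (N + 1) * exp (real s * (- (\<mu> * (1 - 4 * \<sigma>))))"
    using binomial_le_exp[OF s0, of n] n by (intro mult_mono C3 X) (auto simp: l_def)
  also have "\<dots> = real (N + 1) * exp (real s * (1 + l) + real s * (3 * l) + real s * (- (\<mu> * (1 - 4 * \<sigma>))))"
    by (simp only: exp_add mult_ac)
  also have "\<dots> = real (N + 1) * exp (real s * (1 + 4 * l - \<mu> * (1 - 4 * \<sigma>)))"
    by (simp add: algebra_simps)
  also have "\<dots> \<le> real (N + 1) * exp (- real x / 2)"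
  proof -
    have "real s * (1 + 4 * l - \<mu> * (1 - 4 * \<sigma>)) \<le> real s * (- 1 / 2)"
      using key by (intro mult_left_mono) auto
    also have "\<dots> \<le> - real x / 2" using s by simp
    finally show ?thesis by (intro mult_left_mono) auto
  qed
  finally show ?thesis .
qed

text \<open>Squaring turns the exponent \<open>5 t / 2\<close> into an integer.\<close>

lemma dense_spot_term_sq:
  fixes n m t :: nat
  assumes n: "2 \<le> n" and t: "16 \<le> t" "t \<le> n"
  defines "N \<equiv> n choose 2" and "\<mu> \<equiv> 2 * real m / real n" and "\<tau> \<equiv> real t / real n"
  assumes y: "exp 1 * \<tau> * \<mu> / 5 \<le> 1"
  shows "(real (n choose t) *
        (real ((t choose 2) choose ((5 * t + 1) div 2)) * (real m / real N) ^ ((5 * t + 1) div 2)))\<^sup>2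
    \<le> (exp 1 ^ 7 / 3125 * \<tau> ^ 3 * \<mu> ^ 5) ^ t"
proof -
  define f where "f = (5 * t + 1) div 2"
  define y where "y = exp 1 * \<tau> * \<mu> / 5"
  have f: "5 * t \<le> 2 * f" "0 < f" using t by (auto simp: f_def)
  have n0: "0 < real n" "0 < real n - 1" using n by auto
  have \<tau>0: "0 < \<tau>" using t n0 by (simp add: \<tau>_def)
  have y0: "0 \<le> y" using \<tau>0 by (simp add: y_def \<mu>_def)
  have N: "real N = real n * (real n - 1) / 2" using two_times_choose_two[of n] by (simp add: N_def)
  have "real ((t choose 2) choose f) \<le> (exp 1 * real (t choose 2) / real f) ^ f"
    by (rule binomial_le_exp_power[OF f(2)])
  then have "real ((t choose 2) choose f) * (real m / real N) ^ f
      \<le> (exp 1 * real (t choose 2) / real f) ^ f * (real m / real N) ^ f"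
    by (rule mult_right_mono) simp
  also have "\<dots> = (exp 1 * real (t choose 2) / real f * (real m / real N)) ^ f"
    by (simp only: power_mult_distrib)
  also have "\<dots> \<le> y ^ f"
  proof (rule power_mono)
    have t2: "real (t choose 2) = real t * (real t - 1) / 2" using two_times_choose_two[of t] by simp
    have "real (5 * t) \<le> real (2 * f)" using f(1) by (rule of_nat_mono)
    \<comment> \<open>As f is at least 5 t / 2, the ratio is at most (t - 1) / 5. Keeping t - 1 here
      and n - 1 in N lets their quotient be bounded by \<tau> exactly.\<close>
    then have "real (t choose 2) / real f \<le> real (t choose 2) / (5 * real t / 2)"
      using t f by (intro divide_left_mono) auto
    also have "\<dots> = (real t - 1) / 5" using t by (simp add: t2 field_simps)
    finally have 1: "real (t choose 2) / real f \<le> (real t - 1) / 5" .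
    have "(real t - 1) * real n \<le> real t * (real n - 1)" using t by (simp add: algebra_simps)
    then have 2: "(real t - 1) / (real n - 1) \<le> \<tau>" using n0 by (simp add: \<tau>_def field_simps)
    have "exp 1 * real (t choose 2) / real f * (real m / real N)
        = exp 1 * (real (t choose 2) / real f) * (real m / real N)" by simp
    also have "\<dots> \<le> exp 1 * ((real t - 1) / 5) * (real m / real N)"
      using 1 by (intro mult_right_mono mult_left_mono) auto
    also have "\<dots> = exp 1 / 5 * \<mu> * ((real t - 1) / (real n - 1))"
      using n0 by (simp add: N \<mu>_def field_simps)
    also have "\<dots> \<le> exp 1 / 5 * \<mu> * \<tau>" using 2 by (intro mult_left_mono) (auto simp: \<mu>_def)
    finally show "exp 1 * real (t choose 2) / real f * (real m / real N) \<le> y" by (simp add: y_def mult_ac)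
  qed simp
  finally have F: "real ((t choose 2) choose f) * (real m / real N) ^ f \<le> y ^ f" .
  have C: "real (n choose t) \<le> (exp 1 / \<tau>) ^ t"
    using binomial_le_exp_power[of t n] t by (simp add: \<tau>_def)
  have "real (n choose t) * (real ((t choose 2) choose f) * (real m / real N) ^ f) \<le> (exp 1 / \<tau>) ^ t * y ^ f"
    using \<tau>0 by (intro mult_mono C F) auto
  then have "(real (n choose t) * (real ((t choose 2) choose f) * (real m / real N) ^ f))\<^sup>2
      \<le> ((exp 1 / \<tau>) ^ t * y ^ f)\<^sup>2" by (intro power_mono) auto
  also have "\<dots> = ((exp 1 / \<tau>)\<^sup>2) ^ t * y ^ (2 * f)"
    by (simp add: power_mult_distrib flip: power_mult) (simp add: mult.commute)
  \<comment> \<open>Rounding 5 t / 2 up only helps because y <= 1. The exponents then combine to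
    e^(2+5), \<tau>^(5-2) and 5^5 = 3125.\<close>
  also have "\<dots> \<le> ((exp 1 / \<tau>)\<^sup>2) ^ t * y ^ (5 * t)"
    using f y0 y unfolding y_def[symmetric] by (intro mult_left_mono power_decreasing) auto
  also have "\<dots> = ((exp 1 / \<tau>)\<^sup>2 * y ^ 5) ^ t" by (simp only: power_mult_distrib power_mult)
  also have "(exp 1 / \<tau>)\<^sup>2 * y ^ 5 = exp 1 ^ 7 / 3125 * \<tau> ^ 3 * \<mu> ^ 5"
    using \<tau>0 by (simp add: y_def power_divide power_mult_distrib field_simps eval_nat_numeral)
  finally show ?thesis by (simp only: f_def)
qed

text \<open>Below sqrt n the base of the squared term is at most a power of log n times n^(-3/2);
  since t >= 16, its square root raised to the power t is at most the eighth power of that. From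
  sqrt n on the base is at most 0.81, which gives 0.9^t.\<close>

lemma dense_spot_sum_bound:
  fixes \<mu> :: real and n m r x :: nat
  assumes n: "2 \<le> n" and \<mu>: "\<mu> = 2 * real m / real n" "104 / 3 \<le> \<mu>" "\<mu> \<le> 2 * ln (real n)"
    and r: "8 * r \<le> n" and x: "3 * x \<le> n" "100 * real x * \<mu>\<^sup>2 \<le> 141 * real n"
  defines "N \<equiv> n choose 2"
  shows "(\<Sum>t = 16..<3 * x. real (n choose t) *
        (real ((t choose 2) choose ((5 * t + 1) div 2)) * (real (m + r) / real N) ^ ((5 * t + 1) div 2)))
    \<le> real n * (((2 * ln (real n) + 1) ^ 5 / sqrt (real n) ^ 3) ^ 8 + (9 / 10) powr sqrt (real n))"
    (is "(\<Sum>t = 16..<3 * x. ?a t) \<le> real n * (?b ^ 8 + ?c)")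
proof -
  have n0: "0 < real n" using n by simp
  have \<mu>0: "0 < \<mu>" using \<mu> by simp
  define \<nu> where "\<nu> = 2 * real (m + r) / real n"
  have "real (8 * r) \<le> real n" using r by (rule of_nat_mono)
  then have \<nu>: "0 \<le> \<nu>" "\<nu> \<le> \<mu> + 1 / 4" using n0 by (auto simp: \<nu>_def \<mu>(1) field_simps)
  \<comment> \<open>The n / 8 new edges raise the average degree by at most 1 / 4, and 419 / 416 = 1
    + (1 / 4) / (104 / 3).\<close>
  then have \<nu>\<mu>: "\<nu> \<le> 419 / 416 * \<mu>" using \<mu>(2) by simp
  have ln0: "0 \<le> ln (real n)" using n by simp
  have b0: "0 \<le> ?b" using ln0 n0 by simp
  have each: "?a t \<le> ?b ^ 8 + ?c" if t: "t \<in> {16..<3 * x}" for t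
  proof -
    define \<tau> where "\<tau> = real t / real n"
    define B where "B = exp 1 ^ 7 / 3125 * \<tau> ^ 3 * \<nu> ^ 5"
    have t16: "16 \<le> t" "t \<le> n" using t x by auto
    have \<tau>0: "0 < \<tau>" using t16 n0 by (simp add: \<tau>_def)
    have c0: "0 \<le> ?c" by simp
    have "real t \<le> 3 * real x" using t by simp
    then have "real t * \<mu>\<^sup>2 \<le> 3 * real x * \<mu>\<^sup>2" by (rule mult_right_mono) simp
    then have "100 * real t * \<mu>\<^sup>2 \<le> 423 * real n" using x(2) by linarith
    then have \<tau>\<mu>: "\<tau> \<le> 423 / 100 / \<mu>\<^sup>2" using n0 \<mu>0 by (simp add: \<tau>_def field_simps)
    have y: "exp 1 * \<tau> * \<nu> / 5 \<le> 1"
    proof -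
      have "\<tau> * \<nu> \<le> 423 / 100 / \<mu>\<^sup>2 * (419 / 416 * \<mu>)"
        using \<tau>\<mu> \<nu>\<mu> \<nu>(1) by (intro mult_mono) auto
      also have "\<dots> = 423 / 100 * (419 / 416) / \<mu>" using \<mu>0 by (simp add: power2_eq_square)
      also have "\<dots> \<le> 423 / 100 * (419 / 416) / (104 / 3)" using \<mu> by (intro divide_left_mono) auto
      finally have "\<tau> * \<nu> \<le> 1 / 3" by simp
      moreover have "exp 1 * (\<tau> * \<nu>) \<le> 3 * (\<tau> * \<nu>)"
        using \<tau>0 \<nu>(1) by (intro mult_right_mono exp_le) auto
      ultimately show ?thesis by simp
    qed
    have sq: "(?a t)\<^sup>2 \<le> B ^ t"
      using dense_spot_term_sq[OF n t16, of "m + r"] y unfolding B_def \<tau>_def \<nu>_def N_def by simp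
    have B0: "0 \<le> B" using \<tau>0 \<nu> by (simp add: B_def)
    have e7: "exp 1 ^ 7 / 3125 \<le> (1102 / 3125 :: real)"
    proof -
      have "exp 1 ^ 7 \<le> (272 / 100 :: real) ^ 7" using e_less_272 by (intro power_mono) auto
      also have "\<dots> \<le> 1102" by (simp add: power_divide)
      finally show ?thesis by simp
    qed
    \<comment> \<open>As \<tau> is of order at most 1 / \<mu>^2 (423 = 3 * 141), the product of
      \<tau>^3 and \<nu>^5 is of order at most 1 / \<mu>, so \<mu> = 104 / 3 is the worst case.
      There the bound is about 0.798.\<close>
    have B1: "B \<le> 81 / 100"
    proof -
      have "B \<le> 1102 / 3125 * (423 / 100 / \<mu>\<^sup>2) ^ 3 * (419 / 416 * \<mu>) ^ 5"
        unfolding B_def using \<tau>\<mu> \<nu>\<mu> \<nu>(1) \<tau>0 e7 by (intro mult_mono power_mono) auto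
      also have "\<dots> = 1102 / 3125 * (423 / 100) ^ 3 * (419 / 416) ^ 5 / \<mu>"
        using \<mu>0 by (simp add: power_divide power_mult_distrib flip: power_mult) (simp add: eval_nat_numeral)
      also have "\<dots> \<le> 1102 / 3125 * (423 / 100) ^ 3 * (419 / 416) ^ 5 / (104 / 3)"
        using \<mu> by (intro divide_left_mono) auto
      also have "\<dots> \<le> 81 / 100" by (simp add: power_divide)
      finally show ?thesis .
    qed
    show ?thesis
    proof (cases "sqrt (real n) \<le> real t")
      case True
      have "(?a t)\<^sup>2 \<le> (81 / 100) ^ t" using sq power_mono[OF B1 B0, of t] by linarith
      also have "\<dots> = ((9 / 10) ^ t)\<^sup>2" by (simp add: power_divide flip: power_mult) (simp add: power_mult mult.commute[of t 2])
      finally have "?a t \<le> (9 / 10) ^ t" by (rule power2_le_imp_le) simp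
      also have "\<dots> = (9 / 10) powr real t" by (simp add: powr_realpow)
      also have "\<dots> \<le> ?c" using True by (intro powr_mono') auto
      finally show ?thesis using b0 by (smt (verit) zero_le_power)
    next
      case False
      have "\<tau> \<le> sqrt (real n) / real n" unfolding \<tau>_def using False n0 by (intro divide_right_mono) auto
      also have "\<dots> = 1 / sqrt (real n)" using n0 by (simp add: field_simps)
      finally have \<tau>n: "\<tau> \<le> 1 / sqrt (real n)" .
      have "B \<le> 1 * (1 / sqrt (real n)) ^ 3 * (2 * ln (real n) + 1) ^ 5"
        unfolding B_def using \<tau>n \<tau>0 \<nu> \<mu>(3) e7 by (intro mult_mono power_mono) auto
      also have "\<dots> = ?b" by (simp add: power_divide)
      finally have Bb: "B \<le> ?b" .
      have "B ^ t \<le> B ^ 16" using B0 B1 t16 by (intro power_decreasing) auto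
      also have "\<dots> \<le> ?b ^ 16" using Bb B0 by (rule power_mono)
      also have "\<dots> = (?b ^ 8)\<^sup>2" by (simp flip: power_mult)
      finally have "(?a t)\<^sup>2 \<le> (?b ^ 8)\<^sup>2" using sq by linarith
      then have "?a t \<le> ?b ^ 8" by (rule power2_le_imp_le) (use b0 in simp)
      then show ?thesis using c0 by linarith
    qed
  qed
  have "(\<Sum>t = 16..<3 * x. ?a t) \<le> real (card {16..<3 * x}) * (?b ^ 8 + ?c)"
    by (rule sum_bounded_above[OF each])
  also have "\<dots> \<le> real n * (?b ^ 8 + ?c)"
  proof (rule mult_right_mono)
    have "card {16..<3 * x} \<le> n" using x by simp
    then show "real (card {16..<3 * x}) \<le> real n" by (rule of_nat_mono)
  qed (use b0 in simp)
  finally show ?thesis .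
qed

text \<open>The factor 2^x costs at most about 0.000815 n in the exponent, while the boosters gain
  about 0.000955 n; the difference exceeds n / 10000. The 1 in the exponent absorbs the rounding of
  n / 8.\<close>

lemma booster_bound:
  fixes n r x M :: nat
  assumes n: "0 < n" and x: "1000000 * x \<le> 1174 * n" and M: "499 / 1000 * real n ^ 2 \<le> real M"
    and r: "real n / 8 - 1 \<le> real r"
  shows "2 ^ x * real (M + 1) *
      exp (- ((1 / 8 - real x / real n)\<^sup>2 / 2) * real r * (real M - real x * real n) / real M)
    \<le> real (M + 1) * exp (1 - real n / 10000)"
proof -
  define \<xi> where "\<xi> = real x / real n"
  have n0: "0 < real n" using n by simp
  have "real (1000000 * x) \<le> real (1174 * n)" using x by (rule of_nat_mono)
  then have \<xi>: "0 \<le> \<xi>" "\<xi> \<le> 1174 / 1000000" using n0 by (auto simp: \<xi>_def field_simps)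
  have "0 < 499 / 1000 * real n ^ 2" using n0 by simp
  then have M0: "0 < real M" using M by linarith
  have "(123826 / 1000000)\<^sup>2 \<le> (1 / 8 - \<xi>)\<^sup>2" using \<xi> by (intro power_mono) auto
  then have q: "766 / 100000 \<le> (1 / 8 - \<xi>)\<^sup>2 / 2" by (simp add: power2_eq_square)
  have "real x * real n / real M \<le> real x * real n / (499 / 1000 * real n ^ 2)"
    using M n0 M0 by (intro divide_left_mono) auto
  also have "\<dots> = \<xi> / (499 / 1000)" using n0 by (simp add: \<xi>_def power2_eq_square)
  also have "\<dots> \<le> 24 / 10000" using \<xi> by simp
  finally have w: "9976 / 10000 \<le> (real M - real x * real n) / real M"
    using M0 by (simp add: diff_divide_distrib)
  have "766 / 100000 * (9976 / 10000) * (real n / 8 - 1) \<le> 766 / 100000 * (9976 / 10000) * real r"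
    using r by (intro mult_left_mono) auto
  also have "\<dots> \<le> (1 / 8 - \<xi>)\<^sup>2 / 2 * ((real M - real x * real n) / real M) * real r"
    using q w by (intro mult_right_mono mult_mono) auto
  finally have e: "766 / 100000 * (9976 / 10000) * (real n / 8 - 1)
      \<le> (1 / 8 - \<xi>)\<^sup>2 / 2 * ((real M - real x * real n) / real M) * real r" .
  have "(2::real) ^ x = exp (ln 2) ^ x" by simp
  also have "\<dots> = exp (real x * ln 2)" by (simp only: exp_of_nat_mult)
  finally have two: "(2::real) ^ x = exp (real x * ln 2)" .
  have "real x * ln 2 \<le> real x * (25 / 36)" using ln2_le_25_over_36 by (intro mult_left_mono) auto
  also have "\<dots> \<le> 1174 / 1000000 * real n * (25 / 36)"
    using \<xi> n0 by (simp add: \<xi>_def field_simps)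
  finally have l: "real x * ln 2 \<le> 1174 / 1000000 * real n * (25 / 36)" .
  have "real x * ln 2 - (1 / 8 - \<xi>)\<^sup>2 / 2 * ((real M - real x * real n) / real M) * real r \<le> 1 - real n / 10000"
  proof -
    have "a - Z \<le> 1 - real n / 10000"
      if "766 / 100000 * (9976 / 10000) * (real n / 8 - 1) \<le> Z" "a \<le> 1174 / 1000000 * real n * (25 / 36)" for a Z :: real
      using that n0 by simp
    then show ?thesis using e l by blast
  qed
  then have "2 ^ x * exp (- ((1 / 8 - \<xi>)\<^sup>2 / 2) * real r * (real M - real x * real n) / real M) \<le> exp (1 - real n / 10000)"
    unfolding two exp_add[symmetric] by (simp add: mult_ac)
  then have "real (M + 1) * (2 ^ x * exp (- ((1 / 8 - \<xi>)\<^sup>2 / 2) * real r * (real M - real x * real n) / real M))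
    \<le> real (M + 1) * exp (1 - real n / 10000)" by (intro mult_left_mono) auto
  then show ?thesis by (simp only: \<xi>_def mult_ac)
qed

text \<open>The threshold \<open>x\<close> is about \<open>7 n / (5 \<mu>\<^sup>2)\<close>, where \<open>\<mu>\<close> is the average degree: for much smaller \<open>x\<close>
  too many sets compete in \<open>small_core_bound\<close>, for much larger \<open>x\<close> dense spots with \<open>3 x\<close> vertices
  become likely.\<close>

lemma prob_sprinkled_fails_bound:
  fixes n m k :: nat
  assumes k: "15 \<le> k" and n: "8 \<le> n"
    and m: "1 / 6 * (7 * real k - 1) * real n \<le> real m" "real m \<le> real n * ln (real n)"
    and large: "real n * ln (real n) + real n / 8 \<le> real n * (real n - 1) / 2"
      "499 / 1000 * real n ^ 2 \<le> real n * (real n - 1) / 2 - real n * ln (real n)"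
      "400 * ln (real n) ^ 2 \<le> real n"
  shows "measure_pmf.prob (Gnm_sprinkled n m (n div 8))
      {(H, G). hamiltonian (k_core k H) \<and> connected_graph (k_core k G) \<and> \<not> hamiltonian (k_core k G)}
    \<le> real n ^ 2 * exp (- (7 / 200) * real n / ln (real n) ^ 2)
   + (real n + 1) * real n ^ 2 * exp (- (7 / 40) * real n / ln (real n) ^ 2)
   + real n * (((2 * ln (real n) + 1) ^ 5 / sqrt (real n) ^ 3) ^ 8 + (9 / 10) powr sqrt (real n))
   + real n ^ 2 * exp (1 - real n / 10000)"
proof -
  define \<mu> where "\<mu> = 2 * real m / real n"
  define x where "x = nat \<lceil>7 * real n / (5 * \<mu>\<^sup>2)\<rceil>"
  define N where "N = n choose 2"
  define M where "M = (n choose 2) - m"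
  define r where "r = n div 8"
  have n0: "0 < real n" and n2: "2 \<le> n" using n by auto
  have \<mu>k: "7 * real k \<le> 3 * \<mu> + 1" using m(1) n0 by (simp add: \<mu>_def field_simps)
  then have \<mu>1: "104 / 3 \<le> \<mu>" using k by simp
  have \<mu>2: "\<mu> \<le> 2 * ln (real n)" using m(2) n0 by (simp add: \<mu>_def field_simps)
  have \<mu>0: "0 < \<mu>" using \<mu>1 by simp
  have L0: "0 < ln (real n)" using \<mu>2 \<mu>0 by simp
  have \<mu>sq: "\<mu>\<^sup>2 \<le> 4 * ln (real n) ^ 2" using power_mono[OF \<mu>2, of 2] \<mu>0 by (simp add: power_mult_distrib)
  have xpos: "0 < 7 * real n / (5 * \<mu>\<^sup>2)" using n0 \<mu>0 by simp
  then have x0: "0 < x" by (simp add: x_def)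
  have xlo: "7 * real n / (5 * \<mu>\<^sup>2) \<le> real x" using xpos unfolding x_def by linarith
  have xhi: "real x \<le> 7 * real n / (5 * \<mu>\<^sup>2) + 1" using xpos unfolding x_def by linarith
  have x1: "7 * real n \<le> 5 * real x * \<mu>\<^sup>2" using xlo \<mu>0 by (simp add: field_simps)
  \<comment> \<open>Rounding x up adds at most 100 \<mu>^2 <= 400 ln^2 n <= n, which turns 140 into
    141.\<close>
  have x2: "100 * real x * \<mu>\<^sup>2 \<le> 141 * real n"
  proof -
    have "100 * real x * \<mu>\<^sup>2 \<le> 100 * (7 * real n / (5 * \<mu>\<^sup>2) + 1) * \<mu>\<^sup>2"
      using xhi by (intro mult_right_mono mult_left_mono) auto
    also have "\<dots> = 140 * real n + 100 * \<mu>\<^sup>2" using \<mu>0 by (simp add: field_simps)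
    finally show ?thesis using \<mu>sq large(3) by linarith
  qed
  \<comment> \<open>0.001174 is 141 / (100 (104 / 3)^2), rounded up.\<close>
  have x3: "1000000 * x \<le> 1174 * n"
  proof -
    have "(104 / 3)\<^sup>2 \<le> \<mu>\<^sup>2" using \<mu>1 by (intro power_mono) auto
    then have "100 * real x * (104 / 3)\<^sup>2 \<le> 100 * real x * \<mu>\<^sup>2" by (intro mult_left_mono) auto
    then have "100 * real x * (104 / 3)\<^sup>2 \<le> 141 * real n" using x2 by linarith
    then have "1000000 * real x \<le> 1174 * real n" by (simp add: power2_eq_square)
    then show ?thesis by linarith
  qed
  have x8: "8 * x \<le> n" and x3n: "3 * x \<le> n" and xn: "x \<le> n" using x3 by linarith+
  have N: "real N = real n * (real n - 1) / 2" using two_times_choose_two[of n] by (simp add: N_def)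
  have rn: "real r \<le> real n / 8" "real n / 8 - 1 \<le> real r" "8 * r \<le> n"
    unfolding r_def by linarith+
  have "real (m + r) \<le> real N" using m(2) rn(1) large(1) N by simp
  then have mr: "m + r \<le> n choose 2" unfolding N_def by linarith
  have r0: "0 < r" using n by (simp add: r_def)
  then have mN: "m < n choose 2" using mr by linarith
  have Mr: "real M = real N - real m" using mN by (simp add: M_def N_def of_nat_diff)
  have Mlo: "499 / 1000 * real n ^ 2 \<le> real M" using Mr N m(2) large(2) by linarith
  have N1: "real (N + 1) \<le> real n ^ 2"
  proof -
    have "real n * 8 \<le> real n * real n" using n by (intro mult_left_mono) auto
    then show ?thesis using N n by (simp add: power2_eq_square algebra_simps)
  qed
  have M1: "real (M + 1) \<le> real n ^ 2" using N1 Mr by simp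
  \<comment> \<open>Here the upper bound on m enters: \<mu> <= 2 ln n. The rates 7 / 200 and 7 / 40
    below are 1 / 10 and 1 / 2 of this 7 / 20.\<close>
  have xL: "7 / 20 * real n / ln (real n) ^ 2 \<le> real x"
  proof -
    have "7 / 20 * real n / ln (real n) ^ 2 = 7 * real n / (5 * (4 * ln (real n) ^ 2))" by simp
    also have "\<dots> \<le> 7 * real n / (5 * \<mu>\<^sup>2)" using \<mu>sq \<mu>0 L0 n0 by (intro divide_left_mono) auto
    finally show ?thesis using xlo by linarith
  qed
  have e3: "real (n choose x) * (5 / 2) ^ ((k - 1) * x) * real (N + 1)
        * exp (- (3 / 5) * real m * real (x * (n - x)) / real N)
      \<le> real n ^ 2 * exp (- (7 / 200) * real n / ln (real n) ^ 2)"
  proof -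
    have "real (n choose x) * (5 / 2) ^ ((k - 1) * x) * real (N + 1)
        * exp (- (3 / 5) * real m * real (x * (n - x)) / real N) \<le> real (N + 1) * exp (- real x / 10)"
      unfolding N_def by (rule small_core_bound[OF n2 \<mu>_def \<mu>1 _ \<mu>k x0 xn x1 x2]) (use k in simp)
    also have "\<dots> \<le> real n ^ 2 * exp (- (7 / 200) * real n / ln (real n) ^ 2)"
      using xL by (intro mult_mono N1) auto
    finally show ?thesis .
  qed
  have e2: "(\<Sum>s | x \<le> s \<and> 8 * s \<le> n. real (n choose s) * real (n choose (3 * s))
        * real (N + 1) * exp (- real m * real (s * (n - 4 * s)) / real N))
      \<le> (real n + 1) * real n ^ 2 * exp (- (7 / 40) * real n / ln (real n) ^ 2)"
  proof -
    have "(\<Sum>s | x \<le> s \<and> 8 * s \<le> n. real (n choose s) * real (n choose (3 * s))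
        * real (N + 1) * exp (- real m * real (s * (n - 4 * s)) / real N))
      \<le> real (card {s. x \<le> s \<and> 8 * s \<le> n}) * (real (N + 1) * exp (- real x / 2))"
    proof (rule sum_bounded_above)
      fix s assume "s \<in> {s. x \<le> s \<and> 8 * s \<le> n}"
      then show "real (n choose s) * real (n choose (3 * s))
        * real (N + 1) * exp (- real m * real (s * (n - 4 * s)) / real N) \<le> real (N + 1) * exp (- real x / 2)"
        unfolding N_def by (intro not_joined_term_bound[OF n2 \<mu>_def \<mu>1 x0 x1]) auto
    qed
    also have "\<dots> \<le> (real n + 1) * (real n ^ 2 * exp (- (7 / 40) * real n / ln (real n) ^ 2))"
    proof (intro mult_mono N1)
      have "card {s. x \<le> s \<and> 8 * s \<le> n} \<le> card {..n}" by (intro card_mono) auto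
      then show "real (card {s. x \<le> s \<and> 8 * s \<le> n}) \<le> real n + 1" by simp
      show "exp (- real x / 2) \<le> exp (- (7 / 40) * real n / ln (real n) ^ 2)" using xL by simp
    qed auto
    finally show ?thesis by (simp only: mult.assoc)
  qed
  have e1: "(\<Sum>t = 16..<3 * x. real (n choose t) *
        (real ((t choose 2) choose ((5 * t + 1) div 2)) * (real (m + r) / real N) ^ ((5 * t + 1) div 2)))
    \<le> real n * (((2 * ln (real n) + 1) ^ 5 / sqrt (real n) ^ 3) ^ 8 + (9 / 10) powr sqrt (real n))"
    unfolding N_def by (rule dense_spot_sum_bound[OF n2 \<mu>_def \<mu>1 \<mu>2 rn(3) x3n x2])
  have e4: "2 ^ x * real (M + 1) * exp (- ((1 / 8 - real x / real n)\<^sup>2 / 2) * real r * (real M - real x * real n) / real M)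
      \<le> real n ^ 2 * exp (1 - real n / 10000)"
  proof -
    have "2 ^ x * real (M + 1) * exp (- ((1 / 8 - real x / real n)\<^sup>2 / 2) * real r * (real M - real x * real n) / real M)
      \<le> real (M + 1) * exp (1 - real n / 10000)"
      by (rule booster_bound[OF _ x3 Mlo rn(2)]) (use n in simp)
    also have "\<dots> \<le> real n ^ 2 * exp (1 - real n / 10000)" by (intro mult_right_mono M1) simp
    finally show ?thesis .
  qed
  show ?thesis
    using prob_sprinkled_fails_le[OF k mr mN x8] e1 e2 e3 e4
    unfolding M_def[symmetric] N_def[symmetric] unfolding r_def[symmetric] M_def N_def by linarith
qed

theorem theorem2p2:
  fixes k :: nat and m :: "nat \<Rightarrow> nat"
  assumes "k \<ge> 15"
    and "\<forall>\<^sub>F n in sequentially.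
           1 / 6 * (7 * real k - 1) * real n \<le> real (m n) \<and> real (m n) \<le> real n * ln (real n)"
  shows "(\<lambda>n. measure_pmf.prob (Gnm_sprinkled n (m n) (n div 8))
             {(H, G). hamiltonian (k_core k H) \<and>
                connected_graph (k_core k G) \<and> \<not> hamiltonian (k_core k G)})
         \<in> o(\<lambda>n. 1 / real n ^ 3)"
proof -
  let ?g = "\<lambda>n. real n ^ 2 * exp (- (7 / 200) * real n / ln (real n) ^ 2)
   + (real n + 1) * real n ^ 2 * exp (- (7 / 40) * real n / ln (real n) ^ 2)
   + real n * (((2 * ln (real n) + 1) ^ 5 / sqrt (real n) ^ 3) ^ 8 + (9 / 10) powr sqrt (real n))
   + real n ^ 2 * exp (1 - real n / 10000)"
  let ?p = "\<lambda>n. measure_pmf.prob (Gnm_sprinkled n (m n) (n div 8))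
             {(H, G). hamiltonian (k_core k H) \<and>
                connected_graph (k_core k G) \<and> \<not> hamiltonian (k_core k G)}"
  have large: "\<forall>\<^sub>F n in sequentially. real n * ln (real n) + real n / 8 \<le> real n * (real n - 1) / 2"
    "\<forall>\<^sub>F n in sequentially. 499 / 1000 * real n ^ 2 \<le> real n * (real n - 1) / 2 - real n * ln (real n)"
    "\<forall>\<^sub>F n in sequentially. 400 * ln (real n) ^ 2 \<le> real n"
    by real_asymp+
  have "\<forall>\<^sub>F n in sequentially. ?p n \<le> ?g n"
    using assms(2) large eventually_ge_at_top[of 8]
    by eventually_elim (rule prob_sprinkled_fails_bound[OF assms(1)]; simp)
  then have "?p \<in> O(?g)"
    by (intro landau_o.big_mono) (auto elim!: eventually_mono)
  \<comment> \<open>The slowest summand comes from the dense spots below sqrt n: n times n^(-12), up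
    to powers of log n. All others decay faster than any power of n.\<close>
  moreover have "?g \<in> o(\<lambda>n. 1 / real n ^ 3)" by real_asymp
  ultimately show ?thesis by (rule landau_o.big_small_trans)
qed

end
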